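(* Let $E\in \mathcal{I}\cup\mathcal{I}_{\mathcal{R}}$, i.e. $E\subset\mathbb{H}^n$ is a compact isodiametric set, or a compact rotationally invariant set that is isodiametric within the class of rotationally invariant sets. Let $f^\pm$, $U$ and $\hat E$ be associated with $E$ as in the context. Then the following properties hold. (i) $E$ is $t$-convex. (ii) $\mathcal{L}^{2n+1}(\hat E)=\mathcal{L}^{2n+1}(E)$ and $\operatorname{diam}\hat E=\operatorname{diam}E$. (iii) If $E\in\mathcal{I}$ then $\hat E\in\mathcal{I}$, and if $E\in\mathcal{I}_{\mathcal{R}}$ then $\hat E\in\mathcal{I}_{\mathcal{R}}$. (iv) The set $U$ is open in $\mathbb{C}^n$, and the maps $f^-$ and $f^+$ are locally Lipschitz on $U$ and continuous on $\pi(E)$. (v) We have $$\operatorname{int}E=\operatorname{int}\hat E=\{[z,t]\in\mathbb{H}^n : z\in U,\ f^-(z)<t<f^+(z)\},$$ $$\partial\hat E=\{[z,f^{\pm}(z)]\in\mathbb{H}^n : z\in\overline U\},\qquad \hat E=\overline{\operatorname{int}E}.$$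
   Context: Let $n\ge 1$. The Heisenberg group is $\mathbb{H}^n=\mathbb{C}^n\times\mathbb{R}\approx\mathbb{R}^{2n+1}$ with points $[z,t]$, $z=(z_1,\dots,z_n)$, $z_j=x_j+iy_j$, and group law $[z,t]\cdot[z',t']=[z+z',\,t+t'+2\operatorname{Im} z\overline{z}']$, where $\operatorname{Im} z\overline z'=\sum_j\operatorname{Im} z_j\overline{z}'_j$. Put $X_j=\partial_{x_j}+2y_j\partial_t$, $Y_j=\partial_{y_j}-2x_j\partial_t$. A curve is horizontal if it is absolutely continuous and its tangent vector lies a.e. in $\operatorname{span}\{X_j,Y_j\}_{j}$. Fix the left-invariant Riemannian metric making $(X_1,\dots,X_n,Y_1,\dots,Y_n,\partial_t)$ orthonormal; the Carnot-Carathéodory distance $d(p,q)$ is the infimum of the Riemannian lengths of horizontal curves joining $p$ to $q$. It induces the usual topology. Diameters are with respect to $d$; $\mathcal{L}^{2n+1}$ is Lebesgue (outer) measure on $\mathbb{R}^{2n+1}$; $\pi([z,t])=z$. Isodiametric classes: $C_I=\sup\{\mathcal{L}^{2n+1}(F)/(\operatorname{diam}F)^{2n+2} : F\subset\mathbb{H}^n,\ 0<\operatorname{diam}F<+\infty\}$ and $\mathcal{I}=\{E\subset\mathbb{H}^n : E \text{ compact},\ \operatorname{diam}E>0,\ \mathcal{L}^{2n+1}(E)=C_I(\operatorname{diam}E)^{2n+2}\}$. For $\theta\in\mathbb{R}^n$ let $r_\theta([z,t])=[(e^{i\theta_1}z_1,\dots,e^{i\theta_n}z_n),t]$, and let $\mathcal{R}=\{F\subset\mathbb{H}^n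 : r_\theta(F)\subset F\text{ for all }\theta\in\mathbb{R}^n\}$ (rotationally invariant sets). $C_{I,\mathcal{R}}$ is the supremum of $\mathcal{L}^{2n+1}(F)/(\operatorname{diam}F)^{2n+2}$ over $F\in\mathcal{R}$ with $0<\operatorname{diam}F<+\infty$, and $\mathcal{I}_{\mathcal{R}}=\{E\in\mathcal{R} : E\text{ compact},\ \operatorname{diam}E>0,\ \mathcal{L}^{2n+1}(E)=C_{I,\mathcal{R}}(\operatorname{diam}E)^{2n+2}\}$. A set $F\subset\mathbb{H}^n$ is $t$-convex if, whenever $[z,t_1],[z,t_2]\in F$ with $t_1\le t_2$, also $[z,t]\in F$ for all $t\in[t_1,t_2]$. For a compact set $E\subset\mathbb{H}^n$ and $z\in\pi(E)$: $f^+(z)=\max\{t : [z,t]\in E\}$, $f^-(z)=\min\{t : [z,t]\in E\}$; $U=\{z\in\pi(E) : f^-(z)<f^+(z)\}$; $\hat E=\{[z,t]\in\mathbb{H}^n : z\in\overline U,\ f^-(z)\le t\le f^+(z)\}$ (note $\overline U\subset\pi(E)$). *)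

theory Defs
  imports "HOL-Analysis.Analysis"
begin

text \<open>Points [z, t] of the Heisenberg group are pairs in C^n x R, with n = CARD('n). This product
  type carries the Euclidean norm, topology and Lebesgue measure of R^(2n+1), and its vectors are
  also used as tangent vectors.\<close>

type_synonym 'n heis = "(complex ^ 'n) \<times> real"

definition heis_mult :: "'n::finite heis \<Rightarrow> 'n heis \<Rightarrow> 'n heis" where
  "heis_mult p q =
     (fst p + fst q, snd p + snd q + 2 * (\<Sum>j\<in>UNIV. Im (fst p $ j * cnj (fst q $ j))))"

definition X_field :: "'n::finite \<Rightarrow> 'n heis \<Rightarrow> 'n heis" where
  "X_field j p = (axis j 1, 2 * Im (fst p $ j))"

definition Y_field :: "'n::finite \<Rightarrow> 'n heis \<Rightarrow> 'n heis" where
  "Y_field j p = (axis j \<i>, - 2 * Re (fst p $ j))"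

definition T_field :: "'n::finite heis \<Rightarrow> 'n heis" where
  "T_field p = (0, 1)"

definition horizontal_space :: "'n::finite heis \<Rightarrow> 'n heis set" where
  "horizontal_space p = span (range (\<lambda>j. X_field j p) \<union> range (\<lambda>j. Y_field j p))"

text \<open>In the frame at p, the coordinates of v along X_j and Y_j are the real and imaginary parts of
  the j-th component of v; the coordinate along the vertical field is the following one.\<close>

definition T_coord :: "'n::finite heis \<Rightarrow> 'n heis \<Rightarrow> real" where
  "T_coord p v = snd v - 2 * (\<Sum>j\<in>UNIV. Im (fst p $ j * cnj (fst v $ j)))"

definition heis_metric :: "'n::finite heis \<Rightarrow> 'n heis \<Rightarrow> 'n heis \<Rightarrow> real" where
  "heis_metric p v w = fst v \<bullet> fst w + T_coord p v * T_coord p w"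

lemma frame_expansion:
  "v = (\<Sum>j\<in>UNIV. Re (fst v $ j) *\<^sub>R X_field j p) + (\<Sum>j\<in>UNIV. Im (fst v $ j) *\<^sub>R Y_field j p)
       + T_coord p v *\<^sub>R T_field p"
proof (rule prod_eqI)
  show "fst v = fst ((\<Sum>j\<in>UNIV. Re (fst v $ j) *\<^sub>R X_field j p) +
      (\<Sum>j\<in>UNIV. Im (fst v $ j) *\<^sub>R Y_field j p) + T_coord p v *\<^sub>R T_field p)"
    by (auto simp: vec_eq_iff fst_sum X_field_def Y_field_def T_field_def axis_def complex_eq_iff
        if_distrib sum.delta cong: if_cong)
  show "snd v = snd ((\<Sum>j\<in>UNIV. Re (fst v $ j) *\<^sub>R X_field j p) +
      (\<Sum>j\<in>UNIV. Im (fst v $ j) *\<^sub>R Y_field j p) + T_coord p v *\<^sub>R T_field p)"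
    by (simp add: snd_sum X_field_def Y_field_def T_field_def T_coord_def sum_distrib_left
        algebra_simps flip: sum.distrib)
qed

lemma frame_orthonormal:
  "heis_metric p (X_field i p) (X_field j p) = (if i = j then 1 else 0)"
  "heis_metric p (Y_field i p) (Y_field j p) = (if i = j then 1 else 0)"
  "heis_metric p (X_field i p) (Y_field j p) = 0"
  "heis_metric p (X_field i p) (T_field p) = 0"
  "heis_metric p (Y_field i p) (T_field p) = 0"
  "heis_metric p (T_field p) (T_field p) = 1"
proof -
  have X: "T_coord p (X_field i p) = 0" for i
    by (simp add: T_coord_def X_field_def axis_def if_distrib sum.delta cong: if_cong)
  have Y: "T_coord p (Y_field i p) = 0" for i
    by (simp add: T_coord_def Y_field_def axis_def if_distrib sum.delta cong: if_cong)
  have T: "T_coord p (T_field p) = 1"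
    by (simp add: T_coord_def T_field_def)
  show "heis_metric p (X_field i p) (X_field j p) = (if i = j then 1 else 0)"
    "heis_metric p (Y_field i p) (Y_field j p) = (if i = j then 1 else 0)"
    "heis_metric p (X_field i p) (Y_field j p) = 0"
    "heis_metric p (X_field i p) (T_field p) = 0"
    "heis_metric p (Y_field i p) (T_field p) = 0"
    "heis_metric p (T_field p) (T_field p) = 1"
    by (simp_all add: heis_metric_def X Y T)
       (auto simp: X_field_def Y_field_def T_field_def inner_axis_axis inner_complex_def)
qed

lemma heis_mult_has_derivative:
  "(heis_mult p has_derivative
     (\<lambda>v. (fst v, snd v + 2 * (\<Sum>j\<in>UNIV. Im (fst p $ j * cnj (fst v $ j)))))) (at q)"
  unfolding heis_mult_def
  by (auto intro!: derivative_eq_intros bounded_linear.has_derivative[OF bounded_linear_vec_nth])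

lemma heis_metric_left_invariant:
  fixes p q v w :: "'n::finite heis"
  defines "dL \<equiv> \<lambda>v :: 'n heis. (fst v, snd v + 2 * (\<Sum>j\<in>UNIV. Im (fst p $ j * cnj (fst v $ j))))"
  shows "heis_metric (heis_mult p q) (dL v) (dL w) = heis_metric q v w"
proof -
  have "T_coord (heis_mult p q) (dL u) = T_coord q u" for u
    by (simp add: T_coord_def heis_mult_def dL_def algebra_simps sum.distrib sum_subtractf)
  then show ?thesis
    by (simp add: heis_metric_def) (simp add: dL_def)
qed

definition absolutely_continuous_curve :: "real \<Rightarrow> real \<Rightarrow> (real \<Rightarrow> 'a::metric_space) \<Rightarrow> bool" where
  "absolutely_continuous_curve a b f \<longleftrightarrow>
     (\<forall>e>0. \<exists>d>0. \<forall>D. finite D \<and> (\<forall>(l, r)\<in>D. a \<le> l \<and> l \<le> r \<and> r \<le> b) \<and>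
        pairwise (\<lambda>I J. disjnt {fst I<..<snd I} {fst J<..<snd J}) D \<and>
        (\<Sum>(l, r)\<in>D. r - l) < d \<longrightarrow> (\<Sum>(l, r)\<in>D. dist (f l) (f r)) < e)"

definition horizontal_curve :: "real \<Rightarrow> real \<Rightarrow> (real \<Rightarrow> 'n::finite heis) \<Rightarrow> bool" where
  "horizontal_curve a b \<gamma> \<longleftrightarrow> absolutely_continuous_curve a b \<gamma> \<and>
     (AE s in lebesgue. s \<in> {a..b} \<longrightarrow>
        (\<exists>v\<in>horizontal_space (\<gamma> s). (\<gamma> has_vector_derivative v) (at s)))"

definition riemannian_length :: "real \<Rightarrow> real \<Rightarrow> (real \<Rightarrow> 'n::finite heis) \<Rightarrow> ennreal" where
  "riemannian_length a b \<gamma> =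
     (\<integral>\<^sup>+ s\<in>{a..b}. ennreal (sqrt (heis_metric (\<gamma> s) (vector_derivative \<gamma> (at s))
                                                  (vector_derivative \<gamma> (at s)))) \<partial>lebesgue)"

definition cc_dist :: "'n::finite heis \<Rightarrow> 'n heis \<Rightarrow> ennreal" where
  "cc_dist p q =
     (INF (a, b, \<gamma>)\<in>{(a, b, \<gamma>). a \<le> b \<and> horizontal_curve a b \<gamma> \<and> \<gamma> a = p \<and> \<gamma> b = q}.
        riemannian_length a b \<gamma>)"

definition cc_diam :: "'n::finite heis set \<Rightarrow> ennreal" where
  "cc_diam F = (SUP p\<in>F. SUP q\<in>F. cc_dist p q)"

definition leb :: "'n::finite heis set \<Rightarrow> ennreal" where
  "leb F = outer_measure_of lebesgue F"

text \<open>The isodiametric constant and the compact isodiametric sets relative to a class of sets. The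
  class UNIV gives the constant C_I and the class I of the unrestricted problem, and rot_invariant
  gives their rotationally invariant counterparts.\<close>

definition isodiam_const :: "'n::finite heis set set \<Rightarrow> ennreal" where
  "isodiam_const \<A> =
     (SUP F\<in>{F\<in>\<A>. 0 < cc_diam F \<and> cc_diam F < \<infinity>}. leb F / cc_diam F ^ (2 * CARD('n) + 2))"

definition isodiam_class :: "'n::finite heis set set \<Rightarrow> 'n heis set set" where
  "isodiam_class \<A> =
     {E\<in>\<A>. compact E \<and> 0 < cc_diam E \<and>
        leb E = isodiam_const \<A> * cc_diam E ^ (2 * CARD('n) + 2)}"

definition rot :: "real ^ 'n \<Rightarrow> 'n::finite heis \<Rightarrow> 'n heis" where
  "rot \<theta> p = ((\<chi> j. exp (\<i> * complex_of_real (\<theta> $ j)) * fst p $ j), snd p)"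

definition rot_invariant :: "'n::finite heis set set" where
  "rot_invariant = {F. \<forall>\<theta>. rot \<theta> ` F \<subseteq> F}"

definition t_convex :: "'n::finite heis set \<Rightarrow> bool" where
  "t_convex F \<longleftrightarrow>
     (\<forall>z t1 t2 t. (z, t1) \<in> F \<and> (z, t2) \<in> F \<and> t1 \<le> t \<and> t \<le> t2 \<longrightarrow> (z, t) \<in> F)"

text \<open>For compact E and z in its projection the maximum and minimum below exist; for other z the
  values are arbitrary.\<close>

definition f_plus :: "'n::finite heis set \<Rightarrow> complex ^ 'n \<Rightarrow> real" where
  "f_plus E z = (GREATEST t. (z, t) \<in> E)"

definition f_minus :: "'n::finite heis set \<Rightarrow> complex ^ 'n \<Rightarrow> real" where
  "f_minus E z = (LEAST t. (z, t) \<in> E)"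

definition U_set :: "'n::finite heis set \<Rightarrow> (complex ^ 'n) set" where
  "U_set E = {z\<in>fst ` E. f_minus E z < f_plus E z}"

definition E_hat :: "'n::finite heis set \<Rightarrow> 'n heis set" where
  "E_hat E = {(z, t). z \<in> closure (U_set E) \<and> f_minus E z \<le> t \<and> t \<le> f_plus E z}"

definition locally_lipschitz_on :: "'a::metric_space set \<Rightarrow> ('a \<Rightarrow> 'b::metric_space) \<Rightarrow> bool" where
  "locally_lipschitz_on S f \<longleftrightarrow> (\<forall>x\<in>S. \<exists>r>0. \<exists>L. L-lipschitz_on (ball x r \<inter> S) f)"

end

theory Submission
  imports Defs
begin

text \<open>By left invariance d(p, q) is a function N(z, t) of the horizontal and vertical coordinates of the
  difference of p and q. Contracting a curve from 0 to [z, t] towards its horizontal chord lowers the endpoint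
  and shortens the curve by a definite amount, because a curve that is not straight is longer than its chord by
  an amount controlled from below by the enclosed area. Hence N(z, t) is strictly increasing in |t|, with a
  locally uniform rate, and the spheres of N are locally Lipschitz graphs away from the plane t = 0.

  If a point x in the fibre of a point of E has distance less than diam E from all of E, then a small ball
  around x (together with its rotations) can be added to E without increasing the diameter, so by maximality
  of the measure it is contained in E. By strict monotonicity this applies to every point strictly between two
  points of E in the same fibre. Conversely a point outside E in a fibre of E is at distance at least diam E
  from some q in E, and comparing with the sphere around q gives the Lipschitz bounds for the functions
  bounding E from above and below.\<close>


section \<open>Absolutely continuous curves\<close>

text \<open>No length-minimizing curve is ever produced. The estimates on N are proved for every
  curve of length at most L, with explicit dependence on L, and then L decreases to the infimum. A
  strict inequality between lengths would be lost in this limit, so strict monotonicity is read off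
  from the quantitative inequality \<open>cc_norm_shrink\<close>.

  The rate in that inequality is proportional to N - |z|, which is 0 on the plane t = 0, so the
  slope of a sphere around q is controlled only at points whose height relative to q stays away from
  0. Over U this holds without any knowledge of q: of two points of a fibre at distance 2 \<eta>, at
  least one has relative height at least \<eta>. Outside U there is no gap, and only continuity is
  claimed there.

  In the rotationally invariant class a whole orbit of balls is added at once, so the points of the
  orbit of x must also be close to each other. This is where it matters that x lies in a fibre of E:
  the point of E in that fibre provides the comparison.\<close>

definition nonoverlapping :: "real \<Rightarrow> real \<Rightarrow> (real \<times> real) set \<Rightarrow> bool" where
  "nonoverlapping a b D \<longleftrightarrow> finite D \<and> (\<forall>(l, r)\<in>D. a \<le> l \<and> l \<le> r \<and> r \<le> b) \<and>
     pairwise (\<lambda>I J. disjnt {fst I<..<snd I} {fst J<..<snd J}) D"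

lemma absolutely_continuous_curve_iff:
  "absolutely_continuous_curve a b f \<longleftrightarrow> (\<forall>e>0. \<exists>d>0. \<forall>D. nonoverlapping a b D \<longrightarrow>
     (\<Sum>(l, r)\<in>D. r - l) < d \<longrightarrow> (\<Sum>(l, r)\<in>D. dist (f l) (f r)) < e)"
  unfolding absolutely_continuous_curve_def nonoverlapping_def by (simp only: imp_conjL conj_assoc)

text \<open>The one comparison principle behind the closure properties below: linear images,
  bilinear products, and Lipschitz curves, which are compared with a constant curve.\<close>

lemma absolutely_continuous_curve_dominated:
  fixes f :: "real \<Rightarrow> 'a::metric_space" and g :: "real \<Rightarrow> 'b::metric_space"
  assumes f: "absolutely_continuous_curve a b f" and "C \<ge> 0"
    and dom: "\<And>l r. a \<le> l \<Longrightarrow> l \<le> r \<Longrightarrow> r \<le> b \<Longrightarrow> dist (g l) (g r) \<le> C * dist (f l) (f r) + C * (r - l)"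
  shows "absolutely_continuous_curve a b g"
  unfolding absolutely_continuous_curve_iff
proof (intro allI impI)
  fix e :: real assume "e > 0"
  \<comment> \<open>The shift by 1 covers C = 0 and gives C / c < 1, which keeps the final
    inequality strict.\<close>
  define c where "c = C + 1"
  define e' where "e' = e / c / 2"
  have "e' > 0" using \<open>e > 0\<close> \<open>C \<ge> 0\<close> by (simp add: e'_def c_def)
  then obtain d where "d > 0" and d: "\<forall>D. nonoverlapping a b D \<longrightarrow>
     (\<Sum>(l, r)\<in>D. r - l) < d \<longrightarrow> (\<Sum>(l, r)\<in>D. dist (f l) (f r)) < e'"
    using f unfolding absolutely_continuous_curve_iff by blast
  show "\<exists>d>0. \<forall>D. nonoverlapping a b D \<longrightarrow>
     (\<Sum>(l, r)\<in>D. r - l) < d \<longrightarrow> (\<Sum>(l, r)\<in>D. dist (g l) (g r)) < e"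
  proof (intro exI[of _ "min d e'"] conjI allI impI)
    fix D assume D: "nonoverlapping a b D" "(\<Sum>(l, r)\<in>D. r - l) < min d e'"
    have "(\<Sum>(l, r)\<in>D. dist (g l) (g r)) \<le> (\<Sum>(l, r)\<in>D. C * dist (f l) (f r) + C * (r - l))"
      using D(1) dom by (intro sum_mono) (auto simp: nonoverlapping_def)
    also have "\<dots> = C * (\<Sum>(l, r)\<in>D. dist (f l) (f r)) + C * (\<Sum>(l, r)\<in>D. r - l)"
      by (simp add: sum_distrib_left sum.distrib split_def)
    also have "\<dots> \<le> C * e' + C * e'"
      using D d \<open>C \<ge> 0\<close> by (intro add_mono mult_left_mono) (auto intro: less_imp_le)
    also have "\<dots> = e * (C / c)"
    proof -
      have "C * e' + C * e' = C * (2 * e')" by simp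
      also have "2 * e' = e / c" unfolding e'_def by simp
      finally show ?thesis by simp
    qed
    also have "\<dots> < e * 1"
      using \<open>e > 0\<close> \<open>C \<ge> 0\<close> by (intro mult_strict_left_mono) (auto simp: divide_simps c_def)
    finally show "(\<Sum>(l, r)\<in>D. dist (g l) (g r)) < e" by simp
  qed (use \<open>d > 0\<close> \<open>e' > 0\<close> in auto)
qed

lemma absolutely_continuous_curve_const: "absolutely_continuous_curve a b (\<lambda>_. c)"
  unfolding absolutely_continuous_curve_def by (auto intro: exI[of _ 1])

lemma absolutely_continuous_curve_subinterval:
  assumes "absolutely_continuous_curve a b f" "a \<le> a'" "b' \<le> b"
  shows "absolutely_continuous_curve a' b' f"
proof -
  have "nonoverlapping a b D" if "nonoverlapping a' b' D" for D
    using that assms(2,3) unfolding nonoverlapping_def by fastforce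
  then show ?thesis
    using assms(1) unfolding absolutely_continuous_curve_iff by meson
qed

lemma absolutely_continuous_curve_imp_continuous_on:
  assumes "absolutely_continuous_curve a b f"
  shows "continuous_on {a..b} f"
  unfolding continuous_on_iff
proof (intro ballI allI impI)
  fix x e :: real assume x: "x \<in> {a..b}" and "e > 0"
  then obtain d where "d > 0" and d: "\<And>D. nonoverlapping a b D \<Longrightarrow>
     (\<Sum>(l, r)\<in>D. r - l) < d \<Longrightarrow> (\<Sum>(l, r)\<in>D. dist (f l) (f r)) < e"
    using assms unfolding absolutely_continuous_curve_iff by blast
  have "dist (f y) (f x) < e" if y: "y \<in> {a..b}" "dist y x < d" for y
    using d[of "{(x, y)}"] d[of "{(y, x)}"] y x
    by (cases "x \<le> y") (auto simp: nonoverlapping_def dist_real_def dist_commute)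
  then show "\<exists>d>0. \<forall>x'\<in>{a..b}. dist x' x < d \<longrightarrow> dist (f x') (f x) < e"
    using \<open>d > 0\<close> by blast
qed

text \<open>The fundamental theorem of calculus in gauge form. Intervals tagged outside Z obey the
  straddle estimate for the derivative. Intervals tagged in Z are confined by the gauge to an open
  set of measure less than d, where absolute continuity makes the sum of their increments
  small.\<close>

lemma absolutely_continuous_has_integral_derivative:
  fixes f :: "real \<Rightarrow> 'a::euclidean_space"
  assumes ac: "absolutely_continuous_curve a b f" and "a \<le> b"
    and Z: "Z \<in> null_sets lebesgue"
    and f': "\<And>x. x \<in> {a..b} - Z \<Longrightarrow> (f has_vector_derivative f' x) (at x within {a..b})"
  shows "((\<lambda>x. if x \<in> Z then 0 else f' x) has_integral (f b - f a)) {a..b}"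
proof (cases "a = b")
  case True
  then show ?thesis by (auto simp: has_integral_refl)
next
  case False
  then have "a < b" using \<open>a \<le> b\<close> by simp
  let ?g = "\<lambda>x. if x \<in> Z then 0 else f' x"
  show ?thesis
    unfolding has_integral_factor_content_real
  proof (intro allI impI)
    fix e :: real assume "e > 0"
    then have "e * (b - a) / 2 > 0" using \<open>a < b\<close> by simp
    then obtain d where "d > 0" and d: "\<And>D. nonoverlapping a b D \<Longrightarrow>
        (\<Sum>(l, r)\<in>D. r - l) < d \<Longrightarrow> (\<Sum>(l, r)\<in>D. dist (f l) (f r)) < e * (b - a) / 2"
      using ac unfolding absolutely_continuous_curve_iff by blast
    have Zleb: "Z \<in> sets lebesgue" using Z by auto
    obtain T where T: "open T" "Z \<subseteq> T" "T - Z \<in> lmeasurable" "emeasure lebesgue (T - Z) < ennreal d"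
      using sets_lebesgue_outer_open[OF Zleb \<open>d > 0\<close>] by metis
    have TZ: "T = (T - Z) \<union> Z" using T by auto
    have "T \<in> lmeasurable"
      using T(3) Z TZ by (metis fmeasurable.Un fmeasurableI_null_sets)
    have "emeasure lebesgue T = emeasure lebesgue (T - Z)"
      using T(3) Z TZ by (metis emeasure_Un_null_set fmeasurableD)
    then have mT: "measure lebesgue T < d"
    proof -
      have "ennreal (measure lebesgue T) = emeasure lebesgue T"
        using emeasure_eq_measure2[OF \<open>T \<in> lmeasurable\<close>] by simp
      also have "\<dots> < ennreal d" using T(4) \<open>emeasure lebesgue T = emeasure lebesgue (T - Z)\<close> by simp
      finally show ?thesis by (subst (asm) ennreal_less_iff) auto
    qed
    have "\<exists>\<eta>>0. x \<in> {a..b} - Z \<longrightarrow>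
        (\<forall>y\<in>{a..b}. \<bar>y - x\<bar> < \<eta> \<longrightarrow> norm (f y - f x - (y - x) *\<^sub>R f' x) \<le> e / 2 * \<bar>y - x\<bar>)" for x
    proof (cases "x \<in> {a..b} - Z")
      case True
      from f'[OF True] have "(f has_derivative (\<lambda>h. h *\<^sub>R f' x)) (at x within {a..b})"
        by (simp add: has_vector_derivative_def)
      then show ?thesis using \<open>e > 0\<close>
        unfolding has_derivative_within_alt
        by (metis half_gt_zero real_norm_def)
    qed (auto intro: exI[of _ 1])
    then obtain \<eta> where \<eta>: "\<And>x. \<eta> x > 0" "\<And>x y. x \<in> {a..b} - Z \<Longrightarrow> y \<in> {a..b} \<Longrightarrow> \<bar>y - x\<bar> < \<eta> x \<Longrightarrow>
         norm (f y - f x - (y - x) *\<^sub>R f' x) \<le> e / 2 * \<bar>y - x\<bar>"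
      by metis
    \<comment> \<open>The integrand is 0 at tags in Z, so such an interval contributes to the error
      only its increment of \<open>f\<close>.\<close>
    define \<G> where "\<G> x = (if x \<in> Z then T else ball x (\<eta> x))" for x
    show "\<exists>d. gauge d \<and> (\<forall>p. p tagged_division_of {a..b} \<and> d fine p \<longrightarrow>
           norm (sum (\<lambda>(x, k). measure lborel k *\<^sub>R ?g x) p - (f b - f a)) \<le> e * measure lborel {a..b})"
    proof (intro exI[of _ \<G>] conjI allI impI)
      show "gauge \<G>"
        using T \<eta>(1) by (auto simp: gauge_def \<G>_def)
      fix p assume "p tagged_division_of {a..b} \<and> \<G> fine p"
      then have p: "p tagged_division_of {a..b}" and fine: "\<G> fine p" by auto
      have fin: "finite p" using p by blast
      have pk: "\<exists>u v. k = {u..v} \<and> u \<le> v \<and> x \<in> k \<and> a \<le> u \<and> v \<le> b" if xk: "(x, k) \<in> p" for x k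
      proof -
        obtain u v where uv: "k = cbox u v" using tagged_division_ofD(4)[OF p xk] by blast
        have "x \<in> k" "k \<subseteq> {a..b}" using tagged_division_ofD(2,3)[OF p xk] by auto
        then show ?thesis using uv by (intro exI[of _ u] exI[of _ v]) auto
      qed
      let ?p1 = "{(x, k) \<in> p. x \<in> Z}" and ?p2 = "{(x, k) \<in> p. x \<notin> Z}"
      have sumF: "(\<Sum>(x, k)\<in>p. f (Sup k) - f (Inf k)) = f b - f a"
        using additive_tagged_division_1[OF \<open>a \<le> b\<close> p] .
      have 2: "norm (measure lborel k *\<^sub>R ?g x - (f (Sup k) - f (Inf k))) \<le> e / 2 * measure lborel k"
        if xk: "(x, k) \<in> p" "x \<notin> Z" for x k
      proof -
        obtain u v where k: "k = {u..v}" "u \<le> v" "x \<in> k" "a \<le> u" "v \<le> b"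
          using pk[OF xk(1)] by blast
        have "k \<subseteq> ball x (\<eta> x)" using fineD[OF fine xk(1)] xk(2) by (simp add: \<G>_def)
        moreover have "u \<in> k" "v \<in> k" using k by auto
        ultimately have "u \<in> ball x (\<eta> x)" "v \<in> ball x (\<eta> x)" by blast+
        then have "norm (f u - f x - (u - x) *\<^sub>R f' x) \<le> e / 2 * (x - u)"
          "norm (f v - f x - (v - x) *\<^sub>R f' x) \<le> e / 2 * (v - x)"
          using \<eta>(2)[of x u] \<eta>(2)[of x v] k xk by (auto simp: dist_real_def abs_minus_commute)
        moreover have "(v - u) *\<^sub>R f' x - (f v - f u) =
            (f u - f x - (u - x) *\<^sub>R f' x) - (f v - f x - (v - x) *\<^sub>R f' x)"
          by (simp add: algebra_simps)
        ultimately have "norm ((v - u) *\<^sub>R f' x - (f v - f u)) \<le> e / 2 * (x - u) + e / 2 * (v - x)"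
          by (metis (no_types, lifting) norm_triangle_le_diff add_mono)
        also have "\<dots> = e / 2 * (v - u)" by (simp only: distrib_left[symmetric]) simp
        finally show ?thesis using k xk by simp
      qed
      have 1: "(\<Sum>(x, k)\<in>?p1. dist (f (Inf k)) (f (Sup k))) \<le> e * (b - a) / 2"
      proof -
        have tp: "?p1 tagged_partial_division_of {a..b}"
          by (rule tagged_partial_division_subset[of p])
             (use p in \<open>auto simp: tagged_division_of_def\<close>)
        let ?D = "(\<lambda>(x, k). (Inf k, Sup k)) ` ?p1"
        \<comment> \<open>Absolute continuity speaks of sets of endpoint pairs, so distinct tagged
          intervals must not collapse. Two different tags on one interval would force its interior
          to be empty; the interval is then a single point and the tags agree after all.\<close>
        have inj: "inj_on (\<lambda>(x, k). (Inf k, Sup k)) ?p1"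
        proof (rule inj_onI, clarify)
          fix x k x' k' assume xk: "(x, k) \<in> p" "x \<in> Z" "(x', k') \<in> p" "x' \<in> Z"
            and eq: "Inf k = Inf k'" "Sup k = Sup k'"
          obtain u v where k: "k = {u..v}" "u \<le> v" "x \<in> k" using pk[OF xk(1)] by blast
          obtain u' v' where k': "k' = {u'..v'}" "u' \<le> v'" "x' \<in> k'" using pk[OF xk(3)] by blast
          have "k = k'" using eq k k' by auto
          moreover have "x = x'"
          proof (rule ccontr)
            assume "x \<noteq> x'"
            then have "interior k \<inter> interior k' = {}"
              using tagged_division_ofD(5)[OF p xk(1,3)] by auto
            then have "{u<..<v} = {}" using k \<open>k = k'\<close> by simp
            then have "u = v" using k by (simp add: not_less)
            then show False using k k' \<open>k = k'\<close> \<open>x \<noteq> x'\<close> by auto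
          qed
          ultimately show "x = x' \<and> k = k'" by simp
        qed
        have pw: "pairwise (\<lambda>I J. disjnt {fst I<..<snd I} {fst J<..<snd J}) ?D"
        proof (rule pairwiseI)
          fix I J assume "I \<in> ?D" "J \<in> ?D" "I \<noteq> J"
          then obtain x k x' k' where xk: "(x, k) \<in> p" "(x', k') \<in> p" "I = (Inf k, Sup k)" "J = (Inf k', Sup k')"
            unfolding image_iff by (auto split: prod.splits)
          obtain u v where k: "k = {u..v}" "u \<le> v" using pk[OF xk(1)] by blast
          obtain u' v' where k': "k' = {u'..v'}" "u' \<le> v'" using pk[OF xk(2)] by blast
          have "interior k \<inter> interior k' = {}"
            using tagged_division_ofD(5)[OF p xk(1,2)] xk(3,4) \<open>I \<noteq> J\<close> by auto
          then show "disjnt {fst I<..<snd I} {fst J<..<snd J}"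
            using k k' xk by (simp add: disjnt_def)
        qed
        have "(\<Sum>(l, r)\<in>?D. r - l) = (\<Sum>(x, k)\<in>?p1. Sup k - Inf k)"
          by (subst sum.reindex[OF inj]) (simp add: split_def)
        also have "\<dots> = (\<Sum>(x, k)\<in>?p1. measure lborel k)"
          by (intro sum.cong refl) (use pk in force)
        also have "\<dots> = (\<Sum>k\<in>snd ` ?p1. measure lborel k)"
          using sum.over_tagged_division_lemma[OF tagged_partial_division_of_Union_self[OF tp], of "measure lborel"]
          by (simp add: interior_cbox content_eq_0_interior)
        also have "\<dots> = (\<Sum>k\<in>snd ` ?p1. measure lebesgue k)"
        proof (intro sum.cong refl)
          fix k assume "k \<in> snd ` ?p1"
          then obtain x where "(x, k) \<in> p" by auto
          then show "measure lborel k = measure lebesgue k" using pk by force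
        qed
        also have "\<dots> = measure lebesgue (\<Union>(snd ` ?p1))"
          using content_division[OF division_of_tagged_division[OF tagged_partial_division_of_Union_self[OF tp]]]
          by simp
        also have "\<dots> \<le> measure lebesgue T"
        proof (rule measure_mono_fmeasurable)
          show "\<Union>(snd ` ?p1) \<subseteq> T"
          proof clarify
            fix s x k assume "(x, k) \<in> p" "x \<in> Z" "s \<in> snd (x, k)"
            then show "s \<in> T" using fineD[OF fine \<open>(x, k) \<in> p\<close>] by (auto simp: \<G>_def)
          qed
          show "T \<in> lmeasurable" by fact
          show "\<Union>(snd ` ?p1) \<in> sets lebesgue"
          proof (intro sets.finite_Union)
            show "finite (snd ` ?p1)" by (intro finite_imageI finite_subset[OF _ fin]) auto
            have "k \<in> sets lebesgue" if xk: "(x, k) \<in> p" for x k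
              using pk[OF xk] by auto
            then show "snd ` ?p1 \<subseteq> sets lebesgue" by auto
          qed
        qed
        finally have "(\<Sum>(l, r)\<in>?D. r - l) < d" using mT by simp
        then have "(\<Sum>(l, r)\<in>?D. dist (f l) (f r)) < e * (b - a) / 2"
        proof (intro d)
          have "finite ?D" using fin by (intro finite_imageI finite_subset[OF _ fin]) auto
          moreover have "\<forall>(l, r)\<in>?D. a \<le> l \<and> l \<le> r \<and> r \<le> b"
            using pk by force
          ultimately show "nonoverlapping a b ?D" using pw by (simp add: nonoverlapping_def)
        qed
        moreover have "(\<Sum>(l, r)\<in>?D. dist (f l) (f r)) = (\<Sum>(x, k)\<in>?p1. dist (f (Inf k)) (f (Sup k)))"
          by (subst sum.reindex[OF inj]) (simp add: split_def)
        ultimately show ?thesis by simp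
      qed
      have "sum (\<lambda>(x, k). measure lborel k *\<^sub>R ?g x) p - (f b - f a) =
          (\<Sum>(x, k)\<in>p. measure lborel k *\<^sub>R ?g x - (f (Sup k) - f (Inf k)))"
        by (simp add: sumF[symmetric] sum_subtractf split_def)
      also have "norm \<dots> \<le> (\<Sum>(x, k)\<in>p. norm (measure lborel k *\<^sub>R ?g x - (f (Sup k) - f (Inf k))))"
        by (rule order_trans[OF norm_sum]) (simp add: split_def)
      also have "\<dots> \<le> (\<Sum>(x, k)\<in>p. e / 2 * measure lborel k + (if x \<in> Z then dist (f (Inf k)) (f (Sup k)) else 0))"
        using 2 \<open>e > 0\<close> by (intro sum_mono) (auto simp: dist_norm norm_minus_commute)
      also have "\<dots> = e / 2 * (\<Sum>(x, k)\<in>p. measure lborel k) + (\<Sum>(x, k)\<in>?p1. dist (f (Inf k)) (f (Sup k)))"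
      proof -
        have "(\<Sum>(x, k)\<in>p. if x \<in> Z then dist (f (Inf k)) (f (Sup k)) else 0) =
            (\<Sum>(x, k)\<in>?p1. dist (f (Inf k)) (f (Sup k)))"
          by (rule sum.mono_neutral_cong_right) (use fin in \<open>auto split: if_splits\<close>)
        then show ?thesis by (simp add: split_def sum.distrib sum_distrib_left)
      qed
      also have "(\<Sum>(x, k)\<in>p. measure lborel k) = b - a"
        using additive_content_tagged_division[of p a b] p \<open>a \<le> b\<close> by simp
      also have "e / 2 * (b - a) + (\<Sum>(x, k)\<in>?p1. dist (f (Inf k)) (f (Sup k))) \<le> e * measure lborel {a..b}"
        using 1 \<open>a \<le> b\<close> by simp
      finally show "norm (sum (\<lambda>(x, k). measure lborel k *\<^sub>R ?g x) p - (f b - f a)) \<le> e * measure lborel {a..b}" .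
    qed
  qed
qed

text \<open>Only a finite right-hand side matters. It bounds the integral of the norm of the
  derivative, so the gauge integral of the preceding lemma is an absolutely convergent Lebesgue
  integral and the norm passes inside.\<close>

lemma absolutely_continuous_increment_le:
  fixes f :: "real \<Rightarrow> 'a::euclidean_space"
  assumes ac: "absolutely_continuous_curve a b f" and "a \<le> b"
    and f': "AE s in lebesgue. s \<in> {a..b} \<longrightarrow> (\<exists>v. (f has_vector_derivative v) (at s) \<and> norm v \<le> g s)"
  shows "ennreal (norm (f b - f a)) \<le> (\<integral>\<^sup>+ s\<in>{a..b}. ennreal (g s) \<partial>lebesgue)"
proof (cases "(\<integral>\<^sup>+ s\<in>{a..b}. ennreal (g s) \<partial>lebesgue) < \<infinity>")
  case True
  obtain Z where Z: "Z \<in> null_sets lebesgue"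
    and f'Z: "\<And>s. s \<in> {a..b} - Z \<Longrightarrow> \<exists>v. (f has_vector_derivative v) (at s) \<and> norm v \<le> g s"
  proof -
    obtain Z where "Z \<in> null_sets lebesgue" and
      "{s \<in> space lebesgue. \<not> (s \<in> {a..b} \<longrightarrow> (\<exists>v. (f has_vector_derivative v) (at s) \<and> norm v \<le> g s))} \<subseteq> Z"
      using f' unfolding eventually_ae_filter by blast
    then show ?thesis by (intro that[of Z]) auto
  qed
  define h where "h s = (if s \<in> Z then 0 else vector_derivative f (at s))" for s
  have der: "(f has_vector_derivative vector_derivative f (at s)) (at s)" "norm (vector_derivative f (at s)) \<le> g s"
    if "s \<in> {a..b} - Z" for s
    using f'Z[OF that] vector_derivative_at by auto
  have hi: "(h has_integral (f b - f a)) {a..b}"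
    unfolding h_def using ac \<open>a \<le> b\<close> Z
    by (rule absolutely_continuous_has_integral_derivative)
       (use der in \<open>blast intro: has_vector_derivative_at_within\<close>)
  then have "h \<in> borel_measurable (lebesgue_on {a..b})"
    by (intro integrable_imp_measurable) (auto simp: integrable_on_def)
  then have meas: "(\<lambda>s. indicator {a..b} s *\<^sub>R h s) \<in> borel_measurable lebesgue"
    by (simp add: borel_measurable_restrict_space_iff)
  have le: "(\<integral>\<^sup>+ s. norm (indicator {a..b} s *\<^sub>R h s) \<partial>lebesgue) \<le> (\<integral>\<^sup>+ s\<in>{a..b}. ennreal (g s) \<partial>lebesgue)"
  proof (rule nn_integral_mono_AE)
    show "AE s in lebesgue. ennreal (norm (indicator {a..b} s *\<^sub>R h s)) \<le> ennreal (g s) * indicator {a..b} s"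
      using AE_not_in[OF Z]
    proof eventually_elim
      case (elim s)
      then show ?case using der(2)[of s]
        by (auto simp: indicator_def h_def intro!: ennreal_leI)
    qed
  qed
  have int: "set_integrable lebesgue {a..b} h"
    unfolding set_integrable_def using meas le True
    by (intro integrableI_bounded) auto
  have "f b - f a = (LINT s:{a..b}|lebesgue. h s)"
    using set_lebesgue_integral_eq_integral(2)[OF int] integral_unique[OF hi] by simp
  then have "ennreal (norm (f b - f a)) \<le> (\<integral>\<^sup>+ s. norm (indicator {a..b} s *\<^sub>R h s) \<partial>lebesgue)"
    using integral_norm_bound_ennreal int
    unfolding set_integrable_def set_lebesgue_integral_def by metis
  then show ?thesis using le by (rule order_trans)
next
  case False
  then have "(\<integral>\<^sup>+ s\<in>{a..b}. ennreal (g s) \<partial>lebesgue) = top"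
    using less_top by (metis infinity_ennreal_def)
  then show ?thesis by simp
qed

text \<open>The derivative is a limit of difference quotients of the extension of f to the real line that is
  constant outside the interval.\<close>

lemma measurable_vector_derivative_exists:
  fixes f :: "real \<Rightarrow> 'a::euclidean_space"
  assumes "continuous_on {a..b} f"
  obtains D where "D \<in> borel_measurable borel"
    "\<And>s v. s \<in> {a<..<b} \<Longrightarrow> (f has_vector_derivative v) (at s) \<Longrightarrow> D s = v"
proof (cases "a < b")
  case True
  define F where "F s = f (max a (min b s))" for s
  have cF: "continuous_on UNIV F"
    unfolding F_def using True
    by (intro continuous_on_compose2[OF assms] continuous_intros) auto
  define q where "q n s = real (Suc n) *\<^sub>R (F (s + 1 / real (Suc n)) - F s)" for n s
  have "continuous_on UNIV (q n)" for n
    unfolding q_def by (intro continuous_intros continuous_on_compose2[OF cF]) auto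
  then have q: "q n \<in> borel_measurable borel" for n
    by (rule borel_measurable_continuous_onI)
  let ?D = "\<lambda>s. lim (\<lambda>n. q n s)"
  have "?D \<in> borel_measurable borel" using q by (rule borel_measurable_lim_metric)
  moreover have "?D s = v" if s: "s \<in> {a<..<b}" and v: "(f has_vector_derivative v) (at s)" for s v
  proof (rule limI)
    have "(F has_vector_derivative v) (at s)"
      by (rule has_vector_derivative_transform_within_open[OF v, of "{a<..<b}"]) (use s in \<open>auto simp: F_def\<close>)
    then have "((\<lambda>h. norm (F (s + h) - F s - h *\<^sub>R v) / norm h) \<longlongrightarrow> 0) (at 0)"
      by (simp add: has_vector_derivative_def has_derivative_at)
    moreover have "filterlim (\<lambda>n. 1 / real (Suc n)) (at 0) sequentially"
      unfolding filterlim_at using LIMSEQ_Suc[OF lim_1_over_n] by simp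
    ultimately have "(\<lambda>n. norm (F (s + 1 / real (Suc n)) - F s - (1 / real (Suc n)) *\<^sub>R v)
        / norm (1 / real (Suc n))) \<longlonglongrightarrow> 0"
      by (rule filterlim_compose)
    moreover have "norm (F (s + 1 / real (Suc n)) - F s - (1 / real (Suc n)) *\<^sub>R v)
        / norm (1 / real (Suc n)) = norm (q n s - v)" for n
    proof -
      have "q n s - v = real (Suc n) *\<^sub>R (F (s + 1 / real (Suc n)) - F s - (1 / real (Suc n)) *\<^sub>R v)"
        unfolding q_def by (simp only: scaleR_diff_right scaleR_scaleR) simp
      then have "norm (q n s - v) = real (Suc n) * norm (F (s + 1 / real (Suc n)) - F s - (1 / real (Suc n)) *\<^sub>R v)"
        by (metis norm_scaleR abs_of_nat)
      then show ?thesis by (simp add: field_simps del: of_nat_Suc)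
    qed
    ultimately show "(\<lambda>n. q n s) \<longlonglongrightarrow> v"
      by (simp add: tendsto_norm_zero_iff LIM_zero_iff del: of_nat_Suc)
  qed
  ultimately show ?thesis by (rule that)
next
  case False
  then show ?thesis using that[of "\<lambda>_. 0"] by auto
qed

section \<open>Horizontal curves and the Carnot-Caratheodory distance\<close>

text \<open>Up to sign the standard symplectic form on C^n. Isolating it gives access to the rules
  for bounded bilinear maps.\<close>

definition sympl :: "complex ^ 'n \<Rightarrow> complex ^ 'n \<Rightarrow> real" where
  "sympl z w = (\<Sum>j\<in>UNIV. Im (z $ j * cnj (w $ j)))"

text \<open>Multiplying w by the imaginary unit is an isometry and turns the form into the inner
  product, so Cauchy-Schwarz applies.\<close>

lemma abs_sympl_le: "\<bar>sympl z w\<bar> \<le> norm z * norm w"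
proof -
  define Jw :: "complex ^ 'a" where "Jw = (\<chi> j. \<i> * w $ j)"
  have "sympl z w = z \<bullet> Jw"
    by (simp add: sympl_def Jw_def inner_vec_def inner_complex_def algebra_simps)
  moreover have "norm Jw = norm w"
    by (simp add: Jw_def norm_vec_def norm_mult)
  ultimately show ?thesis
    using Cauchy_Schwarz_ineq2[of z Jw] by simp
qed

lemma bounded_bilinear_sympl: "bounded_bilinear sympl"
proof
  show "\<exists>K. \<forall>a b. norm (sympl a b) \<le> norm a * norm b * K"
    using abs_sympl_le by (intro exI[of _ 1]) auto
qed (simp_all add: sympl_def algebra_simps sum.distrib sum_subtractf sum_distrib_left)

lemma sympl_commute: "sympl w z = - sympl z w"
  by (simp add: sympl_def sum_negf[symmetric] algebra_simps)

lemma sympl_self [simp]: "sympl z z = 0"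
  by (simp add: sympl_def algebra_simps)

lemmas sympl_simps =
  bounded_bilinear.add_left[OF bounded_bilinear_sympl]
  bounded_bilinear.add_right[OF bounded_bilinear_sympl]
  bounded_bilinear.diff_left[OF bounded_bilinear_sympl]
  bounded_bilinear.diff_right[OF bounded_bilinear_sympl]
  bounded_bilinear.scaleR_left[OF bounded_bilinear_sympl]
  bounded_bilinear.scaleR_right[OF bounded_bilinear_sympl]
  bounded_bilinear.minus_left[OF bounded_bilinear_sympl]
  bounded_bilinear.minus_right[OF bounded_bilinear_sympl]
  bounded_bilinear.zero_left[OF bounded_bilinear_sympl]
  bounded_bilinear.zero_right[OF bounded_bilinear_sympl]

lemma has_vector_derivative_sympl:
  assumes "(f has_vector_derivative f') (at s within S)" "(g has_vector_derivative g') (at s within S)"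
  shows "((\<lambda>s. sympl (f s) (g s)) has_vector_derivative sympl (f s) g' + sympl f' (g s)) (at s within S)"
  by (rule bounded_bilinear.has_vector_derivative[OF bounded_bilinear_sympl assms])

lemma heis_mult_sympl: "heis_mult p q = (fst p + fst q, snd p + snd q + 2 * sympl (fst p) (fst q))"
  by (simp add: heis_mult_def sympl_def)

lemma T_coord_sympl: "T_coord p v = snd v - 2 * sympl (fst p) (fst v)"
  by (simp add: T_coord_def sympl_def)

text \<open>Replaces membership in a span by one scalar equation; the coefficients for the converse
  direction come from \<open>frame_expansion\<close>.\<close>

lemma horizontal_space_iff: "v \<in> horizontal_space p \<longleftrightarrow> T_coord p v = 0"
proof
  assume "v \<in> horizontal_space p"
  then show "T_coord p v = 0" unfolding horizontal_space_def
  proof (induction rule: span_induct)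
    case base
    show ?case by (auto intro!: subspaceI simp: T_coord_sympl sympl_simps algebra_simps)
  next
    case (step x)
    have "T_coord p (X_field j p) = 0" "T_coord p (Y_field j p) = 0" for j
      by (simp_all add: T_coord_def X_field_def Y_field_def axis_def if_distrib sum.delta cong: if_cong)
    then show ?case using step by auto
  qed
next
  assume "T_coord p v = 0"
  then have "v = (\<Sum>j\<in>UNIV. Re (fst v $ j) *\<^sub>R X_field j p) + (\<Sum>j\<in>UNIV. Im (fst v $ j) *\<^sub>R Y_field j p)"
    using frame_expansion[of v p] by simp
  moreover have "\<dots> \<in> horizontal_space p"
    unfolding horizontal_space_def by (intro span_add span_sum span_scale span_base) auto
  ultimately show "v \<in> horizontal_space p" by simp
qed

lemma AE_lebesgue_neq: "AE s::real in lebesgue. s \<noteq> c"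
  by (rule AE_completion) (rule AE_lborel_singleton)

text \<open>On horizontal vectors the vertical coordinate vanishes, so the Riemannian length is the
  Euclidean length of the projected curve. The two endpoints form a null set and need no
  derivative.\<close>

lemma horizontal_curveI:
  assumes "absolutely_continuous_curve a b \<gamma>"
    "AE s in lebesgue. s \<in> {a<..<b} \<longrightarrow> (\<gamma> has_vector_derivative D s) (at s) \<and> T_coord (\<gamma> s) (D s) = 0"
  shows "horizontal_curve a b \<gamma>"
    and "riemannian_length a b \<gamma> = (\<integral>\<^sup>+ s\<in>{a..b}. ennreal (norm (fst (D s))) \<partial>lebesgue)"
proof -
  have AE: "AE s in lebesgue. s \<in> {a..b} \<longrightarrow> (\<gamma> has_vector_derivative D s) (at s) \<and> T_coord (\<gamma> s) (D s) = 0"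
    using assms(2) AE_lebesgue_neq[of a] AE_lebesgue_neq[of b] by eventually_elim auto
  then have "AE s in lebesgue. s \<in> {a..b} \<longrightarrow>
        (\<exists>v\<in>horizontal_space (\<gamma> s). (\<gamma> has_vector_derivative v) (at s))"
    by eventually_elim (auto simp: horizontal_space_iff)
  then show "horizontal_curve a b \<gamma>"
    using assms(1) by (simp add: horizontal_curve_def)
  show "riemannian_length a b \<gamma> = (\<integral>\<^sup>+ s\<in>{a..b}. ennreal (norm (fst (D s))) \<partial>lebesgue)"
    unfolding riemannian_length_def
  proof (rule nn_integral_cong_AE)
    show "AE s in lebesgue. ennreal (sqrt (heis_metric (\<gamma> s) (vector_derivative \<gamma> (at s))
             (vector_derivative \<gamma> (at s)))) * indicator {a..b} s =
        ennreal (norm (fst (D s))) * indicator {a..b} s"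
      using AE by eventually_elim
        (auto simp: indicator_def vector_derivative_at heis_metric_def norm_eq_sqrt_inner)
  qed
qed

text \<open>The velocity is delivered as a Borel function, because splitting and adding lengths
  requires measurable integrands.\<close>

lemma horizontal_curveE:
  assumes "horizontal_curve a b \<gamma>"
  obtains D where "absolutely_continuous_curve a b \<gamma>" "D \<in> borel_measurable borel"
    "AE s in lebesgue. s \<in> {a..b} \<longrightarrow> (\<gamma> has_vector_derivative D s) (at s) \<and> T_coord (\<gamma> s) (D s) = 0"
    "riemannian_length a b \<gamma> = (\<integral>\<^sup>+ s\<in>{a..b}. ennreal (norm (fst (D s))) \<partial>lebesgue)"
proof -
  have ac: "absolutely_continuous_curve a b \<gamma>"
    and AE: "AE s in lebesgue. s \<in> {a..b} \<longrightarrow>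
        (\<exists>v\<in>horizontal_space (\<gamma> s). (\<gamma> has_vector_derivative v) (at s))"
    using assms by (auto simp: horizontal_curve_def)
  obtain D where D: "D \<in> borel_measurable borel"
    "\<And>s v. s \<in> {a<..<b} \<Longrightarrow> (\<gamma> has_vector_derivative v) (at s) \<Longrightarrow> D s = v"
    using measurable_vector_derivative_exists[OF absolutely_continuous_curve_imp_continuous_on[OF ac]]
    by metis
  have AED: "AE s in lebesgue. s \<in> {a..b} \<longrightarrow> (\<gamma> has_vector_derivative D s) (at s) \<and> T_coord (\<gamma> s) (D s) = 0"
    using AE AE_lebesgue_neq[of a] AE_lebesgue_neq[of b]
  proof eventually_elim
    case (elim s)
    show ?case
    proof
      assume "s \<in> {a..b}"
      then have "s \<in> {a<..<b}" using elim by auto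
      moreover obtain v where "T_coord (\<gamma> s) v = 0" "(\<gamma> has_vector_derivative v) (at s)"
        using elim \<open>s \<in> {a..b}\<close> by (auto simp: horizontal_space_iff)
      ultimately show "(\<gamma> has_vector_derivative D s) (at s) \<and> T_coord (\<gamma> s) (D s) = 0"
        using D(2) by auto
    qed
  qed
  have "AE s in lebesgue. s \<in> {a<..<b} \<longrightarrow> (\<gamma> has_vector_derivative D s) (at s) \<and> T_coord (\<gamma> s) (D s) = 0"
    using AED by eventually_elim auto
  from horizontal_curveI(2)[OF ac this] show ?thesis
    using that ac D(1) AED by blast
qed

section \<open>Shifting and joining curves, and the triangle inequality\<close>

lemma absolutely_continuous_curve_shift:
  assumes "absolutely_continuous_curve a b f"
  shows "absolutely_continuous_curve (a + k) (b + k) (\<lambda>s. f (s - k))"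
  unfolding absolutely_continuous_curve_iff
proof (intro allI impI)
  fix e :: real assume "e > 0"
  then obtain d where "d > 0" and d: "\<And>D. nonoverlapping a b D \<Longrightarrow>
     (\<Sum>(l, r)\<in>D. r - l) < d \<Longrightarrow> (\<Sum>(l, r)\<in>D. dist (f l) (f r)) < e"
    using assms unfolding absolutely_continuous_curve_iff by blast
  show "\<exists>d>0. \<forall>D. nonoverlapping (a + k) (b + k) D \<longrightarrow>
     (\<Sum>(l, r)\<in>D. r - l) < d \<longrightarrow> (\<Sum>(l, r)\<in>D. dist (f (l - k)) (f (r - k))) < e"
  proof (intro exI[of _ d] conjI allI impI \<open>d > 0\<close>)
    fix D assume D: "nonoverlapping (a + k) (b + k) D" and small: "(\<Sum>(l, r)\<in>D. r - l) < d"
    let ?h = "\<lambda>(l, r). (l - k, r - k)"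
    have inj: "inj_on ?h D" by (auto intro: inj_onI)
    have "{l - k<..<r - k} \<inter> {l' - k<..<r' - k} = {}" if "{l<..<r} \<inter> {l'<..<r'} = {}" for l r l' r' :: real
    proof (rule ccontr)
      assume "{l - k<..<r - k} \<inter> {l' - k<..<r' - k} \<noteq> {}"
      then obtain x where "x \<in> {l - k<..<r - k} \<inter> {l' - k<..<r' - k}" by blast
      then have "x + k \<in> {l<..<r} \<inter> {l'<..<r'}" by auto
      then show False using that by blast
    qed
    then have "pairwise (\<lambda>I J. disjnt {fst I<..<snd I} {fst J<..<snd J}) (?h ` D)"
      using D unfolding nonoverlapping_def
      by (fastforce simp: pairwise_def disjnt_def)
    then have "nonoverlapping a b (?h ` D)"
      using D unfolding nonoverlapping_def by auto
    moreover have "(\<Sum>(l, r)\<in>?h ` D. r - l) = (\<Sum>(l, r)\<in>D. r - l)"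
      by (subst sum.reindex[OF inj]) (simp add: split_def)
    ultimately have "(\<Sum>(l, r)\<in>?h ` D. dist (f l) (f r)) < e"
      using d small by simp
    also have "(\<Sum>(l, r)\<in>?h ` D. dist (f l) (f r)) = (\<Sum>(l, r)\<in>D. dist (f (l - k)) (f (r - k)))"
      by (subst sum.reindex[OF inj]) (simp add: split_def)
    finally show "(\<Sum>(l, r)\<in>D. dist (f (l - k)) (f (r - k))) < e" .
  qed
qed

lemma nonoverlapping_subset:
  assumes "nonoverlapping a b D" "D' \<subseteq> D" "\<And>l r. (l, r) \<in> D' \<Longrightarrow> a' \<le> l \<and> r \<le> b'"
  shows "nonoverlapping a' b' D'"
  unfolding nonoverlapping_def
proof (intro conjI)
  show "finite D'" using assms(1,2) by (auto simp: nonoverlapping_def intro: finite_subset)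
  show "pairwise (\<lambda>I J. disjnt {fst I<..<snd I} {fst J<..<snd J}) D'"
    using assms(1,2) by (auto simp: nonoverlapping_def intro: pairwise_subset)
  show "\<forall>(l, r)\<in>D'. a' \<le> l \<and> l \<le> r \<and> r \<le> b'"
    using assms by (auto simp: nonoverlapping_def)
qed

text \<open>Disjointness leaves at most one interval of the family with b in its interior. Cutting
  it at b gives one short interval in each half, and these two pieces use up the remaining half of
  e.\<close>

lemma absolutely_continuous_curve_join:
  fixes f :: "real \<Rightarrow> 'a::metric_space"
  assumes "absolutely_continuous_curve a b f" "absolutely_continuous_curve b c f" "a \<le> b" "b \<le> c"
  shows "absolutely_continuous_curve a c f"
  unfolding absolutely_continuous_curve_iff
proof (intro allI impI)
  fix e :: real assume "e > 0"
  then have "e / 4 > 0" by simp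
  obtain d1 where "d1 > 0" and d1: "\<And>D. nonoverlapping a b D \<Longrightarrow>
     (\<Sum>(l, r)\<in>D. r - l) < d1 \<Longrightarrow> (\<Sum>(l, r)\<in>D. dist (f l) (f r)) < e / 4"
    using assms(1) \<open>e / 4 > 0\<close> unfolding absolutely_continuous_curve_iff by blast
  obtain d2 where "d2 > 0" and d2: "\<And>D. nonoverlapping b c D \<Longrightarrow>
     (\<Sum>(l, r)\<in>D. r - l) < d2 \<Longrightarrow> (\<Sum>(l, r)\<in>D. dist (f l) (f r)) < e / 4"
    using assms(2) \<open>e / 4 > 0\<close> unfolding absolutely_continuous_curve_iff by blast
  show "\<exists>d>0. \<forall>D. nonoverlapping a c D \<longrightarrow>
     (\<Sum>(l, r)\<in>D. r - l) < d \<longrightarrow> (\<Sum>(l, r)\<in>D. dist (f l) (f r)) < e"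
  proof (intro exI[of _ "min d1 d2"] conjI allI impI)
    fix D assume D: "nonoverlapping a c D" and small: "(\<Sum>(l, r)\<in>D. r - l) < min d1 d2"
    have fin: "finite D" and lr: "\<And>l r. (l, r) \<in> D \<Longrightarrow> a \<le> l \<and> l \<le> r \<and> r \<le> c"
      using D by (auto simp: nonoverlapping_def)
    let ?A = "{(l, r)\<in>D. r \<le> b}" and ?B = "{(l, r)\<in>D. b \<le> l \<and> b < r}" and ?C = "{(l, r)\<in>D. l < b \<and> b < r}"
    have sub: "(\<Sum>(l, r)\<in>D'. r - l) < min d1 d2" if "D' \<subseteq> D" for D'
      using sum_mono2[OF fin that, of "\<lambda>(l, r). r - l"] lr small by fastforce
    have A: "(\<Sum>(l, r)\<in>?A. dist (f l) (f r)) < e / 4"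
      by (rule d1[OF nonoverlapping_subset[OF D]]) (use sub[of ?A] lr in auto)
    have B: "(\<Sum>(l, r)\<in>?B. dist (f l) (f r)) < e / 4"
      by (rule d2[OF nonoverlapping_subset[OF D]]) (use sub[of ?B] lr in auto)
    have C: "(\<Sum>(l, r)\<in>?C. dist (f l) (f r)) < e / 2"
    proof (cases "?C = {}")
      case True
      then show ?thesis using \<open>e > 0\<close> by (simp only: sum.empty)
    next
      case False
      then obtain l r where lrD: "(l, r) \<in> D" "l < b" "b < r" by auto
      have "?C = {(l, r)}"
      proof -
        have "(l', r') = (l, r)" if "(l', r') \<in> D" "l' < b" "b < r'" for l' r'
        proof (rule ccontr)
          assume "(l', r') \<noteq> (l, r)"
          then have "disjnt {l'<..<r'} {l<..<r}"
            using D that(1) lrD(1) by (fastforce simp: nonoverlapping_def pairwise_def)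
          then show False using that lrD by (auto simp: disjnt_def)
        qed
        then have "?C \<subseteq> {(l, r)}" by blast
        moreover have "(l, r) \<in> ?C" using lrD by simp
        ultimately show ?thesis by blast
      qed
      moreover have "r - l < min d1 d2"
        using sub[of "{(l, r)}"] lrD by simp
      then have "dist (f l) (f b) < e / 4" "dist (f b) (f r) < e / 4"
        using d1[of "{(l, b)}"] d2[of "{(b, r)}"] lrD lr[OF lrD(1)] by (simp_all add: nonoverlapping_def)
      then have "dist (f l) (f r) < e / 2"
        using dist_triangle[of "f l" "f r" "f b"] by simp
      ultimately show ?thesis by simp
    qed
    have "D = ?A \<union> (?B \<union> ?C)" using lr by auto
    moreover have "?A \<inter> (?B \<union> ?C) = {}" "?B \<inter> ?C = {}" by auto
    moreover have "finite ?A" "finite ?B" "finite ?C" by (auto intro: finite_subset[OF _ fin])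
    ultimately have "(\<Sum>(l, r)\<in>D. dist (f l) (f r)) =
        (\<Sum>(l, r)\<in>?A. dist (f l) (f r)) + ((\<Sum>(l, r)\<in>?B. dist (f l) (f r)) + (\<Sum>(l, r)\<in>?C. dist (f l) (f r)))"
      using sum.union_disjoint[of ?A "?B \<union> ?C" "\<lambda>(l, r). dist (f l) (f r)"]
        sum.union_disjoint[of ?B ?C "\<lambda>(l, r). dist (f l) (f r)"] by simp
    then show "(\<Sum>(l, r)\<in>D. dist (f l) (f r)) < e" using A B C by simp
  qed (use \<open>d1 > 0\<close> \<open>d2 > 0\<close> in auto)
qed

lemma absolutely_continuous_curve_cong:
  assumes "\<And>s. a \<le> s \<Longrightarrow> s \<le> b \<Longrightarrow> f s = g s"
  shows "absolutely_continuous_curve a b f \<longleftrightarrow> absolutely_continuous_curve a b g"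
proof -
  have "(\<Sum>(l, r)\<in>D. dist (f l) (f r)) = (\<Sum>(l, r)\<in>D. dist (g l) (g r))" if "nonoverlapping a b D" for D
    using that assms by (intro sum.cong) (auto simp: nonoverlapping_def)
  then show ?thesis unfolding absolutely_continuous_curve_iff by (metis (no_types, lifting))
qed

lemma cc_dist_le_length:
  assumes "a \<le> b" "horizontal_curve a b \<gamma>"
  shows "cc_dist (\<gamma> a) (\<gamma> b) \<le> riemannian_length a b \<gamma>"
proof -
  have "(a, b, \<gamma>) \<in> {(a', b', \<gamma>'). a' \<le> b' \<and> horizontal_curve a' b' \<gamma>' \<and> \<gamma>' a' = \<gamma> a \<and> \<gamma>' b' = \<gamma> b}"
    using assms by simp
  from INF_lower[OF this, of "\<lambda>(a, b, \<gamma>). riemannian_length a b \<gamma>"]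
  show ?thesis unfolding cc_dist_def by simp
qed

lemma cc_dist_lessE:
  assumes "cc_dist p q < c"
  obtains a b \<gamma> where "a \<le> b" "horizontal_curve a b \<gamma>" "\<gamma> a = p" "\<gamma> b = q" "riemannian_length a b \<gamma> < c"
  using assms unfolding cc_dist_def INF_less_iff by auto

lemma cc_dist_greatest:
  assumes "\<And>a b \<gamma>. a \<le> b \<Longrightarrow> horizontal_curve a b \<gamma> \<Longrightarrow> \<gamma> a = p \<Longrightarrow> \<gamma> b = q \<Longrightarrow> c \<le> riemannian_length a b \<gamma>"
  shows "c \<le> cc_dist p q"
  unfolding cc_dist_def by (rule INF_greatest) (use assms in auto)

lemma AE_lebesgue_shift:
  fixes k :: real
  assumes "AE s in lebesgue. P s"
  shows "AE s in lebesgue. P (s - k)"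
proof -
  have "AE s in lborel. P s" using assms by (simp add: AE_completion_iff)
  then obtain N where N: "N \<in> null_sets lborel" "{s. \<not> P s} \<subseteq> N"
    unfolding eventually_ae_filter by auto
  have "AE s in lborel. P (s - k)"
    by (rule AE_I'[OF null_sets_translation[OF N(1), of k]]) (use N(2) in auto)
  then show ?thesis by (rule AE_completion)
qed

lemma borel_measurable_norm_fst:
  fixes D :: "'a \<Rightarrow> 'b::euclidean_space \<times> 'c::euclidean_space"
  assumes "D \<in> borel_measurable M"
  shows "(\<lambda>s. norm (fst (D s))) \<in> borel_measurable M"
  by (rule measurable_compose[OF assms]) (intro borel_measurable_continuous_onI continuous_intros)

lemma horizontal_curve_shift:
  assumes "horizontal_curve a b \<gamma>"
  shows "horizontal_curve (a + k) (b + k) (\<lambda>s. \<gamma> (s - k))"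
    and "riemannian_length (a + k) (b + k) (\<lambda>s. \<gamma> (s - k)) = riemannian_length a b \<gamma>"
proof -
  obtain D where D: "absolutely_continuous_curve a b \<gamma>" "D \<in> borel_measurable borel"
    "AE s in lebesgue. s \<in> {a..b} \<longrightarrow> (\<gamma> has_vector_derivative D s) (at s) \<and> T_coord (\<gamma> s) (D s) = 0"
    "riemannian_length a b \<gamma> = (\<integral>\<^sup>+ s\<in>{a..b}. ennreal (norm (fst (D s))) \<partial>lebesgue)"
    using horizontal_curveE[OF assms] by blast
  have ac: "absolutely_continuous_curve (a + k) (b + k) (\<lambda>s. \<gamma> (s - k))"
    by (rule absolutely_continuous_curve_shift) fact
  have "AE s in lebesgue. s \<in> {a + k<..<b + k} \<longrightarrow>
      ((\<lambda>s. \<gamma> (s - k)) has_vector_derivative D (s - k)) (at s) \<and> T_coord (\<gamma> (s - k)) (D (s - k)) = 0"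
    using AE_lebesgue_shift[OF D(3), of k]
  proof eventually_elim
    case (elim s)
    show ?case
    proof
      assume "s \<in> {a + k<..<b + k}"
      then have s: "(\<gamma> has_vector_derivative D (s - k)) (at (s - k))" "T_coord (\<gamma> (s - k)) (D (s - k)) = 0"
        using elim by auto
      have "((\<lambda>s. s - k) has_vector_derivative 1) (at s)"
        by (auto intro!: derivative_eq_intros)
      from vector_diff_chain_at[OF this s(1)] s(2)
      show "((\<lambda>s. \<gamma> (s - k)) has_vector_derivative D (s - k)) (at s) \<and> T_coord (\<gamma> (s - k)) (D (s - k)) = 0"
        by (simp add: o_def)
    qed
  qed
  note h = horizontal_curveI[OF ac this]
  show "horizontal_curve (a + k) (b + k) (\<lambda>s. \<gamma> (s - k))" by (rule h)
  have "(\<lambda>s. norm (fst (D (s - k)))) \<in> borel_measurable borel"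
    by (rule measurable_compose[OF _ borel_measurable_norm_fst[OF D(2)]]) simp
  then have meas: "(\<lambda>s. ennreal (norm (fst (D (s - k)))) * indicator {a + k..b + k} s) \<in> borel_measurable borel"
    by measurable
  have "riemannian_length (a + k) (b + k) (\<lambda>s. \<gamma> (s - k)) =
      (\<integral>\<^sup>+ s\<in>{a + k..b + k}. ennreal (norm (fst (D (s - k)))) \<partial>lebesgue)" by (rule h)
  also have "\<dots> = (\<integral>\<^sup>+ s. ennreal (norm (fst (D (k + 1 * s - k)))) * indicator {a + k..b + k} (k + 1 * s) \<partial>lebesgue)"
    by (subst nn_integral_real_affine_lebesgue[of _ 1 k]) (use meas in \<open>auto intro!: measurable_completion\<close>)
  also have "\<dots> = (\<integral>\<^sup>+ s\<in>{a..b}. ennreal (norm (fst (D s))) \<partial>lebesgue)"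
    by (intro nn_integral_cong) (auto simp: indicator_def)
  finally show "riemannian_length (a + k) (b + k) (\<lambda>s. \<gamma> (s - k)) = riemannian_length a b \<gamma>"
    using D(4) by simp
qed

lemma horizontal_curve_join:
  assumes g1: "horizontal_curve a b \<gamma>1" and g2: "horizontal_curve b c \<gamma>2"
    and "\<gamma>1 b = \<gamma>2 b" "a \<le> b" "b \<le> c"
  defines "\<gamma> \<equiv> \<lambda>s. if s \<le> b then \<gamma>1 s else \<gamma>2 s"
  shows "horizontal_curve a c \<gamma>"
    and "riemannian_length a c \<gamma> \<le> riemannian_length a b \<gamma>1 + riemannian_length b c \<gamma>2"
proof -
  obtain D1 where D1: "absolutely_continuous_curve a b \<gamma>1" "D1 \<in> borel_measurable borel"
    "AE s in lebesgue. s \<in> {a..b} \<longrightarrow> (\<gamma>1 has_vector_derivative D1 s) (at s) \<and> T_coord (\<gamma>1 s) (D1 s) = 0"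
    "riemannian_length a b \<gamma>1 = (\<integral>\<^sup>+ s\<in>{a..b}. ennreal (norm (fst (D1 s))) \<partial>lebesgue)"
    using horizontal_curveE[OF g1] by blast
  obtain D2 where D2: "absolutely_continuous_curve b c \<gamma>2" "D2 \<in> borel_measurable borel"
    "AE s in lebesgue. s \<in> {b..c} \<longrightarrow> (\<gamma>2 has_vector_derivative D2 s) (at s) \<and> T_coord (\<gamma>2 s) (D2 s) = 0"
    "riemannian_length b c \<gamma>2 = (\<integral>\<^sup>+ s\<in>{b..c}. ennreal (norm (fst (D2 s))) \<partial>lebesgue)"
    using horizontal_curveE[OF g2] by blast
  define D where "D s = (if s \<le> b then D1 s else D2 s)" for s
  have ac: "absolutely_continuous_curve a c \<gamma>"
  proof (rule absolutely_continuous_curve_join[of a b _ c])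
    show "absolutely_continuous_curve a b \<gamma>"
      using D1(1) absolutely_continuous_curve_cong[of a b \<gamma> \<gamma>1] by (simp add: \<gamma>_def)
    show "absolutely_continuous_curve b c \<gamma>"
      using D2(1) absolutely_continuous_curve_cong[of b c \<gamma> \<gamma>2] assms(3) by (auto simp: \<gamma>_def)
  qed fact+
  have "AE s in lebesgue. s \<in> {a<..<c} \<longrightarrow> (\<gamma> has_vector_derivative D s) (at s) \<and> T_coord (\<gamma> s) (D s) = 0"
    using D1(3) D2(3) AE_lebesgue_neq[of b]
  proof eventually_elim
    case (elim s)
    show ?case
    proof
      assume s: "s \<in> {a<..<c}"
      show "(\<gamma> has_vector_derivative D s) (at s) \<and> T_coord (\<gamma> s) (D s) = 0"
      proof (cases "s < b")
        case True
        then have "(\<gamma>1 has_vector_derivative D s) (at s)" "T_coord (\<gamma> s) (D s) = 0"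
          using elim s by (auto simp: D_def \<gamma>_def)
        moreover from this(1) have "(\<gamma> has_vector_derivative D s) (at s)"
          by (rule has_vector_derivative_transform_within_open[where S="{..<b}"]) (use True in \<open>auto simp: \<gamma>_def\<close>)
        ultimately show ?thesis by simp
      next
        case False
        then have "s > b" using elim by auto
        then have "(\<gamma>2 has_vector_derivative D s) (at s)" "T_coord (\<gamma> s) (D s) = 0"
          using elim s by (auto simp: D_def \<gamma>_def)
        moreover from this(1) have "(\<gamma> has_vector_derivative D s) (at s)"
          by (rule has_vector_derivative_transform_within_open[where S="{b<..}"]) (use \<open>s > b\<close> in \<open>auto simp: \<gamma>_def\<close>)
        ultimately show ?thesis by simp
      qed
    qed
  qed
  note h = horizontal_curveI[OF ac this]
  show "horizontal_curve a c \<gamma>" by (rule h)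
  have "riemannian_length a c \<gamma> = (\<integral>\<^sup>+ s\<in>{a..c}. ennreal (norm (fst (D s))) \<partial>lebesgue)" by (rule h)
  also have "\<dots> \<le> (\<integral>\<^sup>+ s. ennreal (norm (fst (D1 s))) * indicator {a..b} s +
      ennreal (norm (fst (D2 s))) * indicator {b..c} s \<partial>lebesgue)"
    by (intro nn_integral_mono) (auto simp: D_def indicator_def)
  also have "\<dots> = riemannian_length a b \<gamma>1 + riemannian_length b c \<gamma>2"
    unfolding D1(4) D2(4) using borel_measurable_norm_fst[OF D1(2)] borel_measurable_norm_fst[OF D2(2)]
    by (intro nn_integral_add measurable_completion) (simp_all, measurable)
  finally show "riemannian_length a c \<gamma> \<le> riemannian_length a b \<gamma>1 + riemannian_length b c \<gamma>2" .
qed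

lemma cc_dist_triangle: "cc_dist p r \<le> cc_dist p q + cc_dist q r"
proof (rule ennreal_le_epsilon)
  fix e :: real assume fin: "cc_dist p q + cc_dist q r < top" and "e > 0"
  have "cc_dist p q < cc_dist p q + ennreal (e / 2)" "cc_dist q r < cc_dist q r + ennreal (e / 2)"
    using fin \<open>e > 0\<close> ennreal_add_left_cancel_less[of _ 0 "ennreal (e / 2)"] by (auto simp: less_top)
  then obtain a b \<gamma>1 c d \<gamma>2 where
    1: "a \<le> b" "horizontal_curve a b \<gamma>1" "\<gamma>1 a = p" "\<gamma>1 b = q" "riemannian_length a b \<gamma>1 < cc_dist p q + ennreal (e / 2)"
    and 2: "c \<le> d" "horizontal_curve c d \<gamma>2" "\<gamma>2 c = q" "\<gamma>2 d = r" "riemannian_length c d \<gamma>2 < cc_dist q r + ennreal (e / 2)"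
    by (elim cc_dist_lessE) blast
  define \<gamma>2' where "\<gamma>2' s = \<gamma>2 (s - (b - c))" for s
  define b' where "b' = d + (b - c)"
  have "horizontal_curve b b' \<gamma>2'" "riemannian_length b b' \<gamma>2' = riemannian_length c d \<gamma>2"
    using horizontal_curve_shift[OF 2(2), of "b - c"] by (simp_all add: \<gamma>2'_def[abs_def] b'_def)
  moreover have "\<gamma>2' b = q" "\<gamma>2' b' = r" "b \<le> b'" using 2 by (auto simp: \<gamma>2'_def b'_def)
  ultimately have
    "horizontal_curve a b' (\<lambda>s. if s \<le> b then \<gamma>1 s else \<gamma>2' s)"
    "riemannian_length a b' (\<lambda>s. if s \<le> b then \<gamma>1 s else \<gamma>2' s) \<le> riemannian_length a b \<gamma>1 + riemannian_length c d \<gamma>2"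
    using horizontal_curve_join[of a b \<gamma>1 b' \<gamma>2'] 1 by auto
  moreover have "(if b' \<le> b then \<gamma>1 b' else \<gamma>2' b') = r"
    using \<open>b \<le> b'\<close> 1(4) \<open>\<gamma>2' b = q\<close> \<open>\<gamma>2' b' = r\<close> by (cases "b' = b") auto
  ultimately have "cc_dist p r \<le> riemannian_length a b \<gamma>1 + riemannian_length c d \<gamma>2"
    using cc_dist_le_length[of a b' "\<lambda>s. if s \<le> b then \<gamma>1 s else \<gamma>2' s"] 1 \<open>b \<le> b'\<close> by force
  also have "\<dots> \<le> (cc_dist p q + ennreal (e / 2)) + (cc_dist q r + ennreal (e / 2))"
    using 1(5) 2(5) by (intro add_mono) auto
  also have "\<dots> = cc_dist p q + cc_dist q r + (ennreal (e / 2) + ennreal (e / 2))"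
    by (simp add: add_ac)
  also have "ennreal (e / 2) + ennreal (e / 2) = ennreal e"
    using \<open>e > 0\<close> by (simp flip: ennreal_plus)
  finally show "cc_dist p r \<le> cc_dist p q + cc_dist q r + ennreal e" .
qed

section \<open>Algebraic operations on absolutely continuous curves\<close>

lemma absolutely_continuous_curve_Pair:
  assumes "absolutely_continuous_curve a b f" "absolutely_continuous_curve a b g"
  shows "absolutely_continuous_curve a b (\<lambda>s. (f s, g s))"
  unfolding absolutely_continuous_curve_iff
proof (intro allI impI)
  fix e :: real assume "e > 0"
  then have "e / 2 > 0" by simp
  obtain d1 where "d1 > 0" and d1: "\<And>D. nonoverlapping a b D \<Longrightarrow>
     (\<Sum>(l, r)\<in>D. r - l) < d1 \<Longrightarrow> (\<Sum>(l, r)\<in>D. dist (f l) (f r)) < e / 2"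
    using assms(1) \<open>e / 2 > 0\<close> unfolding absolutely_continuous_curve_iff by blast
  obtain d2 where "d2 > 0" and d2: "\<And>D. nonoverlapping a b D \<Longrightarrow>
     (\<Sum>(l, r)\<in>D. r - l) < d2 \<Longrightarrow> (\<Sum>(l, r)\<in>D. dist (g l) (g r)) < e / 2"
    using assms(2) \<open>e / 2 > 0\<close> unfolding absolutely_continuous_curve_iff by blast
  have "(\<Sum>(l, r)\<in>D. dist (f l, g l) (f r, g r)) < e"
    if D: "nonoverlapping a b D" "(\<Sum>(l, r)\<in>D. r - l) < min d1 d2" for D
  proof -
    have "dist (f l, g l) (f r, g r) \<le> dist (f l) (f r) + dist (g l) (g r)" for l r
      by (simp add: dist_Pair_Pair sqrt_sum_squares_le_sum)
    then have "(\<Sum>(l, r)\<in>D. dist (f l, g l) (f r, g r)) \<le> (\<Sum>(l, r)\<in>D. dist (f l) (f r) + dist (g l) (g r))"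
      by (intro sum_mono) (simp add: split_def)
    also have "\<dots> = (\<Sum>(l, r)\<in>D. dist (f l) (f r)) + (\<Sum>(l, r)\<in>D. dist (g l) (g r))"
      by (simp add: split_def sum.distrib)
    also have "\<dots> < e" using d1[OF D(1)] d2[OF D(1)] D(2) by simp
    finally show ?thesis .
  qed
  then show "\<exists>d>0. \<forall>D. nonoverlapping a b D \<longrightarrow>
     (\<Sum>(l, r)\<in>D. r - l) < d \<longrightarrow> (\<Sum>(l, r)\<in>D. dist (f l, g l) (f r, g r)) < e"
    using \<open>d1 > 0\<close> \<open>d2 > 0\<close> by (intro exI[of _ "min d1 d2"]) auto
qed

lemma absolutely_continuous_curve_bounded_linear:
  assumes "absolutely_continuous_curve a b f" "bounded_linear A"
  shows "absolutely_continuous_curve a b (\<lambda>s. A (f s))"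
proof -
  obtain K where K: "K \<ge> 0" "\<And>x. norm (A x) \<le> norm x * K"
    using bounded_linear.nonneg_bounded[OF assms(2)] by blast
  show ?thesis
  proof (rule absolutely_continuous_curve_dominated[OF assms(1) K(1)])
    fix l r :: real assume "l \<le> r"
    have "dist (A (f l)) (A (f r)) = norm (A (f l - f r))"
      by (simp add: dist_norm linear_diff[OF bounded_linear.linear[OF assms(2)]])
    also have "\<dots> \<le> K * dist (f l) (f r)" using K(2)[of "f l - f r"] by (simp add: dist_norm mult.commute)
    also have "\<dots> \<le> K * dist (f l) (f r) + K * (r - l)" using K(1) \<open>l \<le> r\<close> by simp
    finally show "dist (A (f l)) (A (f r)) \<le> \<dots>" .
  qed
qed

lemma absolutely_continuous_curve_add:
  fixes f g :: "real \<Rightarrow> 'a::real_normed_vector"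
  assumes "absolutely_continuous_curve a b f" "absolutely_continuous_curve a b g"
  shows "absolutely_continuous_curve a b (\<lambda>s. f s + g s)"
  using absolutely_continuous_curve_bounded_linear[OF absolutely_continuous_curve_Pair[OF assms],
      of "\<lambda>p. fst p + snd p"]
  by (simp add: bounded_linear_add bounded_linear_fst bounded_linear_snd)

lemma absolutely_continuous_curve_lipschitz:
  assumes "\<And>l r. a \<le> l \<Longrightarrow> l \<le> r \<Longrightarrow> r \<le> b \<Longrightarrow> dist (f l) (f r) \<le> C * (r - l)" "C \<ge> 0"
  shows "absolutely_continuous_curve a b f"
  by (rule absolutely_continuous_curve_dominated[OF absolutely_continuous_curve_const[of a b "0::real"] assms(2)])
     (use assms(1) in auto)

text \<open>A bilinear map is Lipschitz on bounded sets, and both curves are bounded because they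
  are continuous on a compact interval.\<close>

lemma absolutely_continuous_curve_bilinear:
  fixes f :: "real \<Rightarrow> 'a::real_normed_vector" and g :: "real \<Rightarrow> 'b::real_normed_vector"
  assumes f: "absolutely_continuous_curve a b f" and g: "absolutely_continuous_curve a b g"
    and bil: "bounded_bilinear h"
  shows "absolutely_continuous_curve a b (\<lambda>s. h (f s) (g s))"
proof -
  interpret bounded_bilinear h by fact
  obtain K where K: "K > 0" "\<And>x y. norm (h x y) \<le> norm x * norm y * K"
    using pos_bounded by blast
  have "bounded (f ` {a..b})" "bounded (g ` {a..b})"
    using f g by (auto intro!: compact_imp_bounded compact_continuous_image
        absolutely_continuous_curve_imp_continuous_on)
  then obtain Bf Bg where B: "\<And>s. s \<in> {a..b} \<Longrightarrow> norm (f s) \<le> Bf" "\<And>s. s \<in> {a..b} \<Longrightarrow> norm (g s) \<le> Bg"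
    unfolding bounded_iff by blast
  define B where "B = max 0 (max Bf Bg)"
  have B': "norm (f s) \<le> B" "norm (g s) \<le> B" if "s \<in> {a..b}" for s
    using B[OF that] by (auto simp: B_def)
  have "B \<ge> 0" by (simp add: B_def)
  show ?thesis
  proof (rule absolutely_continuous_curve_dominated[OF absolutely_continuous_curve_Pair[OF f g], of "2 * B * K"])
    fix l r assume lr: "a \<le> l" "l \<le> r" "r \<le> b"
    have d: "dist (f l) (f r) \<le> dist (f l, g l) (f r, g r)" "dist (g l) (g r) \<le> dist (f l, g l) (f r, g r)"
      by (simp_all add: dist_Pair_Pair real_le_rsqrt)
    have "h (f l) (g l) - h (f r) (g r) = h (f l - f r) (g l) + h (f r) (g l - g r)"
      by (simp add: diff_left diff_right)
    then have "dist (h (f l) (g l)) (h (f r) (g r)) \<le>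
        norm (h (f l - f r) (g l)) + norm (h (f r) (g l - g r))"
      unfolding dist_norm by (metis norm_triangle_ineq)
    also have "\<dots> \<le> norm (f l - f r) * norm (g l) * K + norm (f r) * norm (g l - g r) * K"
      by (intro add_mono K(2))
    also have "\<dots> \<le> dist (f l, g l) (f r, g r) * B * K + B * dist (f l, g l) (f r, g r) * K"
      using d lr B' \<open>B \<ge> 0\<close> K(1) by (intro add_mono mult_mono) (auto simp: dist_norm)
    also have "\<dots> = 2 * B * K * dist (f l, g l) (f r, g r)" by simp
    also have "\<dots> \<le> \<dots> + 2 * B * K * (r - l)" using \<open>B \<ge> 0\<close> K(1) lr by simp
    finally show "dist (h (f l) (g l)) (h (f r) (g r)) \<le> \<dots>" .
  qed (use \<open>B \<ge> 0\<close> K(1) in auto)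
qed

text \<open>The common source of the invariances of the distance: left translations, torus rotations
  and the vertical reflections are affine maps that send horizontal directions to horizontal ones
  and keep the length of the projection. Equality follows each time by applying the estimate also to
  the inverse map.\<close>

lemma cc_dist_affine_le:
  fixes A :: "'n::finite heis \<Rightarrow> 'n heis"
  assumes A: "bounded_linear A"
    and hor: "\<And>q v. T_coord q v = 0 \<Longrightarrow> T_coord (c + A q) (A v) = 0"
    and norm: "\<And>v. norm (fst (A v)) = norm (fst v)"
  shows "cc_dist (c + A p) (c + A q) \<le> cc_dist p q"
proof (rule cc_dist_greatest)
  fix a b and \<gamma> :: "real \<Rightarrow> 'n heis" assume ab: "a \<le> b" and \<gamma>: "horizontal_curve a b \<gamma>" "\<gamma> a = p" "\<gamma> b = q"
  obtain D where D: "absolutely_continuous_curve a b \<gamma>"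
    "AE s in lebesgue. s \<in> {a..b} \<longrightarrow> (\<gamma> has_vector_derivative D s) (at s) \<and> T_coord (\<gamma> s) (D s) = 0"
    "riemannian_length a b \<gamma> = (\<integral>\<^sup>+ s\<in>{a..b}. ennreal (norm (fst (D s))) \<partial>lebesgue)"
    using horizontal_curveE[OF \<gamma>(1)] by blast
  have ac: "absolutely_continuous_curve a b (\<lambda>s. c + A (\<gamma> s))"
    by (rule absolutely_continuous_curve_add[OF absolutely_continuous_curve_const
          absolutely_continuous_curve_bounded_linear[OF D(1) A]])
  have "AE s in lebesgue. s \<in> {a<..<b} \<longrightarrow> ((\<lambda>s. c + A (\<gamma> s)) has_vector_derivative A (D s)) (at s) \<and>
      T_coord (c + A (\<gamma> s)) (A (D s)) = 0"
    using D(2)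
  proof eventually_elim
    case (elim s)
    show ?case
    proof
      assume "s \<in> {a<..<b}"
      then have s: "(\<gamma> has_vector_derivative D s) (at s)" "T_coord (\<gamma> s) (D s) = 0" using elim by auto
      have "((\<lambda>s. c + A (\<gamma> s)) has_vector_derivative 0 + A (D s)) (at s)"
        by (intro has_vector_derivative_add has_vector_derivative_const
            bounded_linear.has_vector_derivative[OF A] s(1))
      then show "((\<lambda>s. c + A (\<gamma> s)) has_vector_derivative A (D s)) (at s) \<and>
          T_coord (c + A (\<gamma> s)) (A (D s)) = 0"
        using hor[OF s(2)] by simp
    qed
  qed
  note h = horizontal_curveI[OF ac this]
  show "cc_dist (c + A p) (c + A q) \<le> riemannian_length a b \<gamma>"
    using cc_dist_le_length[OF ab h(1)] by (simp add: h(2) D(3) norm \<gamma>)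
qed

section \<open>Symmetries of the distance\<close>

lemma heis_mult_left_inverse [simp]: "heis_mult (- p) (heis_mult p q) = q"
  by (simp add: heis_mult_sympl sympl_simps algebra_simps)

lemma heis_mult_zero [simp]: "heis_mult p 0 = p" "heis_mult 0 p = p"
  by (simp_all add: heis_mult_sympl sympl_simps prod_eq_iff)

lemma heis_mult_inverse [simp]: "heis_mult (- p) p = 0" "heis_mult p (- p) = 0"
  by (simp_all add: heis_mult_sympl sympl_simps prod_eq_iff)

lemma cc_dist_left_le: "cc_dist (heis_mult p x) (heis_mult p y) \<le> cc_dist x y"
proof -
  define A :: "'a heis \<Rightarrow> 'a heis" where "A v = (fst v, snd v + 2 * sympl (fst p) (fst v))" for v
  have "heis_mult p v = p + A v" for v
    by (simp add: heis_mult_sympl A_def prod_eq_iff)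
  moreover have "cc_dist (p + A x) (p + A y) \<le> cc_dist x y"
  proof (rule cc_dist_affine_le)
    show "bounded_linear A"
      unfolding A_def
      by (intro bounded_linear_Pair bounded_linear_add bounded_linear_fst bounded_linear_snd
          bounded_linear_compose[OF bounded_linear_mult_right]
          bounded_linear_compose[OF bounded_bilinear.bounded_linear_right[OF bounded_bilinear_sympl]])
  qed (auto simp: A_def T_coord_sympl sympl_simps algebra_simps)
  ultimately show ?thesis by simp
qed

lemma cc_dist_left [simp]: "cc_dist (heis_mult p x) (heis_mult p y) = cc_dist x y"
  using cc_dist_left_le[of p x y] cc_dist_left_le[of "- p" "heis_mult p x" "heis_mult p y"] by simp

lemma cc_dist_eq_from_zero: "cc_dist p q = cc_dist 0 (heis_mult (- p) q)"
  using cc_dist_left[of "- p" p q] by simp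

lemma linear_rot: "linear (rot \<theta>)"
  by (rule linearI) (simp_all add: rot_def vec_eq_iff algebra_simps scaleR_conv_of_real)

lemma sympl_rot: "sympl (fst (rot \<theta> p)) (fst (rot \<theta> q)) = sympl (fst p) (fst q)"
proof -
  have "exp (\<i> * complex_of_real t) * cnj (exp (\<i> * complex_of_real t)) = 1" for t
    by (simp add: exp_cnj flip: exp_add)
  then have "(exp (\<i> * complex_of_real t) * z) * cnj (exp (\<i> * complex_of_real t) * w) = z * cnj w" for t z w
    by (simp add: algebra_simps mult.assoc[symmetric])
  then have "fst (rot \<theta> p) $ j * cnj (fst (rot \<theta> q) $ j) = fst p $ j * cnj (fst q $ j)" for j
    by (simp only: rot_def fst_conv vec_lambda_beta)
  then show ?thesis by (simp only: sympl_def)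
qed

lemma norm_fst_rot [simp]: "norm (fst (rot \<theta> p)) = norm (fst p)"
  by (simp add: rot_def norm_vec_def norm_mult)

lemma snd_rot [simp]: "snd (rot \<theta> p) = snd p"
  by (simp add: rot_def)

lemma rot_add: "rot \<theta> (rot \<phi> p) = rot (\<theta> + \<phi>) p"
  by (simp add: rot_def vec_eq_iff algebra_simps exp_add)

lemma rot_zero [simp]: "rot 0 p = p"
  by (simp add: rot_def prod_eq_iff vec_eq_iff)

lemma cc_dist_rot_le: "cc_dist (rot \<theta> p) (rot \<theta> q) \<le> cc_dist p q"
  using cc_dist_affine_le[of "rot \<theta>" 0 p q] linear_rot[of \<theta>]
  by (simp add: linear_conv_bounded_linear T_coord_sympl sympl_rot)

lemma cc_dist_rot [simp]: "cc_dist (rot \<theta> p) (rot \<theta> q) = cc_dist p q"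
  using cc_dist_rot_le[of \<theta> p q] cc_dist_rot_le[of "- \<theta>" "rot \<theta> p" "rot \<theta> q"]
  by (simp add: rot_add)

text \<open>The antiunitary map below fixes z and reverses the sign of the symplectic form.\<close>

lemma cc_dist_vertical_reflection_le: "cc_dist 0 (z, - t) \<le> cc_dist 0 (z, t)"
proof -
  \<comment> \<open>A phase for which the map u to \<open>c j * cnj u\<close> fixes
    \<open>z $ j\<close>; where that coordinate is 0 any unit number serves.\<close>
  define c where "c j = (if z $ j = 0 then 1 else z $ j / cnj (z $ j))" for j
  have c: "norm (c j) = 1" "c j * cnj (z $ j) = z $ j" for j
    by (auto simp: c_def norm_divide)
  have c1: "c j * cnj (c j) = 1" for j
    using c(1)[of j] by (simp add: complex_mult_cnj cmod_def)
  define A :: "'a heis \<Rightarrow> 'a heis" where "A v = ((\<chi> j. c j * cnj (fst v $ j)), - snd v)" for v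
  have "linear A"
    by (rule linearI) (simp_all add: A_def vec_eq_iff algebra_simps)
  then have A: "bounded_linear A" by (simp add: linear_conv_bounded_linear)
  have "(c j * cnj u) * cnj (c j * cnj w) = cnj u * w" for j u w
    using c1[of j] by (metis (no_types, lifting) complex_cnj_cnj complex_cnj_mult mult.assoc mult.commute mult.right_neutral)
  then have "fst (A u) $ j * cnj (fst (A v) $ j) = cnj (fst u $ j) * fst v $ j" for u v j
    by (simp only: A_def fst_conv vec_lambda_beta)
  then have "sympl (fst (A u)) (fst (A v)) = - sympl (fst u) (fst v)" for u v
    by (simp add: sympl_def flip: sum_negf)
  then have "cc_dist (0 + A 0) (0 + A (z, t)) \<le> cc_dist 0 (z, t)"
    by (intro cc_dist_affine_le A) (auto simp: T_coord_sympl A_def norm_vec_def norm_mult c)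
  moreover have "A 0 = 0" "A (z, t) = (z, - t)"
    by (simp_all add: A_def c prod_eq_iff vec_eq_iff)
  ultimately show ?thesis by simp
qed

lemma cc_dist_vertical_reflection: "cc_dist 0 (z, - t) = cc_dist 0 (z, t)"
  using cc_dist_vertical_reflection_le[of z t] cc_dist_vertical_reflection_le[of z "- t"] by simp

text \<open>Curves are not run backwards. Rotating by pi in every coordinate and then reversing the
  height is the map x to - x, which is group inversion; hence the distance from 0 is even, and left
  invariance gives symmetry.\<close>

lemma cc_dist_commute: "cc_dist p q = cc_dist q p"
proof -
  have uminus: "cc_dist 0 (- x) = cc_dist 0 x" for x :: "'a heis"
  proof -
    have "rot (\<chi> j. pi) x = (- fst x, snd x)"
      by (simp add: rot_def vec_eq_iff)
    moreover have "rot (\<chi> j. pi) (0 :: 'a heis) = 0" by (simp add: rot_def prod_eq_iff vec_eq_iff)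
    ultimately have "cc_dist 0 (- fst x, snd x) = cc_dist 0 x"
      using cc_dist_rot[of "\<chi> j. pi" 0 x] by simp
    then show ?thesis using cc_dist_vertical_reflection[of "- fst x" "snd x"]
      by (simp add: uminus_prod_def)
  qed
  have "heis_mult (- q) p = - heis_mult (- p) q"
    by (simp add: heis_mult_sympl prod_eq_iff sympl_simps sympl_commute[of "fst q"])
  then show ?thesis using uminus cc_dist_eq_from_zero[of p q] cc_dist_eq_from_zero[of q p] by simp
qed

section \<open>Upper bounds from explicit curves\<close>

lemma cc_dist_horizontal_line: "cc_dist p (heis_mult p (w, 0)) \<le> ennreal (norm w)"
proof -
  define \<gamma> :: "real \<Rightarrow> 'a heis" where "\<gamma> s = (s *\<^sub>R w, 0)" for s
  have ac: "absolutely_continuous_curve 0 1 \<gamma>"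
    by (rule absolutely_continuous_curve_lipschitz[of _ _ _ "norm w"])
       (auto simp: \<gamma>_def dist_Pair_Pair dist_norm scaleR_diff_left[symmetric])
  have "AE s in lebesgue. s \<in> {0<..<1} \<longrightarrow> (\<gamma> has_vector_derivative (w, 0)) (at s) \<and> T_coord (\<gamma> s) (w, 0) = 0"
  proof (intro AE_I2 impI conjI)
    fix s
    show "(\<gamma> has_vector_derivative (w, 0)) (at s)"
      unfolding \<gamma>_def
      by (intro has_vector_derivative_Pair has_vector_derivative_const) (auto intro!: derivative_eq_intros)
    show "T_coord (\<gamma> s) (w, 0) = 0" by (simp add: \<gamma>_def T_coord_sympl sympl_simps)
  qed
  note h = horizontal_curveI[OF ac this]
  have "cc_dist (\<gamma> 0) (\<gamma> 1) \<le> ennreal (norm w)"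
    using cc_dist_le_length[OF _ h(1)] by (simp add: h(2) nn_integral_cmult_indicator)
  then have "cc_dist 0 (w, 0) \<le> ennreal (norm w)" by (simp add: \<gamma>_def zero_prod_def)
  then show ?thesis using cc_dist_left[of p 0 "(w, 0)"] by simp
qed

text \<open>A square in a coordinate plane of side r closes up to the vertical displacement - 4 r^2.\<close>

lemma cc_dist_vertical_le: "cc_dist 0 (0, t) \<le> ennreal (2 * sqrt \<bar>t\<bar>)"
proof -
  obtain j :: 'a where True by blast
  \<comment> \<open>Chosen so that 4 r^2 = |t|; the perimeter is then 2 sqrt |t|.\<close>
  define r where "r = sqrt \<bar>t\<bar> / 2"
  have "r \<ge> 0" by (simp add: r_def)
  define u v :: "complex ^ 'a" where "u = axis j (complex_of_real r)" and "v = axis j (\<i> * complex_of_real r)"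
  have nuv: "norm u = r" "norm v = r" using \<open>r \<ge> 0\<close> by (simp_all add: u_def v_def norm_eq_sqrt_inner inner_axis_axis inner_complex_def)
  have uv: "sympl u v = - r\<^sup>2"
    by (simp add: sympl_def u_def v_def axis_def if_distrib sum.delta power2_eq_square cong: if_cong)
  have "4 * r\<^sup>2 = \<bar>t\<bar>" by (simp add: r_def power_divide)
  define p1 p2 p3 :: "'a heis" where "p1 = heis_mult 0 (u, 0)" and "p2 = heis_mult p1 (v, 0)"
    and "p3 = heis_mult p2 (- u, 0)"
  define p4 where "p4 = heis_mult p3 (- v, 0)"
  have p4: "p4 = (0, - \<bar>t\<bar>)"
    using uv \<open>4 * r\<^sup>2 = \<bar>t\<bar>\<close> by (simp add: p4_def p3_def p2_def p1_def heis_mult_sympl sympl_simps sympl_commute[of v u])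
  have "cc_dist 0 p1 \<le> ennreal r" "cc_dist p1 p2 \<le> ennreal r" "cc_dist p2 p3 \<le> ennreal r" "cc_dist p3 p4 \<le> ennreal r"
    using cc_dist_horizontal_line[of 0 u] cc_dist_horizontal_line[of p1 v]
      cc_dist_horizontal_line[of p2 "- u"] cc_dist_horizontal_line[of p3 "- v"] nuv
    by (simp_all add: p1_def p2_def p3_def p4_def)
  then have "cc_dist 0 p4 \<le> ennreal r + (ennreal r + (ennreal r + ennreal r))"
    using cc_dist_triangle[of 0 p4 p1] cc_dist_triangle[of p1 p4 p2] cc_dist_triangle[of p2 p4 p3]
    by (meson add_mono order_trans)
  also have "\<dots> = ennreal (2 * sqrt \<bar>t\<bar>)"
    using \<open>r \<ge> 0\<close> by (simp add: r_def flip: ennreal_plus)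
  finally have "cc_dist 0 (0 :: complex ^ 'a, - \<bar>t\<bar>) \<le> ennreal (2 * sqrt \<bar>t\<bar>)" by (simp add: p4)
  then show ?thesis using cc_dist_vertical_reflection[of "0 :: complex ^ 'a" t]
    by (cases "t \<ge> 0") auto
qed

text \<open>Provides finiteness of the distance, and its continuity in the Euclidean topology,
  because the bound tends to 0 at the origin.\<close>

lemma cc_dist_zero_le:
  fixes z :: "complex ^ 'n::finite"
  shows "cc_dist 0 (z, t) \<le> ennreal (norm z + 2 * sqrt \<bar>t\<bar>)"
proof -
  have "cc_dist 0 (z, t) \<le> cc_dist 0 (z, 0) + cc_dist (z, 0) (z, t)" by (rule cc_dist_triangle)
  also have "cc_dist (z, 0) (z, t) = cc_dist 0 (0 :: complex ^ 'n, t)"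
    using cc_dist_eq_from_zero[of "(z, 0)" "(z, t)"] by (simp add: heis_mult_sympl sympl_simps)
  also have "cc_dist 0 (z, 0) + cc_dist 0 (0 :: complex ^ 'n, t) \<le> ennreal (norm z) + ennreal (2 * sqrt \<bar>t\<bar>)"
    using cc_dist_horizontal_line[of 0 z] by (intro add_mono cc_dist_vertical_le) simp
  finally show ?thesis by simp
qed

section \<open>Length, area and the vertical coordinate\<close>

lemma norm_diff_le_cc_dist: "ennreal (norm (fst q - fst p)) \<le> cc_dist p q"
proof (rule cc_dist_greatest)
  fix a b and \<gamma> :: "real \<Rightarrow> 'a heis"
  assume ab: "a \<le> b" and \<gamma>: "horizontal_curve a b \<gamma>" "\<gamma> a = p" "\<gamma> b = q"
  obtain D where D: "absolutely_continuous_curve a b \<gamma>"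
    "AE s in lebesgue. s \<in> {a..b} \<longrightarrow> (\<gamma> has_vector_derivative D s) (at s) \<and> T_coord (\<gamma> s) (D s) = 0"
    "riemannian_length a b \<gamma> = (\<integral>\<^sup>+ s\<in>{a..b}. ennreal (norm (fst (D s))) \<partial>lebesgue)"
    using horizontal_curveE[OF \<gamma>(1)] by blast
  have "ennreal (norm (fst (\<gamma> b) - fst (\<gamma> a))) \<le> (\<integral>\<^sup>+ s\<in>{a..b}. ennreal (norm (fst (D s))) \<partial>lebesgue)"
    using absolutely_continuous_curve_bounded_linear[OF D(1) bounded_linear_fst] ab
  proof (rule absolutely_continuous_increment_le)
    show "AE s in lebesgue. s \<in> {a..b} \<longrightarrow>
        (\<exists>v. ((\<lambda>s. fst (\<gamma> s)) has_vector_derivative v) (at s) \<and> norm v \<le> norm (fst (D s)))"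
      using D(2) by eventually_elim (blast intro: bounded_linear.has_vector_derivative[OF bounded_linear_fst])
  qed
  then show "ennreal (norm (fst q - fst p)) \<le> riemannian_length a b \<gamma>" using D(3) \<gamma> by simp
qed

text \<open>Here h is the component of the curve perpendicular to its chord z. Reflecting it after time u
  shows that the length is at least that of z + 2 h(u), and t is controlled by sup |h| times the length.\<close>

lemma horizontal_curve_area_bound:
  fixes \<gamma> :: "real \<Rightarrow> 'n::finite heis"
  assumes ab: "a \<le> b" and \<gamma>: "horizontal_curve a b \<gamma>" "\<gamma> a = 0" "\<gamma> b = (z, t)"
    and L: "riemannian_length a b \<gamma> \<le> ennreal L" "L \<ge> 0"
  shows "t\<^sup>2 \<le> 4 * L\<^sup>2 * (L\<^sup>2 - (norm z)\<^sup>2)"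
    and "\<And>u. u \<in> {a..b} \<Longrightarrow> norm (fst (\<gamma> u)) \<le> L"
    and "norm z \<le> L"
proof -
  obtain D where D: "absolutely_continuous_curve a b \<gamma>" "D \<in> borel_measurable borel"
    "AE s in lebesgue. s \<in> {a..b} \<longrightarrow> (\<gamma> has_vector_derivative D s) (at s) \<and> T_coord (\<gamma> s) (D s) = 0"
    "riemannian_length a b \<gamma> = (\<integral>\<^sup>+ s\<in>{a..b}. ennreal (norm (fst (D s))) \<partial>lebesgue)"
    using horizontal_curveE[OF \<gamma>(1)] by blast
  define x where "x s = fst (\<gamma> s)" for s
  have xa: "x a = 0" and xb: "x b = z" using \<gamma> by (simp_all add: x_def)
  have acx: "absolutely_continuous_curve a b x"
    unfolding x_def by (rule absolutely_continuous_curve_bounded_linear[OF D(1) bounded_linear_fst])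
  have dx: "AE s in lebesgue. s \<in> {a..b} \<longrightarrow> (x has_vector_derivative fst (D s)) (at s)"
    using D(3) by eventually_elim
      (auto simp: x_def[abs_def] intro: bounded_linear.has_vector_derivative[OF bounded_linear_fst])
  have meas: "(\<lambda>s. ennreal (norm (fst (D s))) * indicator {c..d} s) \<in> borel_measurable lebesgue" for c d
    using borel_measurable_norm_fst[OF D(2)] by (intro measurable_completion) (simp, measurable)
  have inc: "ennreal (norm (x d - x c)) \<le> (\<integral>\<^sup>+ s\<in>{c..d}. ennreal (norm (fst (D s))) \<partial>lebesgue)"
    if "a \<le> c" "c \<le> d" "d \<le> b" for c d
  proof (rule absolutely_continuous_increment_le)
    show "absolutely_continuous_curve c d x"
      by (rule absolutely_continuous_curve_subinterval[OF acx that(1,3)])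
    show "AE s in lebesgue. s \<in> {c..d} \<longrightarrow>
        (\<exists>v. (x has_vector_derivative v) (at s) \<and> norm v \<le> norm (fst (D s)))"
      using dx by eventually_elim (use that in auto)
  qed fact
  have broken: "norm (x u) + norm (z - x u) \<le> L" if u: "u \<in> {a..b}" for u
  proof -
    have "ennreal (norm (x u) + norm (z - x u)) = ennreal (norm (x u - x a)) + ennreal (norm (x b - x u))"
      by (simp add: xa xb)
    also have "\<dots> \<le> (\<integral>\<^sup>+ s\<in>{a..u}. ennreal (norm (fst (D s))) \<partial>lebesgue) +
        (\<integral>\<^sup>+ s\<in>{u..b}. ennreal (norm (fst (D s))) \<partial>lebesgue)"
      using u by (intro add_mono inc) auto
    also have "\<dots> = (\<integral>\<^sup>+ s. ennreal (norm (fst (D s))) * indicator {a..u} s +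
        ennreal (norm (fst (D s))) * indicator {u..b} s \<partial>lebesgue)"
      by (rule nn_integral_add[symmetric]) (rule meas)+
    also have "\<dots> = (\<integral>\<^sup>+ s\<in>{a..b}. ennreal (norm (fst (D s))) \<partial>lebesgue)"
    proof (rule nn_integral_cong_AE)
      show "AE s in lebesgue. ennreal (norm (fst (D s))) * indicator {a..u} s +
          ennreal (norm (fst (D s))) * indicator {u..b} s = ennreal (norm (fst (D s))) * indicator {a..b} s"
        using AE_lebesgue_neq[of u] by eventually_elim (use u in \<open>auto simp: indicator_def\<close>)
    qed
    also have "\<dots> \<le> ennreal L" using L(1) D(4) by simp
    finally show ?thesis using L(2) by (subst (asm) ennreal_le_iff) auto
  qed
  show normx: "norm (fst (\<gamma> u)) \<le> L" if "u \<in> {a..b}" for u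
    using broken[OF that] norm_ge_zero[of "z - x u"] unfolding x_def[symmetric] by linarith
  show zL: "norm z \<le> L" using broken[of b] ab by (simp add: xb)
  \<comment> \<open>The projection to the line of the chord. For z = 0 the quotient is 0 by
    convention, so \<open>P\<close> vanishes and \<open>h\<close> is the identity, and closed curves
    are covered as well.\<close>
  define P where "P y = ((y \<bullet> z) / (z \<bullet> z)) *\<^sub>R z" for y
  define h where "h y = y - P y" for y
  have blP: "bounded_linear P" unfolding P_def
    by (intro bounded_linear_scaleR_const bounded_linear_divide[THEN bounded_linear_compose]
        bounded_linear_inner_left)
  then have blh: "bounded_linear h" unfolding h_def by (intro bounded_linear_sub bounded_linear_ident)
  have Ph: "P y + h y = y" for y by (simp add: h_def)
  have hz: "h y \<bullet> z = 0" for y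
    by (cases "z = 0") (simp_all add: h_def P_def inner_diff_left)
  have hh: "h z = 0" by (cases "z = 0") (simp_all add: h_def P_def)
  have PP: "sympl (P y) (P y') = 0" for y y' by (simp add: P_def sympl_simps)
  have Ple: "norm (P y) \<le> norm y" for y
  proof (cases "z = 0")
    case False
    have "\<bar>y \<bullet> z\<bar> \<le> norm y * norm z" by (rule Cauchy_Schwarz_ineq2)
    then show ?thesis using False
      by (simp add: P_def power2_norm_eq_inner[symmetric] power2_eq_square field_simps)
  qed (simp add: P_def)
  \<comment> \<open>As h(u) is perpendicular to z, the bound |z + 2 h(u)| \<le> L reads |z|^2 + 4
    |h(u)|^2 \<le> L^2, that is, |h(u)| \<le> m.\<close>
  define m where "m = sqrt (L\<^sup>2 - (norm z)\<^sup>2) / 2"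
  have Lz: "L\<^sup>2 - (norm z)\<^sup>2 \<ge> 0" using zL by (simp add: power_mono)
  have "m \<ge> 0" using Lz by (simp add: m_def)
  have hm: "norm (h (x u)) \<le> m" if u: "u \<in> {a..b}" for u
  proof -
    let ?h = "h (x u)" and ?p = "P (x u)"
    have zh: "z \<bullet> ?h = 0" "?p \<bullet> ?h = 0" using hz[of "x u"] by (simp_all add: P_def inner_commute)
    have "(norm (z - ?p + ?h))\<^sup>2 = (norm (z - ?p - ?h))\<^sup>2"
      unfolding power2_norm_eq_inner using zh
      by (simp add: inner_add_left inner_add_right inner_diff_left inner_diff_right inner_commute)
    then have "norm (z - ?p + ?h) = norm (z - ?p - ?h)" by (simp add: power2_eq_iff_nonneg)
    moreover have "z - ?p - ?h = z - x u" by (simp add: h_def)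
    moreover have "z + 2 *\<^sub>R ?h = x u + (z - ?p + ?h)"
      by (simp add: h_def scaleR_2)
    ultimately have "norm (z + 2 *\<^sub>R ?h) \<le> L"
      using norm_triangle_ineq[of "x u" "z - ?p + ?h"] broken[OF u] by (metis order_trans)
    then have "(norm (z + 2 *\<^sub>R ?h))\<^sup>2 \<le> L\<^sup>2" by (simp add: power_mono)
    moreover have "(norm (z + 2 *\<^sub>R ?h))\<^sup>2 = (norm z)\<^sup>2 + 4 * (norm ?h)\<^sup>2"
      unfolding power2_norm_eq_inner using zh
      by (simp add: inner_add_left inner_add_right inner_commute)
    ultimately have "(2 * norm ?h)\<^sup>2 \<le> L\<^sup>2 - (norm z)\<^sup>2" by (simp add: power_mult_distrib)
    then have "2 * norm ?h \<le> sqrt (L\<^sup>2 - (norm z)\<^sup>2)" by (rule real_le_rsqrt)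
    then show ?thesis by (simp add: m_def)
  qed
  \<comment> \<open>The correction is 0 at both endpoints, since \<open>h\<close> vanishes at 0 and
    at z. It cancels the part of the derivative of the height that pairs \<open>P (x s)\<close>,
    which need not be small, with the velocity; every remaining term carries the factor
    \<open>h (x s)\<close>.\<close>
  define F where "F s = snd (\<gamma> s) + (- 2) * sympl (P (x s)) (h (x s))" for s
  have "absolutely_continuous_curve a b (\<lambda>s. sympl (P (x s)) (h (x s)))"
    by (rule absolutely_continuous_curve_bilinear[OF absolutely_continuous_curve_bounded_linear[OF acx blP]
          absolutely_continuous_curve_bounded_linear[OF acx blh] bounded_bilinear_sympl])
  then have acF: "absolutely_continuous_curve a b F"
    unfolding F_def
    by (intro absolutely_continuous_curve_add[OF absolutely_continuous_curve_bounded_linear[OF D(1) bounded_linear_snd]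
          absolutely_continuous_curve_bounded_linear[OF _ bounded_linear_mult_right]])
  have "F a = 0" "F b = t"
    using \<gamma> by (simp_all add: F_def x_def hh sympl_simps)
      (simp_all add: h_def P_def sympl_simps)
  have "ennreal (norm (F b - F a)) \<le> (\<integral>\<^sup>+ s\<in>{a..b}. ennreal (4 * m * norm (fst (D s))) \<partial>lebesgue)"
  proof (rule absolutely_continuous_increment_le[OF acF ab])
    show "AE s in lebesgue. s \<in> {a..b} \<longrightarrow>
        (\<exists>v. (F has_vector_derivative v) (at s) \<and> norm v \<le> 4 * m * norm (fst (D s)))"
      using D(3) dx
    proof eventually_elim
      case (elim s)
      show ?case
      proof
        assume s: "s \<in> {a..b}"
        let ?x' = "fst (D s)"
        have x': "(x has_vector_derivative ?x') (at s)" and T: "snd (D s) = 2 * sympl (x s) ?x'"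
          and \<gamma>': "(\<gamma> has_vector_derivative D s) (at s)"
          using elim s by (auto simp: T_coord_sympl x_def)
        have "(F has_vector_derivative snd (D s) + (- 2) * (sympl (P (x s)) (h ?x') + sympl (P ?x') (h (x s)))) (at s)"
          unfolding F_def
          by (intro has_vector_derivative_add has_vector_derivative_mult_right has_vector_derivative_sympl
              bounded_linear.has_vector_derivative[OF bounded_linear_snd]
              bounded_linear.has_vector_derivative[OF blP] bounded_linear.has_vector_derivative[OF blh] x' \<gamma>')
        moreover have "snd (D s) + (- 2) * (sympl (P (x s)) (h ?x') + sympl (P ?x') (h (x s))) =
            2 * sympl (h (x s)) ?x' + 2 * sympl (h (x s)) (P ?x')"
        proof -
          have "sympl (x s) ?x' = sympl (P (x s)) (P ?x') + sympl (P (x s)) (h ?x') + sympl (h (x s)) ?x'"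
            by (metis Ph bounded_bilinear.add_left[OF bounded_bilinear_sympl] bounded_bilinear.add_right[OF bounded_bilinear_sympl])
          then show ?thesis using T PP[of "x s" ?x'] sympl_commute[of "P ?x'" "h (x s)"] by simp
        qed
        moreover have "norm (2 * sympl (h (x s)) ?x' + 2 * sympl (h (x s)) (P ?x')) \<le> 4 * m * norm ?x'"
        proof -
          have "\<bar>sympl (h (x s)) ?x'\<bar> \<le> m * norm ?x'"
            using abs_sympl_le[of "h (x s)" ?x'] hm[OF s] by (meson mult_right_mono norm_ge_zero order_trans)
          moreover have "\<bar>sympl (h (x s)) (P ?x')\<bar> \<le> m * norm ?x'"
            using abs_sympl_le[of "h (x s)" "P ?x'"] hm[OF s] Ple[of ?x'] \<open>m \<ge> 0\<close>
            by (meson mult_mono norm_ge_zero order_trans)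
          ultimately show ?thesis by (simp add: abs_le_iff)
        qed
        ultimately show "\<exists>v. (F has_vector_derivative v) (at s) \<and> norm v \<le> 4 * m * norm ?x'"
          by metis
      qed
    qed
  qed
  also have "\<dots> = (\<integral>\<^sup>+ s. ennreal (4 * m) * (ennreal (norm (fst (D s))) * indicator {a..b} s) \<partial>lebesgue)"
    using \<open>m \<ge> 0\<close> by (intro nn_integral_cong) (simp add: ennreal_mult mult.assoc)
  also have "\<dots> = ennreal (4 * m) * riemannian_length a b \<gamma>"
    unfolding D(4) by (rule nn_integral_cmult) (rule meas)
  also have "\<dots> \<le> ennreal (4 * m) * ennreal L" by (intro mult_left_mono L) simp
  finally have "ennreal \<bar>t\<bar> \<le> ennreal (4 * m * L)"
    using \<open>F a = 0\<close> \<open>F b = t\<close> \<open>m \<ge> 0\<close> L(2) by (simp add: ennreal_mult)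
  then have "\<bar>t\<bar> \<le> 4 * m * L" using \<open>m \<ge> 0\<close> L(2) by (simp add: ennreal_le_iff)
  then have "t\<^sup>2 \<le> (4 * m * L)\<^sup>2" by (metis abs_ge_zero power2_abs power_mono)
  also have "\<dots> = 4 * L\<^sup>2 * (L\<^sup>2 - (norm z)\<^sup>2)"
    using Lz by (simp add: m_def power_mult_distrib power_divide)
  finally show "t\<^sup>2 \<le> 4 * L\<^sup>2 * (L\<^sup>2 - (norm z)\<^sup>2)" .
qed

text \<open>The curve with horizontal projection (1 - s) (chord) + s (original) has length at most
  (1 - s) |z| + s L; its endpoint height is a quadratic polynomial in s, which takes the value t'.\<close>

lemma horizontal_curve_shrink:
  fixes \<gamma> :: "real \<Rightarrow> 'n::finite heis"
  assumes ab: "a \<le> b" and \<gamma>: "horizontal_curve a b \<gamma>" "\<gamma> a = 0" "\<gamma> b = (z, t)"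
    and L: "riemannian_length a b \<gamma> \<le> ennreal L" "L \<ge> 0" and t': "0 \<le> t'" "t' \<le> t"
  obtains s where "0 \<le> s" "s \<le> 1" "t - t' \<le> (1 - s) * (8 * L\<^sup>2)"
    "cc_dist 0 (z, t') \<le> ennreal ((1 - s) * norm z + s * L)"
proof (cases "a = b")
  case True
  then have z0: "z = 0 \<and> t = 0" using \<gamma> by (metis Pair_inject zero_prod_def)
  then have "t' = 0" using t' by simp
  have "cc_dist 0 (z, t') = 0"
    using cc_dist_zero_le[of z t'] z0 \<open>t' = 0\<close> by simp
  then show ?thesis using that[of 1] z0 \<open>t' = 0\<close> by simp
next
  case False
  then have ab': "a < b" using ab by simp
  define k where "k = b - a"
  have k: "k > 0" using ab' by (simp add: k_def)
  note area = horizontal_curve_area_bound[OF ab \<gamma> L]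
  obtain D where D: "absolutely_continuous_curve a b \<gamma>" "D \<in> borel_measurable borel"
    "AE s in lebesgue. s \<in> {a..b} \<longrightarrow> (\<gamma> has_vector_derivative D s) (at s) \<and> T_coord (\<gamma> s) (D s) = 0"
    "riemannian_length a b \<gamma> = (\<integral>\<^sup>+ s\<in>{a..b}. ennreal (norm (fst (D s))) \<partial>lebesgue)"
    using horizontal_curveE[OF \<gamma>(1)] by blast
  define x where "x s = fst (\<gamma> s)" for s
  have acx: "absolutely_continuous_curve a b x"
    unfolding x_def by (rule absolutely_continuous_curve_bounded_linear[OF D(1) bounded_linear_fst])
  have xL: "norm (x u) \<le> L" if "u \<in> {a..b}" for u using area(2)[OF that] by (simp add: x_def)
  define \<sigma> where "\<sigma> u = ((u - a) / k) *\<^sub>R z" for u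
  define w where "w = (1 / k) *\<^sub>R z"
  have \<sigma>': "(\<sigma> has_vector_derivative w) (at u)" for u
    unfolding \<sigma>_def w_def using k by (auto intro!: derivative_eq_intros)
  have nw: "norm w = norm z / k" using k by (simp add: w_def)
  have ac\<sigma>: "absolutely_continuous_curve a b \<sigma>"
    by (rule absolutely_continuous_curve_lipschitz[of _ _ _ "norm w"])
       (use k in \<open>simp_all add: \<sigma>_def dist_norm scaleR_diff_left[symmetric] diff_divide_distrib[symmetric] nw mult.commute\<close>)
  define J where "J u = integral {a..u} (\<lambda>v. sympl (x v) w)" for u
  have contf: "continuous_on {a..b} (\<lambda>v. sympl (x v) w)"
    by (intro bounded_bilinear.continuous_on[OF bounded_bilinear_sympl] continuous_on_const
        absolutely_continuous_curve_imp_continuous_on acx)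
  have intf: "(\<lambda>v. sympl (x v) w) integrable_on {c..d}" if "a \<le> c" "d \<le> b" for c d
    by (rule integrable_continuous_interval, rule continuous_on_subset[OF contf]) (use that in auto)
  have Jle: "\<bar>integral {c..d} (\<lambda>v. sympl (x v) w)\<bar> \<le> L * norm w * (d - c)" if "a \<le> c" "c \<le> d" "d \<le> b" for c d
  proof -
    have "norm (integral {c..d} (\<lambda>v. sympl (x v) w)) \<le> L * norm w * (d - c)"
    proof (rule integral_bound)
      show "continuous_on {c..d} (\<lambda>v. sympl (x v) w)"
        by (rule continuous_on_subset[OF contf]) (use that in auto)
      show "norm (sympl (x v) w) \<le> L * norm w" if "v \<in> {c..d}" for v
      proof -
        have "norm (x v) * norm w \<le> L * norm w"
          using xL[of v] that \<open>a \<le> c\<close> \<open>d \<le> b\<close> by (intro mult_right_mono) auto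
        then show ?thesis using abs_sympl_le[of "x v" w] by simp
      qed
    qed fact
    then show ?thesis by simp
  qed
  have J': "(J has_vector_derivative sympl (x u) w) (at u)" if "u \<in> {a<..<b}" for u
  proof -
    have "(J has_vector_derivative sympl (x u) w) (at u within {a..b})"
      unfolding J_def by (rule integral_has_vector_derivative[OF contf]) (use that in auto)
    moreover have "at u within {a..b} = at u" using that by (intro at_within_Icc_at) auto
    ultimately show ?thesis by (simp only:)
  qed
  have acJ: "absolutely_continuous_curve a b J"
  proof (rule absolutely_continuous_curve_lipschitz[of _ _ _ "L * norm w"])
    fix l r assume lr: "a \<le> l" "l \<le> r" "r \<le> b"
    have "J l + integral {l..r} (\<lambda>v. sympl (x v) w) = J r"
      unfolding J_def using lr by (intro Henstock_Kurzweil_Integration.integral_combine intf) auto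
    then show "dist (J l) (J r) \<le> L * norm w * (r - l)"
      using Jle[OF lr] by (simp add: dist_real_def)
  qed (simp add: L(2))
  define c where "c = J b"
  have c: "\<bar>c\<bar> \<le> L\<^sup>2"
  proof -
    have "\<bar>c\<bar> \<le> L * norm w * k" using Jle[of a b] ab by (simp add: c_def J_def k_def)
    also have "\<dots> = L * norm z" using k by (simp add: nw)
    also have "\<dots> \<le> L * L" using area(3) L(2) by (intro mult_left_mono)
    finally show ?thesis by (simp add: power2_eq_square)
  qed
  have tL: "t \<le> 2 * L\<^sup>2"
  proof (rule power2_le_imp_le)
    have "t\<^sup>2 \<le> 4 * L\<^sup>2 * (L\<^sup>2 - (norm z)\<^sup>2)" by (rule area(1))
    also have "\<dots> \<le> 4 * L\<^sup>2 * L\<^sup>2" by (intro mult_left_mono) auto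
    finally show "t\<^sup>2 \<le> (2 * L\<^sup>2)\<^sup>2" by (simp add: power2_eq_square)
  qed simp
  \<comment> \<open>The height reached by the interpolated curve: 0 for the chord (s = 0) and t for
    the given curve (s = 1). The sign of \<open>c\<close> is unknown, so \<open>g\<close> need not
    be monotone and s is found by the intermediate value theorem.\<close>
  define g where "g s = s\<^sup>2 * t + 4 * s * (1 - s) * c" for s
  have "\<exists>s\<ge>0. s \<le> 1 \<and> g s = t'"
  proof (rule IVT')
    show "continuous_on {0..1} g" unfolding g_def by (intro continuous_intros)
  qed (use t' in \<open>auto simp: g_def\<close>)
  then obtain s where s: "0 \<le> s" "s \<le> 1" "g s = t'" by blast
  \<comment> \<open>The 8 is 4 + 4: (1 + s) t contributes at most 4 L^2 because t \<le> 2 L^2, and 4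
    s |c| at most 4 L^2.\<close>
  have tt': "t - t' \<le> (1 - s) * (8 * L\<^sup>2)"
  proof -
    have "t - t' = (1 - s) * ((1 + s) * t - 4 * s * c)"
      unfolding s(3)[symmetric] g_def by (simp add: power2_eq_square algebra_simps)
    also have "\<dots> \<le> (1 - s) * (8 * L\<^sup>2)"
    proof (rule mult_left_mono)
      have "(1 + s) * t \<le> 2 * (2 * L\<^sup>2)" using s t' tL by (intro mult_mono) auto
      moreover have "- (s * c) \<le> 1 * L\<^sup>2"
      proof -
        have "s * (- c) \<le> s * L\<^sup>2" using s c by (intro mult_left_mono) auto
        also have "\<dots> \<le> 1 * L\<^sup>2" using s by (intro mult_right_mono) auto
        finally show ?thesis by simp
      qed
      ultimately show "(1 + s) * t - 4 * s * c \<le> 8 * L\<^sup>2" by simp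
    qed (use s in simp)
    finally show ?thesis .
  qed
  define y where "y u = (1 - s) *\<^sub>R \<sigma> u + s *\<^sub>R x u" for u
  \<comment> \<open>The horizontal lift of \<open>y\<close> in closed form. The cross terms of 2
    sympl y y' are 2 s (1 - s) (sympl \<sigma> x' + sympl x w), and sympl \<sigma> x + 2 J is a
    primitive of the bracket; the integrand of \<open>J\<close> is continuous, whereas x' is merely
    measurable.\<close>
  define \<tau> where "\<tau> u = (2 * s * (1 - s)) * (sympl (\<sigma> u) (x u) + 2 * J u) + s\<^sup>2 * snd (\<gamma> u)" for u
  define \<delta> where "\<delta> u = (y u, \<tau> u)" for u
  define D' where "D' u = ((1 - s) *\<^sub>R w + s *\<^sub>R fst (D u),
      (2 * s * (1 - s)) * ((sympl (\<sigma> u) (fst (D u)) + sympl w (x u)) + 2 * sympl (x u) w) + s\<^sup>2 * snd (D u))" for u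
  have ac\<delta>: "absolutely_continuous_curve a b \<delta>"
    unfolding \<delta>_def y_def \<tau>_def
    by (rule absolutely_continuous_curve_Pair
        absolutely_continuous_curve_add[OF absolutely_continuous_curve_bounded_linear[OF ac\<sigma> bounded_linear_scaleR_right]
            absolutely_continuous_curve_bounded_linear[OF acx bounded_linear_scaleR_right]]
        absolutely_continuous_curve_add[OF absolutely_continuous_curve_bounded_linear[OF absolutely_continuous_curve_add[OF
                 absolutely_continuous_curve_bilinear[OF ac\<sigma> acx bounded_bilinear_sympl]
                 absolutely_continuous_curve_bounded_linear[OF acJ bounded_linear_mult_right]] bounded_linear_mult_right]
            absolutely_continuous_curve_bounded_linear[OF absolutely_continuous_curve_bounded_linear[OF D(1) bounded_linear_snd]
                 bounded_linear_mult_right]])+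
  have "AE u in lebesgue. u \<in> {a<..<b} \<longrightarrow> (\<delta> has_vector_derivative D' u) (at u) \<and> T_coord (\<delta> u) (D' u) = 0"
    using D(3)
  proof eventually_elim
    case (elim u)
    show ?case
    proof
      assume u: "u \<in> {a<..<b}"
      have \<gamma>': "(\<gamma> has_vector_derivative D u) (at u)" and T: "snd (D u) = 2 * sympl (x u) (fst (D u))"
        using elim u by (auto simp: T_coord_sympl x_def)
      have x': "(x has_vector_derivative fst (D u)) (at u)"
        unfolding x_def by (rule bounded_linear.has_vector_derivative[OF bounded_linear_fst \<gamma>'])
      have "(\<delta> has_vector_derivative D' u) (at u)"
        unfolding \<delta>_def y_def \<tau>_def D'_def
        by (intro has_vector_derivative_Pair has_vector_derivative_add has_vector_derivative_mult_right
            has_vector_derivative_sympl bounded_linear.has_vector_derivative[OF bounded_linear_scaleR_right]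
            bounded_linear.has_vector_derivative[OF bounded_linear_snd] \<gamma>' x' \<sigma>' J'[OF u])
      moreover have "sympl (\<sigma> u) w = 0" by (simp add: \<sigma>_def w_def sympl_simps)
      then have "T_coord (\<delta> u) (D' u) = 0"
        using T sympl_commute[of w "x u"]
        by (simp add: T_coord_sympl \<delta>_def D'_def y_def sympl_simps algebra_simps power2_eq_square)
      ultimately show "(\<delta> has_vector_derivative D' u) (at u) \<and> T_coord (\<delta> u) (D' u) = 0" by simp
    qed
  qed
  note h = horizontal_curveI[OF ac\<delta> this]
  have "x a = 0" "x b = z" "\<sigma> a = 0" "\<sigma> b = z" "J a = 0"
    using \<gamma> k by (simp_all add: x_def \<sigma>_def J_def k_def)
  then have "\<delta> a = 0" "\<delta> b = (z, t')"
    using \<gamma> s(3) by (simp_all add: \<delta>_def y_def \<tau>_def sympl_simps zero_prod_def g_def c_def algebra_simps)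
  have meas: "(\<lambda>u. ennreal (norm (fst (D u))) * indicator {a..b} u) \<in> borel_measurable lebesgue"
    using borel_measurable_norm_fst[OF D(2)] by (intro measurable_completion) (simp, measurable)
  have "cc_dist 0 (z, t') \<le> riemannian_length a b \<delta>"
    using cc_dist_le_length[OF ab h(1)] \<open>\<delta> a = 0\<close> \<open>\<delta> b = (z, t')\<close> by simp
  also have "\<dots> = (\<integral>\<^sup>+ u\<in>{a..b}. ennreal (norm (fst (D' u))) \<partial>lebesgue)" by (rule h(2))
  also have "\<dots> \<le> (\<integral>\<^sup>+ u. ennreal ((1 - s) * norm w) * indicator {a..b} u +
      ennreal s * (ennreal (norm (fst (D u))) * indicator {a..b} u) \<partial>lebesgue)"
  proof (intro nn_integral_mono)
    fix u
    have "norm (fst (D' u)) \<le> (1 - s) * norm w + s * norm (fst (D u))"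
      unfolding D'_def fst_conv by (rule order_trans[OF norm_triangle_ineq]) (use s in simp)
    then have "ennreal (norm (fst (D' u))) \<le> ennreal ((1 - s) * norm w) + ennreal s * ennreal (norm (fst (D u)))"
      using s by (simp add: ennreal_leI flip: ennreal_plus ennreal_mult)
    then show "ennreal (norm (fst (D' u))) * indicator {a..b} u \<le> ennreal ((1 - s) * norm w) * indicator {a..b} u +
      ennreal s * (ennreal (norm (fst (D u))) * indicator {a..b} u)"
      by (simp add: indicator_def)
  qed
  also have "\<dots> = (\<integral>\<^sup>+ u. ennreal ((1 - s) * norm w) * indicator {a..b} u \<partial>lebesgue) +
      (\<integral>\<^sup>+ u. ennreal s * (ennreal (norm (fst (D u))) * indicator {a..b} u) \<partial>lebesgue)"
  proof (rule nn_integral_add)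
    have "{a..b} \<in> sets lebesgue" by simp
    then show "(\<lambda>u. ennreal ((1 - s) * norm w) * indicator {a..b} u) \<in> borel_measurable lebesgue"
      by measurable
    show "(\<lambda>u. ennreal s * (ennreal (norm (fst (D u))) * indicator {a..b} u)) \<in> borel_measurable lebesgue"
      using meas by measurable
  qed
  also have "(\<integral>\<^sup>+ u. ennreal ((1 - s) * norm w) * indicator {a..b} u \<partial>lebesgue) = ennreal ((1 - s) * norm w) * ennreal k"
    using ab by (simp add: nn_integral_cmult_indicator k_def)
  also have "\<dots> = ennreal ((1 - s) * norm z)"
    using k s by (simp add: nw flip: ennreal_mult)
  also have "(\<integral>\<^sup>+ u. ennreal s * (ennreal (norm (fst (D u))) * indicator {a..b} u) \<partial>lebesgue) =
      ennreal s * riemannian_length a b \<gamma>"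
    unfolding D(4) by (rule nn_integral_cmult) (rule meas)
  also have "\<dots> \<le> ennreal s * ennreal L" by (intro mult_left_mono L) simp
  also have "ennreal ((1 - s) * norm z) + ennreal s * ennreal L = ennreal ((1 - s) * norm z + s * L)"
    using s L(2) by (simp flip: ennreal_mult)
  finally show ?thesis using that s tt' by (simp add: add_left_mono)
qed

section \<open>The distance as a real function and its monotonicity in the height\<close>

definition cc_norm :: "'n::finite heis \<Rightarrow> real" where
  "cc_norm x = enn2real (cc_dist 0 x)"

definition ccd :: "'n::finite heis \<Rightarrow> 'n heis \<Rightarrow> real" where
  "ccd p q = cc_norm (heis_mult (- p) q)"

lemma cc_dist_zero: "cc_dist 0 x = ennreal (cc_norm x)"
proof -
  have "cc_dist 0 x < top"
    using cc_dist_zero_le[of "fst x" "snd x"] by (simp add: le_less_trans)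
  then show ?thesis by (simp add: cc_norm_def)
qed

lemma cc_norm_nonneg [simp]: "cc_norm x \<ge> 0"
  by (simp add: cc_norm_def)

lemma ccd_nonneg [simp]: "ccd p q \<ge> 0"
  by (simp add: ccd_def)

lemma cc_dist_eq: "cc_dist p q = ennreal (ccd p q)"
  by (simp add: cc_dist_eq_from_zero[of p q] ccd_def cc_dist_zero)

lemma ccd_zero: "ccd 0 x = cc_norm x"
  by (simp add: ccd_def)

lemma ccd_commute: "ccd p q = ccd q p"
  using cc_dist_commute[of p q] by (simp add: cc_dist_eq)

lemma ccd_triangle: "ccd p r \<le> ccd p q + ccd q r"
  using cc_dist_triangle[of p r q] by (simp add: cc_dist_eq flip: ennreal_plus)

lemma ccd_rot: "ccd (rot \<theta> x) (rot \<theta> y) = ccd x y"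
  using cc_dist_rot[of \<theta> x y] by (simp add: cc_dist_eq)

lemma cc_norm_minus: "cc_norm (z, - t) = cc_norm (z, t)"
  using cc_dist_vertical_reflection[of z t] by (simp add: cc_dist_zero)

lemma cc_norm_abs: "cc_norm (z, \<bar>t\<bar>) = cc_norm (z, t)"
  using cc_norm_minus[of z t] by (simp add: abs_if)

lemma cc_norm_le: "cc_norm (z, t) \<le> norm z + 2 * sqrt \<bar>t\<bar>"
proof -
  have "norm z + 2 * sqrt \<bar>t\<bar> \<ge> 0" by simp
  then show ?thesis using cc_dist_zero_le[of z t] by (simp only: cc_dist_zero ennreal_le_iff)
qed

lemma norm_le_cc_norm: "norm z \<le> cc_norm (z, t)"
  using norm_diff_le_cc_dist[of "(z, t)" 0] by (simp add: cc_dist_zero)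

lemma norm_diff_le_ccd: "norm (fst q - fst p) \<le> ccd p q"
  using norm_diff_le_cc_dist[of q p] by (simp add: cc_dist_eq)

lemma ccd_horizontal_line: "ccd p (heis_mult p (w, 0)) \<le> norm w"
  using cc_dist_horizontal_line[of p w] by (simp add: cc_dist_eq)

lemma ccd_self [simp]: "ccd p p = 0"
proof -
  have "cc_norm (0 :: 'a heis) \<le> 0"
    using cc_norm_le[of "0 :: complex ^ 'a" 0] by (simp add: zero_prod_def)
  then show ?thesis using cc_norm_nonneg[of "0 :: 'a heis"] by (simp add: ccd_def antisym)
qed

text \<open>Carries an inequality valid for all lengths L above the distance over to the distance
  itself.\<close>

lemma le_at_right_limit:
  fixes f g :: "real \<Rightarrow> real"
  assumes "isCont f a" "isCont g a" "\<And>x. x > a \<Longrightarrow> f x \<le> g x"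
  shows "f a \<le> g a"
proof (rule tendsto_le[of "at_right a"])
  show "(g \<longlongrightarrow> g a) (at_right a)" "(f \<longlongrightarrow> f a) (at_right a)"
    using assms(1,2) by (auto simp: isCont_def intro: filterlim_mono[OF _ order_refl at_le])
  show "\<forall>\<^sub>F x in at_right a. f x \<le> g x"
    using assms(3) by (auto simp: eventually_at_right_field intro!: exI[of _ "a + 1"])
qed simp

lemma cc_norm_curveE:
  assumes "L > cc_norm (z, t)"
  obtains a b \<gamma> where "a \<le> b" "horizontal_curve a b \<gamma>" "\<gamma> a = 0" "\<gamma> b = (z, t)"
    "riemannian_length a b \<gamma> \<le> ennreal L"
proof -
  have "cc_dist 0 (z, t) < ennreal L"
    using assms by (simp add: cc_dist_zero ennreal_less_iff)
  then show ?thesis by (rule cc_dist_lessE) (use that in \<open>auto intro: less_imp_le\<close>)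
qed

lemma cc_norm_area_bound: "t\<^sup>2 \<le> 4 * (cc_norm (z, t))\<^sup>2 * ((cc_norm (z, t))\<^sup>2 - (norm z)\<^sup>2)"
proof (rule le_at_right_limit[where f="\<lambda>_. t\<^sup>2" and g="\<lambda>L. 4 * L\<^sup>2 * (L\<^sup>2 - (norm z)\<^sup>2)"])
  fix L assume L: "L > cc_norm (z, t)"
  moreover have "L \<ge> 0" using L cc_norm_nonneg[of "(z, t)"] by linarith
  ultimately show "t\<^sup>2 \<le> 4 * L\<^sup>2 * (L\<^sup>2 - (norm z)\<^sup>2)"
    by (metis cc_norm_curveE horizontal_curve_area_bound(1))
qed (intro continuous_intros)+

text \<open>Eliminates the parameter s of the contraction: 1 - s is at least (t - t') / (8 L^2), and
  the contracted curve saves (1 - s) (L - |z|). The excess N - |z| over the chord is bounded below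
  by \<open>cc_norm_area_bound\<close>.\<close>

lemma cc_norm_shrink:
  assumes t': "0 \<le> t'" "t' \<le> t"
  shows "(t - t') * (cc_norm (z, t) - norm z) \<le> 8 * (cc_norm (z, t))\<^sup>2 * (cc_norm (z, t) - cc_norm (z, t'))"
proof (rule le_at_right_limit[where f="\<lambda>L. (t - t') * (L - norm z)" and g="\<lambda>L. 8 * L\<^sup>2 * (L - cc_norm (z, t'))"])
  fix L assume L: "L > cc_norm (z, t)"
  have "L \<ge> 0" using L cc_norm_nonneg[of "(z, t)"] by linarith
  obtain a b \<gamma> where \<gamma>: "a \<le> b" "horizontal_curve a b \<gamma>" "\<gamma> a = 0" "\<gamma> b = (z, t)"
    "riemannian_length a b \<gamma> \<le> ennreal L"
    by (rule cc_norm_curveE[OF L])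
  obtain s where s: "0 \<le> s" "s \<le> 1" "t - t' \<le> (1 - s) * (8 * L\<^sup>2)"
    "cc_dist 0 (z, t') \<le> ennreal ((1 - s) * norm z + s * L)"
    by (rule horizontal_curve_shrink[OF \<gamma> \<open>L \<ge> 0\<close> t'])
  have Lz: "L - norm z \<ge> 0" using L norm_le_cc_norm[of z t] by simp
  have "(1 - s) * norm z + s * L \<ge> 0" using s \<open>L \<ge> 0\<close> by simp
  then have "cc_norm (z, t') \<le> (1 - s) * norm z + s * L"
    using s(4) by (simp only: cc_dist_zero ennreal_le_iff)
  then have *: "(1 - s) * (L - norm z) \<le> L - cc_norm (z, t')" by (simp add: algebra_simps)
  have "(t - t') * (L - norm z) \<le> (1 - s) * (8 * L\<^sup>2) * (L - norm z)"
    by (rule mult_right_mono[OF s(3) Lz])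
  also have "\<dots> = 8 * L\<^sup>2 * ((1 - s) * (L - norm z))" by simp
  also have "\<dots> \<le> 8 * L\<^sup>2 * (L - cc_norm (z, t'))" by (intro mult_left_mono *) simp
  finally show "(t - t') * (L - norm z) \<le> 8 * L\<^sup>2 * (L - cc_norm (z, t'))" .
qed (intro continuous_intros)+

lemma norm_less_cc_norm:
  assumes "t \<noteq> 0"
  shows "norm z < cc_norm (z, t)"
proof -
  have "0 < t\<^sup>2" using assms by simp
  then have "0 < 4 * (cc_norm (z, t))\<^sup>2 * ((cc_norm (z, t))\<^sup>2 - (norm z)\<^sup>2)"
    using cc_norm_area_bound[of t z] by linarith
  then have "(norm z)\<^sup>2 < (cc_norm (z, t))\<^sup>2"
    by (simp add: zero_less_mult_iff)
  then show ?thesis by (rule power_less_imp_less_base) simp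
qed

lemma cc_norm_strict_mono:
  assumes "\<bar>t'\<bar> < \<bar>t\<bar>"
  shows "cc_norm (z, t') < cc_norm (z, t)"
proof -
  have *: "cc_norm (z, u') < cc_norm (z, u)" if "0 \<le> u'" "u' < u" for u u'
  proof -
    have "0 < (u - u') * (cc_norm (z, u) - norm z)"
      using norm_less_cc_norm[of u z] that by simp
    also have "\<dots> \<le> 8 * (cc_norm (z, u))\<^sup>2 * (cc_norm (z, u) - cc_norm (z, u'))"
      by (rule cc_norm_shrink) (use that in auto)
    finally show ?thesis by (simp add: zero_less_mult_iff)
  qed
  show ?thesis using *[of "\<bar>t'\<bar>" "\<bar>t\<bar>"] assms by (simp add: cc_norm_abs)
qed

lemma cc_norm_mono: "\<bar>t'\<bar> \<le> \<bar>t\<bar> \<Longrightarrow> cc_norm (z, t') \<le> cc_norm (z, t)"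
  using cc_norm_strict_mono[of t' t z] cc_norm_abs[of z t] cc_norm_abs[of z t']
  by (cases "\<bar>t'\<bar> = \<bar>t\<bar>") auto

section \<open>Continuity of the distance and slopes of spheres\<close>

lemma continuous_on_sympl:
  "continuous_on S f \<Longrightarrow> continuous_on S g \<Longrightarrow> continuous_on S (\<lambda>x. sympl (f x) (g x))"
  by (rule bounded_bilinear.continuous_on[OF bounded_bilinear_sympl])

lemma continuous_on_heis_mult:
  assumes "continuous_on S f" "continuous_on S g"
  shows "continuous_on S (\<lambda>x. heis_mult (f x) (g x))"
  unfolding heis_mult_sympl
  by (intro continuous_intros continuous_on_sympl assms)

lemma abs_cc_norm_diff_le: "\<bar>cc_norm y - cc_norm x\<bar> \<le> ccd x y"
  using ccd_triangle[of 0 y x] ccd_triangle[of 0 x y] ccd_commute[of x y] by (simp add: ccd_zero abs_le_iff)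

lemma continuous_on_cc_norm: "continuous_on UNIV cc_norm"
proof (rule continuous_at_imp_continuous_on, rule ballI)
  fix x :: "'a heis"
  let ?m = "\<lambda>y. heis_mult (- x) y"
  define \<beta> where "\<beta> y = norm (fst (?m y)) + 2 * sqrt \<bar>snd (?m y)\<bar>" for y
  have "continuous_on UNIV \<beta>"
    unfolding \<beta>_def by (intro continuous_intros continuous_on_heis_mult)
  then have "isCont \<beta> x"
    by (simp only: continuous_on_eq_continuous_at[OF open_UNIV] ball_UNIV)
  then have "(\<beta> \<longlongrightarrow> \<beta> x) (at x)" by (rule isContD)
  moreover have "\<beta> x = 0" by (simp add: \<beta>_def)
  ultimately have lim: "(\<beta> \<longlongrightarrow> 0) (at x)" by (simp only:)
  have "norm (cc_norm y - cc_norm x) \<le> \<beta> y" for y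
    using abs_cc_norm_diff_le[of y x] cc_norm_le[of "fst (?m y)" "snd (?m y)"]
    by (simp add: ccd_def \<beta>_def)
  then have "((\<lambda>y. cc_norm y - cc_norm x) \<longlongrightarrow> 0) (at x)"
    by (rule Lim_null_comparison[OF always_eventually[OF allI] lim])
  then show "isCont cc_norm x" unfolding isCont_def by (rule LIM_zero_cancel)
qed

lemma continuous_on_ccd:
  assumes "continuous_on S f" "continuous_on S g"
  shows "continuous_on S (\<lambda>x. ccd (f x) (g x))"
  unfolding ccd_def
  by (rule continuous_on_compose2[OF continuous_on_cc_norm])
     (auto intro!: continuous_on_heis_mult continuous_on_minus assms)

text \<open>The horizontal segment from (z, b - 2 sympl z z') to (z', b) has length |z' - z|, which is compensated
  by the gain of lowering the height from a.\<close>

lemma cc_norm_sublevel_lipschitz: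
  assumes a: "cc_norm (z, a) \<le> R" "0 < \<eta>" "\<eta> \<le> a" and "0 \<le> b"
    and b: "b + (2 * R + 64 * R ^ 5 / \<eta>\<^sup>2) * norm (z' - z) \<le> a"
  shows "cc_norm (z', b) \<le> R"
proof -
  define n \<Delta> where "n = cc_norm (z, a)" and "\<Delta> = norm (z' - z)"
  have "n > 0" using norm_less_cc_norm[of a z] a norm_ge_zero[of z] unfolding n_def by linarith
  have "n \<le> R" "R > 0" using a(1) \<open>n > 0\<close> by (auto simp: n_def)
  have nz: "0 \<le> norm z" "norm z \<le> n" using norm_le_cc_norm[of z a] by (auto simp: n_def)
  define c where "c = b - 2 * sympl z z'"
  define T where "T = \<bar>c\<bar>"
  have "heis_mult (z, c) (z' - z, 0) = (z', b)"
    by (simp add: heis_mult_sympl sympl_simps c_def)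
  then have "cc_norm (z', b) \<le> cc_norm (z, c) + \<Delta>"
    using ccd_horizontal_line[of "(z, c)" "z' - z"] ccd_triangle[of 0 "(z', b)" "(z, c)"]
    by (simp add: ccd_zero \<Delta>_def)
  then have le: "cc_norm (z', b) \<le> cc_norm (z, T) + \<Delta>"
    by (simp add: T_def cc_norm_abs)
  \<comment> \<open>Since sympl z z = 0, only the increment z' - z enters; this accounts for the 2 R
    in the slope.\<close>
  have "\<bar>sympl z z'\<bar> \<le> R * \<Delta>"
  proof -
    have "\<bar>sympl z (z' - z)\<bar> \<le> norm z * \<Delta>" unfolding \<Delta>_def by (rule abs_sympl_le)
    also have "\<dots> \<le> R * \<Delta>" using nz \<open>n \<le> R\<close> by (intro mult_right_mono) (auto simp: \<Delta>_def)
    finally show ?thesis by (simp add: sympl_simps)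
  qed
  then have "T \<le> b + 2 * R * \<Delta>" using \<open>0 \<le> b\<close> unfolding T_def c_def by linarith
  then have aT: "64 * R ^ 5 / \<eta>\<^sup>2 * \<Delta> \<le> a - T" using b by (simp add: \<Delta>_def algebra_simps)
  have "T \<le> a"
  proof -
    have "0 \<le> 64 * R ^ 5 / \<eta>\<^sup>2 * \<Delta>" using \<open>R > 0\<close> by (simp add: \<Delta>_def)
    then show ?thesis using aT by linarith
  qed
  have "\<eta>\<^sup>2 \<le> a\<^sup>2" using a by (intro power_mono) auto
  also have "\<dots> \<le> 4 * n\<^sup>2 * (n\<^sup>2 - (norm z)\<^sup>2)" unfolding n_def by (rule cc_norm_area_bound)
  also have "\<dots> = 4 * n\<^sup>2 * (n - norm z) * (n + norm z)" by (simp add: power2_eq_square algebra_simps)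
  also have "\<dots> \<le> 4 * n\<^sup>2 * (n - norm z) * (2 * n)" using nz by (intro mult_left_mono) auto
  finally have eta: "\<eta>\<^sup>2 \<le> 8 * n ^ 3 * (n - norm z)" by (simp add: power2_eq_square power3_eq_cube algebra_simps)
  have shrink: "(a - T) * (n - norm z) \<le> 8 * n\<^sup>2 * (n - cc_norm (z, T))"
    unfolding n_def by (rule cc_norm_shrink) (use \<open>T \<le> a\<close> in \<open>auto simp: T_def\<close>)
  have "cc_norm (z, T) \<le> n" unfolding n_def using \<open>T \<le> a\<close> by (intro cc_norm_mono) (simp add: T_def)
  \<comment> \<open>Origin of 64 R^5 / \<eta>^2: the area bound gives n - |z| \<ge> \<eta>^2 / (8
    n^3), \<open>cc_norm_shrink\<close> contributes 8 n^2, and finally n \<le> R.\<close>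
  have "64 * R ^ 5 * \<Delta> = 64 * R ^ 5 / \<eta>\<^sup>2 * \<Delta> * \<eta>\<^sup>2" using a(2) by simp
  also have "\<dots> \<le> (a - T) * \<eta>\<^sup>2" by (intro mult_right_mono aT) simp
  also have "\<dots> \<le> (a - T) * (8 * n ^ 3 * (n - norm z))" using \<open>T \<le> a\<close> by (intro mult_left_mono eta) simp
  also have "\<dots> = 8 * n ^ 3 * ((a - T) * (n - norm z))" by simp
  also have "\<dots> \<le> 8 * n ^ 3 * (8 * n\<^sup>2 * (n - cc_norm (z, T)))"
    using \<open>n > 0\<close> by (intro mult_left_mono shrink) simp
  also have "\<dots> = 64 * n ^ 5 * (n - cc_norm (z, T))" by (simp add: power2_eq_square numeral_eq_Suc)
  also have "\<dots> \<le> 64 * R ^ 5 * (n - cc_norm (z, T))"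
    using \<open>n > 0\<close> \<open>n \<le> R\<close> \<open>cc_norm (z, T) \<le> n\<close> by (intro mult_right_mono mult_left_mono power_mono) auto
  finally have "\<Delta> \<le> n - cc_norm (z, T)" using \<open>R > 0\<close> by simp
  then show ?thesis using le \<open>n \<le> R\<close> by simp
qed

section \<open>Isodiametric sets\<close>

text \<open>Along a fibre only t varies, so the distance to (w, s) depends on |t - c| alone, with c
  = s + 2 sympl w z. All fibre arguments below rest on this form.\<close>

lemma ccd_coordinates: "ccd (w, s) (z, t) = cc_norm (z - w, t - (s + 2 * sympl w z))"
  by (simp add: ccd_def heis_mult_sympl sympl_simps algebra_simps)

lemma ccd_eq_0D:
  assumes "ccd p q = 0"
  shows "p = q"
proof -
  obtain w s z t where pq: "p = (w, s)" "q = (z, t)" by (metis surj_pair)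
  have "z = w" using norm_diff_le_ccd[of q p] assms by (simp add: pq)
  moreover have "t - s = 0"
  proof (rule ccontr)
    assume "t - s \<noteq> 0"
    then have "cc_norm (0 :: complex ^ 'a, t - s) > 0" using norm_less_cc_norm[of "t - s" 0] by simp
    then show False using assms \<open>z = w\<close> by (simp add: pq ccd_coordinates)
  qed
  ultimately show ?thesis by (simp add: pq)
qed

section \<open>Diameter, measure and the isodiametric constant\<close>

lemma cc_diam_le_iff:
  assumes "B \<ge> 0"
  shows "cc_diam F \<le> ennreal B \<longleftrightarrow> (\<forall>p\<in>F. \<forall>q\<in>F. ccd p q \<le> B)"
  using assms by (simp add: cc_diam_def SUP_le_iff cc_dist_eq ennreal_le_iff)

lemma cc_dist_le_cc_diam: "p \<in> F \<Longrightarrow> q \<in> F \<Longrightarrow> cc_dist p q \<le> cc_diam F"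
  unfolding cc_diam_def by (meson SUP_upper SUP_upper2)

lemma cc_diam_mono: "F \<subseteq> G \<Longrightarrow> cc_diam F \<le> cc_diam G"
  unfolding cc_diam_def by (auto intro!: SUP_mono SUP_least cc_dist_le_cc_diam[unfolded cc_diam_def])

lemma cc_diam_less_top:
  assumes "compact F"
  shows "cc_diam F < top"
proof -
  have "continuous_on (F \<times> F) (\<lambda>x. ccd (fst x) (snd x))"
    by (intro continuous_on_ccd continuous_intros)
  then have "bounded ((\<lambda>x. ccd (fst x) (snd x)) ` (F \<times> F))"
    using assms by (intro compact_imp_bounded compact_continuous_image compact_Times)
  then obtain B where "\<forall>y\<in>(\<lambda>x. ccd (fst x) (snd x)) ` (F \<times> F). norm y \<le> B"
    unfolding bounded_iff by blast
  then have "ccd p q \<le> max 0 B" if "p \<in> F" "q \<in> F" for p q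
    using that by force
  then have "cc_diam F \<le> ennreal (max 0 B)" by (subst cc_diam_le_iff) auto
  then show ?thesis by (rule le_less_trans) simp
qed

lemma leb_eq_emeasure: "F \<in> sets lebesgue \<Longrightarrow> leb F = emeasure lebesgue F"
  by (simp add: leb_def)

lemma leb_mono: "F \<subseteq> G \<Longrightarrow> leb F \<le> leb G"
  by (simp add: leb_def outer_measure_of_mono)

lemma emeasure_lebesgue_open_eq_0D:
  fixes V :: "'a::euclidean_space set"
  assumes "open V" "emeasure lebesgue V = 0"
  shows "V = {}"
proof -
  have "V \<in> sets lebesgue" using assms(1) by simp
  then have "negligible V" using assms(2) by (simp add: negligible_iff_emeasure0)
  then show ?thesis using open_not_negligible assms(1) by blast
qed

lemma leb_le_isodiam_const:
  fixes F :: "'n::finite heis set"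
  assumes "F \<in> \<A>" "0 < cc_diam F" "cc_diam F < top"
  shows "leb F \<le> isodiam_const \<A> * cc_diam F ^ (2 * CARD('n) + 2)"
proof -
  let ?d = "cc_diam F ^ (2 * CARD('n) + 2)"
  have d: "?d \<noteq> 0" "?d \<noteq> top"
    using assms(2,3) power_not_zero[of "cc_diam F"] power_eq_top_ennreal[of "cc_diam F"]
    by (metis less_irrefl)+
  have "leb F / ?d \<le> isodiam_const \<A>"
    unfolding isodiam_const_def by (rule SUP_upper) (use assms in simp)
  then have "leb F / ?d * ?d \<le> isodiam_const \<A> * ?d" by (rule mult_right_mono) simp
  moreover have "leb F / ?d * ?d = leb F"
    by (simp only: ennreal_divide_times ennreal_divide_self[OF d(1) d(2)[unfolded less_top]] mult_1_right)
  ultimately show ?thesis by (simp only:)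
qed

text \<open>Both classes of sets are of the form below, for the trivial group and for the full torus.\<close>

definition rot_class :: "(real ^ 'n) set \<Rightarrow> 'n::finite heis set set" where
  "rot_class \<Theta> = {F. \<forall>\<theta>\<in>\<Theta>. rot \<theta> ` F \<subseteq> F}"

lemma rot_class_zero: "rot_class {0} = UNIV"
  by (auto simp: rot_class_def)

lemma rot_class_UNIV: "rot_class UNIV = rot_invariant"
  by (simp add: rot_class_def rot_invariant_def)

lemma norm_rot [simp]: "norm (rot \<theta> p) = norm p"
  by (simp add: norm_prod_def)

text \<open>The two closure conditions make \<Theta> a subgroup, so the distance between two points
  of an orbit is the distance from x to a single rotated copy of x.\<close>

locale isodiametric =
  fixes \<Theta> :: "(real ^ 'n) set" and E :: "'n::finite heis set"
  assumes Theta_zero: "0 \<in> \<Theta>" and Theta_diff: "\<theta> \<in> \<Theta> \<Longrightarrow> \<phi> \<in> \<Theta> \<Longrightarrow> \<theta> - \<phi> \<in> \<Theta>"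
    and E: "E \<in> isodiam_class (rot_class \<Theta>)"
begin

lemma Theta_minus: "\<theta> \<in> \<Theta> \<Longrightarrow> - \<theta> \<in> \<Theta>"
  using Theta_diff[OF Theta_zero, of \<theta>] by simp

lemma Theta_add: "\<theta> \<in> \<Theta> \<Longrightarrow> \<phi> \<in> \<Theta> \<Longrightarrow> \<theta> + \<phi> \<in> \<Theta>"
  using Theta_diff[OF _ Theta_minus, of \<theta> \<phi>] by simp

lemma compact_E: "compact E" and diam_pos: "0 < cc_diam E" and E_class: "E \<in> rot_class \<Theta>"
  and leb_E: "leb E = isodiam_const (rot_class \<Theta>) * cc_diam E ^ (2 * CARD('n) + 2)"
  using E by (simp_all add: isodiam_class_def)

lemma rot_E: "\<theta> \<in> \<Theta> \<Longrightarrow> p \<in> E \<Longrightarrow> rot \<theta> p \<in> E"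
  using E_class by (auto simp: rot_class_def)

lemma lmeasurable_E: "E \<in> lmeasurable"
  using compact_E by (rule lmeasurable_compact)

lemma leb_E_finite: "leb E < top"
  using fmeasurableD2[OF lmeasurable_E] fmeasurableD[OF lmeasurable_E]
  by (simp add: leb_eq_emeasure less_top[symmetric])

text \<open>That the supremum is attained by a compact set of positive diameter forces it to be
  finite, as compact sets have finite measure.\<close>

lemma const_finite: "isodiam_const (rot_class \<Theta>) < top"
proof (rule ccontr)
  assume "\<not> isodiam_const (rot_class \<Theta>) < top"
  then have "isodiam_const (rot_class \<Theta>) = top" by (simp add: less_top[symmetric])
  moreover have "cc_diam E ^ (2 * CARD('n) + 2) \<noteq> 0" using diam_pos by auto
  ultimately show False using leb_E leb_E_finite by (simp add: ennreal_top_mult)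
qed

text \<open>The Euclidean unit ball is an admissible competitor for every \<Theta>, because
  rotations preserve the Euclidean norm. The points 0 and \<open>(axis j (1 / 2), 0)\<close> show
  that its diameter is positive.\<close>

lemma const_pos: "0 < isodiam_const (rot_class \<Theta>)"
proof (rule ccontr)
  let ?B = "ball 0 1 :: 'n heis set"
  assume "\<not> 0 < isodiam_const (rot_class \<Theta>)"
  then have C0: "isodiam_const (rot_class \<Theta>) = 0" by simp
  have "?B \<in> rot_class \<Theta>" by (auto simp: rot_class_def)
  moreover have "cc_diam ?B < top"
    using cc_diam_mono[of ?B "cball 0 1"] cc_diam_less_top[of "cball 0 1 :: 'n heis set"]
    by (auto intro: le_less_trans)
  moreover have "0 < cc_diam ?B"
  proof -
    obtain j :: 'n where True by blast
    let ?p = "(axis j (1 / 2), 0) :: 'n heis"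
    have n: "norm (axis j (1 / 2) :: complex ^ 'n) = 1 / 2"
      by (simp add: norm_eq_sqrt_inner inner_axis_axis inner_complex_def real_sqrt_divide)
    have "0 < ennreal (1 / 2)" by (subst ennreal_less_zero_iff) simp
    also have "\<dots> \<le> cc_dist 0 ?p"
      using norm_diff_le_cc_dist[of ?p 0] by (simp only: fst_conv fst_zero diff_zero n)
    also have "\<dots> \<le> cc_diam ?B"
      by (rule cc_dist_le_cc_diam) (use n in \<open>auto simp: norm_prod_def\<close>)
    finally show ?thesis .
  qed
  ultimately have "leb ?B \<le> 0" using leb_le_isodiam_const[of ?B "rot_class \<Theta>"] C0 by simp
  then have "emeasure lebesgue ?B = 0" by (simp add: leb_eq_emeasure)
  then have "?B = {}" by (rule emeasure_lebesgue_open_eq_0D[rotated]) simp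
  then show False by simp
qed

definition R :: real where "R = enn2real (cc_diam E)"

lemma diam_eq: "cc_diam E = ennreal R"
  using cc_diam_less_top[OF compact_E] by (simp add: R_def)

lemma R_pos: "R > 0"
  using diam_pos by (simp add: diam_eq)

lemma ccd_le_R: "p \<in> E \<Longrightarrow> q \<in> E \<Longrightarrow> ccd p q \<le> R"
  using cc_diam_le_iff[of R E] R_pos by (simp add: diam_eq)

lemma leb_E_pos: "0 < leb E"
  using const_pos diam_pos power_not_zero[of "cc_diam E" "2 * CARD('n) + 2"]
  by (simp only: leb_E ennreal_zero_less_mult_iff zero_less_iff_neq_zero) simp

lemma E_nonempty: "E \<noteq> {}"
  using leb_E_pos by (auto simp: leb_def)

text \<open>The enlarged set has the same diameter, so maximality bounds its measure by that of E.
  Hence the open set V - E is null, and an open null set is empty.\<close>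

lemma enlargement_subset:
  assumes "open V" "E \<union> V \<in> rot_class \<Theta>" "\<And>p q. p \<in> E \<union> V \<Longrightarrow> q \<in> E \<union> V \<Longrightarrow> ccd p q \<le> R"
  shows "V \<subseteq> E"
proof -
  have "cc_diam (E \<union> V) \<le> cc_diam E"
    unfolding diam_eq using assms(3) R_pos by (subst cc_diam_le_iff) auto
  then have D: "cc_diam (E \<union> V) = cc_diam E" by (rule antisym[OF _ cc_diam_mono[OF Un_upper1]])
  have meas: "E \<in> sets lebesgue" "V - E \<in> sets lebesgue" "E \<union> V \<in> sets lebesgue"
    using fmeasurableD[OF lmeasurable_E] assms(1) by auto
  have "leb (E \<union> V) \<le> leb E"
    using leb_le_isodiam_const[OF assms(2)] diam_pos cc_diam_less_top[OF compact_E] by (simp add: D leb_E)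
  then have "emeasure lebesgue (E \<union> V) \<le> emeasure lebesgue E" using meas by (simp add: leb_eq_emeasure)
  moreover have "emeasure lebesgue (E \<union> V) = emeasure lebesgue E + emeasure lebesgue (V - E)"
    using plus_emeasure[OF meas(1,2)] by auto
  ultimately have "emeasure lebesgue E + emeasure lebesgue (V - E) \<le> emeasure lebesgue E + 0" by simp
  moreover have "emeasure lebesgue E \<noteq> top" using leb_E_finite meas by (simp add: leb_eq_emeasure)
  ultimately have "emeasure lebesgue (V - E) = 0" by (simp add: ennreal_add_left_cancel_le)
  moreover have "open (V - E)" using assms(1) compact_E by (intro open_Diff compact_imp_closed)
  ultimately show ?thesis using emeasure_lebesgue_open_eq_0D by blast
qed

text \<open>The vertical coordinate of the difference between x and a rotation of x is the mean of the vertical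
  coordinates obtained after replacing one of the two points by a point of E in the same fibre.\<close>

lemma ccd_orbit_le:
  assumes "(z, s0) \<in> E" "\<theta> \<in> \<Theta>" "\<And>q. q \<in> E \<Longrightarrow> ccd (z, s) q \<le> M"
  shows "ccd (z, s) (rot \<theta> (z, s)) \<le> M"
proof -
  define \<rho> where "\<rho> = fst (rot \<theta> (z, s))"
  have r: "rot \<theta> (z, t) = (\<rho>, t)" for t by (simp add: \<rho>_def rot_def)
  define \<tau> where "\<tau> = - (2 * sympl z \<rho>)"
  have "ccd (z, s) (rot \<theta> (z, s0)) \<le> M"
    by (rule assms(3)[OF rot_E[OF assms(2,1)]])
  then have 1: "cc_norm (\<rho> - z, \<tau> - (s - s0)) \<le> M"
    by (simp add: r ccd_coordinates \<tau>_def algebra_simps)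
  have "ccd (z, s0) (rot \<theta> (z, s)) = ccd (rot (- \<theta>) (z, s0)) (rot (- \<theta>) (rot \<theta> (z, s)))" by (simp add: ccd_rot)
  also have "\<dots> = ccd (z, s) (rot (- \<theta>) (z, s0))" by (simp add: rot_add ccd_commute)
  also have "\<dots> \<le> M" by (rule assms(3)[OF rot_E[OF Theta_minus[OF assms(2)] assms(1)]])
  finally have 2: "cc_norm (\<rho> - z, \<tau> + (s - s0)) \<le> M"
    by (simp add: r ccd_coordinates \<tau>_def algebra_simps)
  have "\<bar>\<tau>\<bar> \<le> \<bar>\<tau> - (s - s0)\<bar> \<or> \<bar>\<tau>\<bar> \<le> \<bar>\<tau> + (s - s0)\<bar>" by linarith
  then have "cc_norm (\<rho> - z, \<tau>) \<le> M"
    using cc_norm_mono 1 2 by (meson order_trans)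
  then show ?thesis by (simp add: r ccd_coordinates \<tau>_def)
qed

text \<open>Compactness of E turns the strict inequalities into a margin R - M. Balls of radius a
  third of it around all points of the orbit of (z, s) form an open invariant set; two such balls
  add at most two thirds of the margin to the distance of their centres. Mutual distances of the
  centres are bounded by \<open>ccd_orbit_le\<close>, which uses the point (z, s0) of E.\<close>

lemma interior_E_I:
  assumes "(z, s0) \<in> E" "\<And>q. q \<in> E \<Longrightarrow> ccd (z, s) q < R"
  shows "(z, s) \<in> interior E"
proof -
  let ?x = "(z, s)"
  have "continuous_on E (\<lambda>q. ccd ?x q)" by (intro continuous_on_ccd continuous_intros)
  then obtain q0 where q0: "q0 \<in> E" "\<And>q. q \<in> E \<Longrightarrow> ccd ?x q \<le> ccd ?x q0"
    using continuous_attains_sup[OF compact_E E_nonempty] by blast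
  define M where "M = ccd ?x q0"
  have M: "M < R" "\<And>q. q \<in> E \<Longrightarrow> ccd ?x q \<le> M" using q0 assms(2) by (auto simp: M_def)
  define \<epsilon> where "\<epsilon> = (R - M) / 3"
  have \<epsilon>3: "3 * \<epsilon> = R - M" by (simp add: \<epsilon>_def)
  then have "\<epsilon> > 0" using M by linarith
  define V where "V = (\<Union>\<theta>\<in>\<Theta>. {y. ccd (rot \<theta> ?x) y < \<epsilon>})"
  have VI: "y \<in> V \<longleftrightarrow> (\<exists>\<theta>\<in>\<Theta>. ccd (rot \<theta> ?x) y < \<epsilon>)" for y by (simp add: V_def)
  have "open {y. ccd (rot \<theta> ?x) y < \<epsilon>}" for \<theta>
    by (intro open_Collect_less continuous_on_ccd continuous_intros)
  then have "open V" by (auto simp: V_def)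
  have orbit: "ccd (rot \<theta> ?x) q \<le> M" if "\<theta> \<in> \<Theta>" "q \<in> E" for \<theta> q
  proof -
    have "ccd (rot \<theta> ?x) q = ccd (rot (- \<theta>) (rot \<theta> ?x)) (rot (- \<theta>) q)" by (simp add: ccd_rot)
    also have "\<dots> = ccd ?x (rot (- \<theta>) q)" by (simp add: rot_add)
    also have "\<dots> \<le> M" by (intro M(2) rot_E Theta_minus that)
    finally show ?thesis .
  qed
  have orbit2: "ccd (rot \<theta> ?x) (rot \<phi> ?x) \<le> M" if "\<theta> \<in> \<Theta>" "\<phi> \<in> \<Theta>" for \<theta> \<phi>
  proof -
    have "ccd (rot \<theta> ?x) (rot \<phi> ?x) = ccd (rot (- \<theta>) (rot \<theta> ?x)) (rot (- \<theta>) (rot \<phi> ?x))" by (simp add: ccd_rot)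
    also have "\<dots> = ccd ?x (rot (\<phi> - \<theta>) ?x)" by (simp add: rot_add)
    also have "\<dots> \<le> M" by (rule ccd_orbit_le[OF assms(1) Theta_diff[OF that(2,1)] M(2)])
    finally show ?thesis .
  qed
  have VE: "ccd y q \<le> R" if y: "y \<in> V" and q: "q \<in> E" for y q
  proof -
    obtain \<theta> where \<theta>: "\<theta> \<in> \<Theta>" "ccd (rot \<theta> ?x) y < \<epsilon>" using y VI by blast
    have "ccd y q \<le> ccd y (rot \<theta> ?x) + ccd (rot \<theta> ?x) q" by (rule ccd_triangle)
    then have "ccd y q \<le> \<epsilon> + M" using \<theta> orbit[OF \<theta>(1) q] ccd_commute[of y] by simp
    then show ?thesis using \<epsilon>3 \<open>\<epsilon> > 0\<close> by linarith
  qed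
  have VV: "ccd y y' \<le> R" if y: "y \<in> V" "y' \<in> V" for y y'
  proof -
    obtain \<theta> \<phi> where \<theta>: "\<theta> \<in> \<Theta>" "ccd (rot \<theta> ?x) y < \<epsilon>" and \<phi>: "\<phi> \<in> \<Theta>" "ccd (rot \<phi> ?x) y' < \<epsilon>"
      using y VI by blast
    have "ccd y y' \<le> ccd y (rot \<theta> ?x) + (ccd (rot \<theta> ?x) (rot \<phi> ?x) + ccd (rot \<phi> ?x) y')"
      using ccd_triangle[of y y' "rot \<theta> ?x"] ccd_triangle[of "rot \<theta> ?x" y' "rot \<phi> ?x"] by linarith
    also have "\<dots> \<le> \<epsilon> + (M + \<epsilon>)"
      using \<theta>(2) \<phi>(2) orbit2[OF \<theta>(1) \<phi>(1)] ccd_commute[of y] by (intro add_mono) auto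
    also have "\<dots> \<le> R" using \<epsilon>3 \<open>\<epsilon> > 0\<close> by linarith
    finally show ?thesis .
  qed
  have "rot \<phi> y \<in> V" if y: "y \<in> V" "\<phi> \<in> \<Theta>" for y \<phi>
  proof -
    obtain \<theta> where \<theta>: "\<theta> \<in> \<Theta>" "ccd (rot \<theta> ?x) y < \<epsilon>" using y VI by blast
    then have "ccd (rot (\<phi> + \<theta>) ?x) (rot \<phi> y) < \<epsilon>" by (simp add: ccd_rot flip: rot_add)
    then show ?thesis using Theta_add[OF y(2) \<theta>(1)] VI by blast
  qed
  then have "E \<union> V \<in> rot_class \<Theta>" by (auto simp: rot_class_def rot_E)
  then have "V \<subseteq> E"
  proof (rule enlargement_subset[OF \<open>open V\<close>])
    fix p q assume "p \<in> E \<union> V" "q \<in> E \<union> V"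
    then show "ccd p q \<le> R" using ccd_le_R[of p q] VE[of p q] VE[of q p] VV[of p q] ccd_commute[of p q] by auto
  qed
  moreover have "?x \<in> V" using VI Theta_zero \<open>\<epsilon> > 0\<close> by (metis ccd_self rot_zero)
  ultimately show ?thesis using \<open>open V\<close> by (meson interior_maximal subsetD)
qed

text \<open>Whatever q is, one of the endpoint heights t1, t2 is strictly farther than t from the
  reference height c of q. Strict monotonicity then puts (z, t) at distance less than R from
  q.\<close>

lemma between_in_interior:
  assumes "(z, t1) \<in> E" "(z, t2) \<in> E" "t1 < t" "t < t2"
  shows "(z, t) \<in> interior E"
proof (rule interior_E_I[OF assms(1)])
  fix q assume q: "q \<in> E"
  obtain w s where ws: "q = (w, s)" by (metis surj_pair)
  define c where "c = s + 2 * sympl w z"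
  have N: "cc_norm (z - w, t' - c) \<le> R" if "(z, t') \<in> E" for t'
    using ccd_le_R[OF q that] by (simp add: ws ccd_coordinates c_def)
  have "\<bar>t - c\<bar> < \<bar>t1 - c\<bar> \<or> \<bar>t - c\<bar> < \<bar>t2 - c\<bar>" using assms(3,4) by linarith
  then have "cc_norm (z - w, t - c) < R"
    using cc_norm_strict_mono N assms(1,2) by (meson less_le_trans)
  then have "ccd q (z, t) < R" by (simp add: ws ccd_coordinates c_def)
  then show "ccd (z, t) q < R" by (simp only: ccd_commute[of q])
qed

lemma t_convex_E: "t_convex E"
  unfolding t_convex_def
proof clarify
  fix z t1 t2 t assume *: "(z, t1) \<in> E" "(z, t2) \<in> E" "t1 \<le> t" "t \<le> t2"
  show "(z, t) \<in> E"
  proof (cases "t = t1 \<or> t = t2")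
    case False
    then show ?thesis using between_in_interior[of z t1 t2 t] * interior_subset by fastforce
  next
    case True
    then show ?thesis using * by blast
  qed
qed

section \<open>Fibres of E, its interior and the set U\<close>

lemma fibre_extrema:
  assumes "z \<in> fst ` E"
  shows "(z, f_plus E z) \<in> E" "(z, f_minus E z) \<in> E"
    and "\<And>t. (z, t) \<in> E \<Longrightarrow> f_minus E z \<le> t \<and> t \<le> f_plus E z"
proof -
  let ?T = "snd ` (E \<inter> ({z} \<times> UNIV))"
  have T: "t \<in> ?T \<longleftrightarrow> (z, t) \<in> E" for t by force
  have "compact ?T"
    by (intro compact_continuous_image continuous_intros compact_Int_closed compact_E closed_Times closed_UNIV closed_singleton)
  moreover have "?T \<noteq> {}" using assms by force
  ultimately obtain s i where "s \<in> ?T" "\<forall>t\<in>?T. t \<le> s" "i \<in> ?T" "\<forall>t\<in>?T. i \<le> t"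
    using compact_attains_sup[of ?T] compact_attains_inf[of ?T] by blast
  then have s: "(z, s) \<in> E" "\<And>t. (z, t) \<in> E \<Longrightarrow> t \<le> s" and i: "(z, i) \<in> E" "\<And>t. (z, t) \<in> E \<Longrightarrow> i \<le> t"
    unfolding T[symmetric] by blast+
  have "f_plus E z = s" unfolding f_plus_def using s by (intro Greatest_equality) auto
  moreover have "f_minus E z = i" unfolding f_minus_def using i by (intro Least_equality) auto
  ultimately show "(z, f_plus E z) \<in> E" "(z, f_minus E z) \<in> E"
    "\<And>t. (z, t) \<in> E \<Longrightarrow> f_minus E z \<le> t \<and> t \<le> f_plus E z"
    using s i by auto
qed

lemma E_iff: "(z, t) \<in> E \<longleftrightarrow> z \<in> fst ` E \<and> f_minus E z \<le> t \<and> t \<le> f_plus E z"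
proof
  assume "(z, t) \<in> E"
  moreover from this have "z \<in> fst ` E" by force
  ultimately show "z \<in> fst ` E \<and> f_minus E z \<le> t \<and> t \<le> f_plus E z" using fibre_extrema by blast
next
  assume "z \<in> fst ` E \<and> f_minus E z \<le> t \<and> t \<le> f_plus E z"
  then show "(z, t) \<in> E" using t_convex_E fibre_extrema(1,2) unfolding t_convex_def by blast
qed

lemma interior_fibre_margin:
  assumes "(z, t) \<in> interior E"
  obtains e where "e > 0" "\<And>z' t'. norm (z' - z) \<le> e \<Longrightarrow> \<bar>t' - t\<bar> \<le> e \<Longrightarrow> (z', t') \<in> E"
proof -
  obtain d where d: "d > 0" "ball (z, t) d \<subseteq> E" using assms by (auto simp: mem_interior)
  show ?thesis
  proof (rule that[of "d / 3"])
    fix z' t' assume "norm (z' - z) \<le> d / 3" "\<bar>t' - t\<bar> \<le> d / 3"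
    then have "dist z z' \<le> d / 3" "dist t t' \<le> d / 3"
      by (simp_all add: dist_norm norm_minus_commute abs_minus_commute)
    moreover have "dist (z, t) (z', t') \<le> dist z z' + dist t t'"
      by (simp add: dist_Pair_Pair sqrt_sum_squares_le_sum)
    ultimately have "dist (z, t) (z', t') \<le> d / 3 + d / 3" by linarith
    then have "(z', t') \<in> ball (z, t) d" using d(1) by simp
    then show "(z', t') \<in> E" using d by blast
  qed (use d in simp)
qed

text \<open>An interior point has room above and below it in its fibre. Conversely, a point strictly
  inside its fibre segment is interior by \<open>between_in_interior\<close>, without any
  information on neighbouring fibres.\<close>

lemma interior_E_eq: "interior E = {(z, t). z \<in> U_set E \<and> f_minus E z < t \<and> t < f_plus E z}"
proof (intro equalityI subrelI)
  fix z t assume "(z, t) \<in> interior E"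
  then obtain e where e: "e > 0" "\<And>z' t'. norm (z' - z) \<le> e \<Longrightarrow> \<bar>t' - t\<bar> \<le> e \<Longrightarrow> (z', t') \<in> E"
    by (rule interior_fibre_margin) blast
  then have "(z, t + e) \<in> E" "(z, t - e) \<in> E" by simp_all
  then have "z \<in> fst ` E" "f_minus E z \<le> t - e" "t + e \<le> f_plus E z" by (simp_all add: E_iff)
  then show "(z, t) \<in> {(z, t). z \<in> U_set E \<and> f_minus E z < t \<and> t < f_plus E z}"
    using e(1) by (auto simp: U_set_def)
next
  fix z t assume "(z, t) \<in> {(z, t). z \<in> U_set E \<and> f_minus E z < t \<and> t < f_plus E z}"
  then show "(z, t) \<in> interior E"
    using between_in_interior[OF fibre_extrema(2,1), of z t] by (auto simp: U_set_def)
qed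

text \<open>Yields openness of U, because the projection is an open map.\<close>

lemma U_set_eq: "U_set E = fst ` interior E"
proof (intro equalityI subsetI)
  fix z assume z: "z \<in> U_set E"
  then have "(z, (f_minus E z + f_plus E z) / 2) \<in> interior E"
    unfolding interior_E_eq by (auto simp: U_set_def)
  then show "z \<in> fst ` interior E" by force
qed (auto simp: interior_E_eq)

lemma open_U_set: "open (U_set E)"
  unfolding U_set_eq by (intro open_image_fst open_interior)

lemma U_set_subset: "U_set E \<subseteq> fst ` E"
  by (auto simp: U_set_def)

lemma compact_fst_E: "compact (fst ` E)"
  by (intro compact_continuous_image continuous_intros compact_E)

lemma closure_U_set_subset: "closure (U_set E) \<subseteq> fst ` E"
  by (intro closure_minimal U_set_subset compact_imp_closed compact_fst_E)

end

text \<open>The part of E with heights in S has a compact projection that misses z, hence misses a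
  ball around z. Taking for S the heights at distance at least e from a one-point fibre gives
  continuity at the points of \<pi>(E) outside U.\<close>

lemma compact_fibre_avoids:
  fixes E :: "('a::metric_space \<times> 'b::metric_space) set"
  assumes "compact E" "closed S" "\<And>t. t \<in> S \<Longrightarrow> (z, t) \<notin> E"
  obtains d where "d > 0" "\<And>z' t. dist z' z < d \<Longrightarrow> t \<in> S \<Longrightarrow> (z', t) \<notin> E"
proof -
  let ?K = "fst ` (E \<inter> (UNIV \<times> S))"
  have "compact ?K"
    by (intro compact_continuous_image continuous_intros compact_Int_closed assms closed_Times closed_UNIV)
  then have "open (- ?K)" by (intro open_Compl compact_imp_closed)
  moreover have "z \<in> - ?K" using assms(3) by auto
  ultimately obtain d where d: "d > 0" "ball z d \<subseteq> - ?K" by (meson open_contains_ball)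
  show ?thesis
  proof (rule that[OF d(1)])
    fix z' t assume *: "dist z' z < d" "t \<in> S"
    then have "z' \<in> ball z d" by (simp add: dist_commute)
    then have "z' \<notin> ?K" using d(2) by blast
    then show "(z', t) \<notin> E" using *(2) by force
  qed
qed

text \<open>Fubini. It is applied to the part of E outside the fibres over U, and to rule out that
  \<open>E_hat E\<close> has diameter 0.\<close>

lemma closed_thin_fibres_null:
  fixes S :: "('a::euclidean_space \<times> real) set"
  assumes "closed S" "\<And>z t t'. (z, t) \<in> S \<Longrightarrow> (z, t') \<in> S \<Longrightarrow> t = t'"
  shows "emeasure lebesgue S = 0"
proof -
  have S: "S \<in> sets borel" using assms(1) by simp
  then have S': "S \<in> sets (lborel \<Otimes>\<^sub>M lborel)" by (simp only: lborel_prod sets_lborel)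
  have fibre: "emeasure lborel (Pair z -` S) = 0" for z
  proof (cases "Pair z -` S = {}")
    case False
    then obtain t where "Pair z -` S = {t}" using assms(2) by blast
    then show ?thesis by simp
  qed simp
  have "emeasure lebesgue S = emeasure (lborel \<Otimes>\<^sub>M lborel) S" using S unfolding lborel_prod by simp
  also have "\<dots> = (\<integral>\<^sup>+ z. emeasure lborel (Pair z -` S) \<partial>lborel)"
    by (rule lborel.emeasure_pair_measure_alt[OF S'])
  also have "\<dots> = 0" by (simp add: fibre)
  finally show ?thesis .
qed

lemma linear_fst_rot: "linear (\<lambda>z. fst (rot \<theta> (z, 0)))"
  by (rule linearI) (simp_all add: rot_def vec_eq_iff algebra_simps scaleR_conv_of_real)

section \<open>Regularity of the functions bounding E\<close>

context isodiametric
begin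

text \<open>If (z', s) is not in the interior of E, some q in E lies at distance at least R from it. The two points
  of E over z are within distance R of q, so the bound on the slope of the sphere of radius R applies.\<close>

lemma fibre_extension_bound:
  assumes p: "(z, p) \<in> E" "(z, p') \<in> E" "0 < \<eta>" "2 * \<eta> \<le> \<bar>p - p'\<bar>"
    and s: "(z', e) \<in> E" "(z', s) \<notin> interior E"
    and B: "\<And>q. q \<in> E \<Longrightarrow> norm (fst q) \<le> B"
  defines "\<Lambda> \<equiv> 2 * R + 64 * R ^ 5 / \<eta>\<^sup>2 + 2 * B"
  shows "e < s \<Longrightarrow> p - \<Lambda> * norm (z' - z) \<le> s" "s < e \<Longrightarrow> s \<le> p + \<Lambda> * norm (z' - z)"
proof -
  obtain q where q: "q \<in> E" "R \<le> ccd (z', s) q"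
    using interior_E_I[OF s(1), of s] s(2) by (meson not_le)
  obtain w \<tau> where w: "q = (w, \<tau>)" by (metis surj_pair)
  define K \<Delta> where "K = 2 * R + 64 * R ^ 5 / \<eta>\<^sup>2" and "\<Delta> = norm (z' - z)"
  define c c' where "c = \<tau> + 2 * sympl w z" and "c' = \<tau> + 2 * sympl w z'"
  have N: "cc_norm (z - w, t - c) \<le> R" if "(z, t) \<in> E" for t
    using ccd_le_R[OF q(1) that] by (simp add: w ccd_coordinates c_def)
  have Ns: "R \<le> cc_norm (z' - w, s - c')"
    using q(2) ccd_commute[of "(z', s)" q] by (simp add: w ccd_coordinates c'_def)
  have "cc_norm (z' - w, e - c') \<le> R"
    using ccd_le_R[OF q(1) s(1)] by (simp add: w ccd_coordinates c'_def)
  \<comment> \<open>This determines the side: e < s forces s \<ge> c', and s < e forces s \<le> c'.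
    So the absolute value in \<open>sa\<close> can be resolved at the end.\<close>
  then have e: "\<bar>e - c'\<bar> \<le> \<bar>s - c'\<bar>"
    using cc_norm_strict_mono[of "s - c'" "e - c'" "z' - w"] Ns by linarith
  \<comment> \<open>The point q is not under control, and p alone could be at a height close to c,
    where the sphere estimate degenerates. Of p and p' at least one is \<eta> or more away from
    c.\<close>
  define a where "a = max \<bar>p - c\<bar> \<bar>p' - c\<bar>"
  have "\<eta> \<le> a" unfolding a_def using p(4) by linarith
  have "cc_norm (z - w, a) \<le> R"
    using N[OF p(1)] N[OF p(2)] cc_norm_abs[of "z - w" "p - c"] cc_norm_abs[of "z - w" "p' - c"]
    by (auto simp: a_def max_def)
  have sa: "a - K * \<Delta> \<le> \<bar>s - c'\<bar>"
  proof (rule ccontr)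
    assume "\<not> a - K * \<Delta> \<le> \<bar>s - c'\<bar>"
    then have less: "\<bar>s - c'\<bar> < a - K * \<Delta>" by simp
    then have "0 \<le> a - K * \<Delta>" by linarith
    then have "cc_norm (z' - w, a - K * \<Delta>) \<le> R"
      by (intro cc_norm_sublevel_lipschitz[OF \<open>cc_norm (z - w, a) \<le> R\<close> p(3) \<open>\<eta> \<le> a\<close>])
         (simp_all add: K_def \<Delta>_def)
    moreover have "cc_norm (z' - w, s - c') < cc_norm (z' - w, a - K * \<Delta>)"
      by (rule cc_norm_strict_mono) (use less in simp)
    ultimately show False using Ns by simp
  qed
  \<comment> \<open>The reference height of q differs between the fibres over z and z'; this is the
    2 B in \<Lambda>.\<close>
  have "\<bar>c - c'\<bar> \<le> 2 * B * \<Delta>"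
  proof -
    have "\<bar>sympl w (z' - z)\<bar> \<le> norm w * norm (z' - z)" by (rule abs_sympl_le)
    also have "\<dots> \<le> B * \<Delta>" unfolding \<Delta>_def using B[OF q(1)] by (intro mult_right_mono) (simp_all add: w)
    finally show ?thesis by (simp add: c_def c'_def sympl_simps)
  qed
  moreover have "\<Lambda> * \<Delta> = K * \<Delta> + 2 * B * \<Delta>" by (simp add: \<Lambda>_def K_def algebra_simps)
  moreover have "\<bar>p - c\<bar> \<le> a" by (simp add: a_def)
  ultimately show "e < s \<Longrightarrow> p - \<Lambda> * norm (z' - z) \<le> s" "s < e \<Longrightarrow> s \<le> p + \<Lambda> * norm (z' - z)"
    using sa e unfolding \<Delta>_def[symmetric] by linarith+
qed

text \<open>A cylinder inside E around an interior point over z0 gives the same gap \<eta> for all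
  nearby fibres, hence one constant for the whole ball. Heights s just outside the fibre over z' are
  not interior, so \<open>fibre_extension_bound\<close> applies to them, and s tends to the end of
  the fibre.\<close>

lemma fibre_extrema_lipschitz:
  assumes "z0 \<in> U_set E"
  obtains d \<Lambda> where "d > 0" "\<Lambda> \<ge> 0" "ball z0 d \<subseteq> U_set E"
    "\<Lambda>-lipschitz_on (ball z0 d) (f_plus E)" "\<Lambda>-lipschitz_on (ball z0 d) (f_minus E)"
proof -
  obtain t where "(z0, t) \<in> interior E" using assms unfolding U_set_eq by auto
  then obtain \<eta> where \<eta>: "\<eta> > 0" "\<And>z' t'. norm (z' - z0) \<le> \<eta> \<Longrightarrow> \<bar>t' - t\<bar> \<le> \<eta> \<Longrightarrow> (z', t') \<in> E"
    by (rule interior_fibre_margin) blast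
  have gap: "z \<in> fst ` E" "f_minus E z \<le> t - \<eta>" "t + \<eta> \<le> f_plus E z" if "z \<in> ball z0 \<eta>" for z
  proof -
    have "norm (z - z0) \<le> \<eta>" using that by (simp add: dist_norm norm_minus_commute)
    then have "(z, t + \<eta>) \<in> E" "(z, t - \<eta>) \<in> E" using \<eta> by simp_all
    then show "z \<in> fst ` E" "f_minus E z \<le> t - \<eta>" "t + \<eta> \<le> f_plus E z" by (simp_all add: E_iff)
  qed
  have "bounded E" using compact_E by (rule compact_imp_bounded)
  then obtain B where "\<forall>q\<in>E. norm q \<le> B" unfolding bounded_iff by blast
  then have B: "norm (fst q) \<le> B" if "q \<in> E" for q
    using that norm_fst_le[of "fst q" "snd q"] by fastforce
  have "B \<ge> 0" using B E_nonempty norm_ge_zero by (metis all_not_in_conv order_trans)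
  define \<Lambda> where "\<Lambda> = 2 * R + 64 * R ^ 5 / \<eta>\<^sup>2 + 2 * B"
  have "\<Lambda> \<ge> 0" using R_pos \<open>B \<ge> 0\<close> by (simp add: \<Lambda>_def)
  have plus: "f_plus E z - \<Lambda> * norm (z' - z) \<le> f_plus E z'"
    and minus: "f_minus E z' \<le> f_minus E z + \<Lambda> * norm (z' - z)"
    if "z \<in> ball z0 \<eta>" "z' \<in> ball z0 \<eta>" for z z'
  proof -
    note z = fibre_extrema[OF gap(1)[OF that(1)]] and z' = fibre_extrema[OF gap(1)[OF that(2)]]
    have g: "2 * \<eta> \<le> \<bar>f_plus E z - f_minus E z\<bar>" "2 * \<eta> \<le> \<bar>f_minus E z - f_plus E z\<bar>"
      using gap(2,3)[OF that(1)] by linarith+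
    have lt: "f_minus E z' < f_plus E z'" using gap(2,3)[OF that(2)] \<eta>(1) by linarith
    show "f_plus E z - \<Lambda> * norm (z' - z) \<le> f_plus E z'"
    proof (rule dense_ge)
      fix s assume s: "f_plus E z' < s"
      then have "(z', s) \<notin> interior E" by (auto simp: interior_E_eq)
      then show "f_plus E z - \<Lambda> * norm (z' - z) \<le> s"
        unfolding \<Lambda>_def using fibre_extension_bound(1)[OF z(1,2) \<eta>(1) g(1) z'(1) _ B s] by blast
    qed
    show "f_minus E z' \<le> f_minus E z + \<Lambda> * norm (z' - z)"
    proof (rule dense_le)
      fix s assume s: "s < f_minus E z'"
      then have "(z', s) \<notin> interior E" by (auto simp: interior_E_eq)
      then show "s \<le> f_minus E z + \<Lambda> * norm (z' - z)"
        unfolding \<Lambda>_def using fibre_extension_bound(2)[OF z(2,1) \<eta>(1) g(2) z'(2) _ B s] by blast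
    qed
  qed
  show ?thesis
  proof (rule that[OF \<eta>(1) \<open>\<Lambda> \<ge> 0\<close>])
    show "ball z0 \<eta> \<subseteq> U_set E" using gap \<eta>(1) by (fastforce simp: U_set_def)
    show "\<Lambda>-lipschitz_on (ball z0 \<eta>) (f_plus E)"
    proof (rule lipschitz_onI[OF _ \<open>\<Lambda> \<ge> 0\<close>])
      fix x y assume "x \<in> ball z0 \<eta>" "y \<in> ball z0 \<eta>"
      then show "dist (f_plus E x) (f_plus E y) \<le> \<Lambda> * dist x y"
        using plus[of x y] plus[of y x] by (simp add: dist_norm norm_minus_commute abs_le_iff)
    qed
    show "\<Lambda>-lipschitz_on (ball z0 \<eta>) (f_minus E)"
    proof (rule lipschitz_onI[OF _ \<open>\<Lambda> \<ge> 0\<close>])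
      fix x y assume "x \<in> ball z0 \<eta>" "y \<in> ball z0 \<eta>"
      then show "dist (f_minus E x) (f_minus E y) \<le> \<Lambda> * dist x y"
        using minus[of x y] minus[of y x] by (simp add: dist_norm norm_minus_commute abs_le_iff)
    qed
  qed
qed

lemma locally_lipschitz_fibre_extrema:
  "locally_lipschitz_on (U_set E) (f_plus E)" "locally_lipschitz_on (U_set E) (f_minus E)"
  unfolding locally_lipschitz_on_def
  by (meson fibre_extrema_lipschitz inf_le1 lipschitz_on_subset)+

text \<open>Away from U the two functions agree, and f_plus is upper and f_minus lower semicontinuous.\<close>

lemma continuous_on_fibre_extrema:
  "continuous_on (fst ` E) (f_plus E)" "continuous_on (fst ` E) (f_minus E)"
proof -
  have "continuous (at z within fst ` E) (f_plus E) \<and> continuous (at z within fst ` E) (f_minus E)"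
    if z: "z \<in> fst ` E" for z
  proof (cases "z \<in> U_set E")
    case True
    then obtain d \<Lambda> where d: "d > 0" "\<Lambda>-lipschitz_on (ball z d) (f_plus E)" "\<Lambda>-lipschitz_on (ball z d) (f_minus E)"
      by (rule fibre_extrema_lipschitz) blast
    then have "isCont (f_plus E) z" "isCont (f_minus E) z"
      using continuous_on_interior[OF lipschitz_on_continuous_on, of _ "ball z d" _ z] by auto
    then show ?thesis by (auto intro: continuous_at_imp_continuous_at_within)
  next
    case False
    define m where "m = f_plus E z"
    have m: "f_plus E z = m" "f_minus E z = m"
      using False z fibre_extrema(3)[OF z fibre_extrema(1)[OF z]] by (auto simp: U_set_def m_def)
    have near: "\<exists>d>0. \<forall>z'\<in>fst ` E. dist z' z < d \<longrightarrow> \<bar>f_plus E z' - m\<bar> < e \<and> \<bar>f_minus E z' - m\<bar> < e"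
      if "e > 0" for e
    proof -
      have cl: "closed {t. e \<le> \<bar>t - m\<bar>}" by (intro closed_Collect_le continuous_intros)
      obtain d where d: "d > 0" "\<And>z' t. dist z' z < d \<Longrightarrow> t \<in> {t. e \<le> \<bar>t - m\<bar>} \<Longrightarrow> (z', t) \<notin> E"
        by (rule compact_fibre_avoids[OF compact_E cl, of z]) (use m \<open>e > 0\<close> in \<open>auto simp: E_iff\<close>)
      have "\<bar>f_plus E z' - m\<bar> < e \<and> \<bar>f_minus E z' - m\<bar> < e" if "z' \<in> fst ` E" "dist z' z < d" for z'
        using d(2)[OF that(2), of "f_plus E z'"] d(2)[OF that(2), of "f_minus E z'"] fibre_extrema(1,2)[OF that(1)]
        by force
      then show ?thesis using d(1) by blast
    qed
    show ?thesis
      unfolding continuous_within_eps_delta m dist_real_def using near by meson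
  qed
  then show "continuous_on (fst ` E) (f_plus E)" "continuous_on (fst ` E) (f_minus E)"
    by (simp_all add: continuous_on_eq_continuous_within)
qed

section \<open>The regularized set \<open>E_hat E\<close>\<close>

lemma E_hat_eq: "E_hat E = E \<inter> (closure (U_set E) \<times> UNIV)"
  using closure_U_set_subset by (auto simp: E_hat_def E_iff)

lemma compact_E_hat: "compact (E_hat E)"
  unfolding E_hat_eq by (intro compact_Int_closed compact_E closed_Times closed_closure closed_UNIV)

text \<open>Everything removed from E lies over the complement of U, where the fibres of E are
  single points.\<close>

lemma leb_E_hat: "leb (E_hat E) = leb E"
proof -
  define S where "S = E \<inter> ((- U_set E) \<times> UNIV)"
  have "closed S" unfolding S_def
    by (intro closed_Int compact_imp_closed compact_E closed_Times closed_UNIV closed_Compl open_U_set)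
  moreover have "t = t'" if "(z, t) \<in> S" "(z, t') \<in> S" for z t t'
    using that by (auto simp: S_def U_set_def E_iff)
  ultimately have S0: "emeasure lebesgue S = 0" by (rule closed_thin_fibres_null)
  have meas: "E_hat E \<in> sets lebesgue" "S \<in> sets lebesgue" "E \<in> sets lebesgue"
    using lmeasurable_compact[OF compact_E_hat] lmeasurable_E \<open>closed S\<close> by auto
  have "E \<subseteq> E_hat E \<union> S"
    unfolding E_hat_eq S_def using closure_subset[of "U_set E"] by auto
  then have "emeasure lebesgue E \<le> emeasure lebesgue (E_hat E \<union> S)"
    using meas by (intro emeasure_mono) auto
  also have "\<dots> \<le> emeasure lebesgue (E_hat E) + emeasure lebesgue S"
    using meas by (intro emeasure_subadditive) auto
  finally have "leb E \<le> leb (E_hat E)" using S0 meas by (simp add: leb_eq_emeasure)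
  moreover have "leb (E_hat E) \<le> leb E" by (rule leb_mono) (auto simp: E_hat_eq)
  ultimately show ?thesis by simp
qed

text \<open>Rotations keep heights, so they carry a fibre with a gap to a fibre with a gap and map U
  into itself. Continuity extends this to the closure of U.\<close>

lemma rot_E_hat: "E_hat E \<in> rot_class \<Theta>"
proof -
  have "rot \<theta> (z, t) \<in> E_hat E" if \<theta>: "\<theta> \<in> \<Theta>" and zt: "(z, t) \<in> E_hat E" for \<theta> z t
  proof -
    define \<rho> where "\<rho> z = fst (rot \<theta> (z, 0))" for z
    have r: "rot \<theta> (z, t) = (\<rho> z, t)" for z t by (simp add: \<rho>_def rot_def)
    have E: "(\<rho> z, t) \<in> E" if "(z, t) \<in> E" for z t using rot_E[OF \<theta> that] by (simp add: r)
    have "\<rho> z \<in> U_set E" if "z \<in> U_set E" for z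
    proof -
      have "(\<rho> z, f_plus E z) \<in> E" "(\<rho> z, f_minus E z) \<in> E" "f_minus E z < f_plus E z"
        using that E fibre_extrema(1,2)[of z] by (auto simp: U_set_def)
      then show ?thesis by (auto simp: U_set_def E_iff)
    qed
    then have "\<rho> ` U_set E \<subseteq> closure (U_set E)" using closure_subset by blast
    moreover have "continuous_on (closure (U_set E)) \<rho>"
      unfolding \<rho>_def by (intro linear_continuous_on linear_conv_bounded_linear[THEN iffD1] linear_fst_rot)
    ultimately have "\<rho> ` closure (U_set E) \<subseteq> closure (U_set E)"
      by (intro image_closure_subset) auto
    then show ?thesis using zt E by (auto simp: E_hat_eq r)
  qed
  then show ?thesis by (auto simp: rot_class_def)
qed

text \<open>\<open>E_hat E\<close> is a competitor with the measure of E, so a smaller diameter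
  would beat the isodiametric constant. Cancelling the constant to get R \<le> r uses that it is
  finite and positive. Diameter 0 is excluded first, since it would leave at most one point and
  hence measure 0.\<close>

lemma cc_diam_E_hat: "cc_diam (E_hat E) = cc_diam E"
proof (rule antisym)
  show le: "cc_diam (E_hat E) \<le> cc_diam E" by (rule cc_diam_mono) (auto simp: E_hat_eq)
  obtain r where r: "cc_diam (E_hat E) = ennreal r" "r \<ge> 0"
    using cc_diam_less_top[OF compact_E_hat] by (metis ennreal_cases less_irrefl)
  obtain C where C: "isodiam_const (rot_class \<Theta>) = ennreal C" "C \<ge> 0"
    using const_finite by (metis ennreal_cases less_irrefl)
  have "C > 0" using const_pos C by simp
  have "r > 0"
  proof (rule ccontr)
    assume "\<not> r > 0"
    then have "r = 0" using r by simp
    then have "\<forall>p\<in>E_hat E. \<forall>q\<in>E_hat E. ccd p q \<le> 0"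
      using cc_diam_le_iff[of 0 "E_hat E"] r by simp
    then have eq: "p = q" if "p \<in> E_hat E" "q \<in> E_hat E" for p q
      using that ccd_eq_0D[of p q] ccd_nonneg[of p q] by (metis antisym)
    have "emeasure lebesgue (E_hat E) = 0"
      by (rule closed_thin_fibres_null[OF compact_imp_closed[OF compact_E_hat]]) (use eq in blast)
    then have "leb (E_hat E) = 0"
      using lmeasurable_compact[OF compact_E_hat] by (simp add: leb_eq_emeasure fmeasurableD)
    then show False using leb_E_pos leb_E_hat by simp
  qed
  have "leb (E_hat E) \<le> isodiam_const (rot_class \<Theta>) * cc_diam (E_hat E) ^ (2 * CARD('n) + 2)"
    by (rule leb_le_isodiam_const[OF rot_E_hat]) (use \<open>r > 0\<close> r in auto)
  then have "ennreal C * ennreal R ^ (2 * CARD('n) + 2) \<le> ennreal C * ennreal r ^ (2 * CARD('n) + 2)"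
    by (simp only: leb_E_hat leb_E C r diam_eq)
  then have "ennreal (C * R ^ (2 * CARD('n) + 2)) \<le> ennreal (C * r ^ (2 * CARD('n) + 2))"
    using R_pos r(2) C(2) by (simp only: ennreal_power less_imp_le ennreal_mult zero_le_power)
  moreover have "0 \<le> C * r ^ (2 * CARD('n) + 2)" using C(2) r(2) by simp
  ultimately have "C * R ^ (2 * CARD('n) + 2) \<le> C * r ^ (2 * CARD('n) + 2)"
    by (simp only: ennreal_le_iff)
  then have "R ^ Suc (2 * CARD('n) + 1) \<le> r ^ Suc (2 * CARD('n) + 1)" using \<open>C > 0\<close> by simp
  then have "R \<le> r" by (rule power_le_imp_le_base) (rule r(2))
  then show "cc_diam E \<le> cc_diam (E_hat E)" using r by (simp add: diam_eq ennreal_leI)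
qed

lemma E_hat_isodiametric: "E_hat E \<in> isodiam_class (rot_class \<Theta>)"
  using rot_E_hat compact_E_hat diam_pos leb_E
  by (simp add: isodiam_class_def cc_diam_E_hat leb_E_hat)

lemma interior_E_hat: "interior (E_hat E) = interior E"
proof (rule antisym)
  show "interior (E_hat E) \<subseteq> interior E" by (rule interior_mono) (auto simp: E_hat_eq)
  have "interior E \<subseteq> E_hat E"
    unfolding E_hat_eq using interior_subset[of E] closure_subset[of "U_set E"] by (force simp: U_set_eq)
  then show "interior E \<subseteq> interior (E_hat E)" by (simp add: interior_maximal)
qed

lemma frontier_E_hat:
  "frontier (E_hat E) =
     {(z, f_plus E z) | z. z \<in> closure (U_set E)} \<union> {(z, f_minus E z) | z. z \<in> closure (U_set E)}"
proof -
  have "frontier (E_hat E) = E_hat E - interior E"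
    using compact_imp_closed[OF compact_E_hat] by (simp add: frontier_def interior_E_hat)
  also have "\<dots> = {(z, f_plus E z) | z. z \<in> closure (U_set E)} \<union> {(z, f_minus E z) | z. z \<in> closure (U_set E)}"
  proof (intro equalityI subrelI)
    fix z t assume "(z, t) \<in> E_hat E - interior E"
    then have zt: "z \<in> closure (U_set E)" "z \<in> fst ` E" "f_minus E z \<le> t" "t \<le> f_plus E z"
      "\<not> (z \<in> U_set E \<and> f_minus E z < t \<and> t < f_plus E z)"
      by (auto simp: E_hat_eq E_iff interior_E_eq)
    then have "t = f_plus E z \<or> t = f_minus E z" by (auto simp: U_set_def)
    then show "(z, t) \<in> {(z, f_plus E z) | z. z \<in> closure (U_set E)} \<union> {(z, f_minus E z) | z. z \<in> closure (U_set E)}"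
      using zt(1) by auto
  next
    fix z t
    assume "(z, t) \<in> {(z, f_plus E z) | z. z \<in> closure (U_set E)} \<union> {(z, f_minus E z) | z. z \<in> closure (U_set E)}"
    then have zt: "z \<in> closure (U_set E)" "t = f_plus E z \<or> t = f_minus E z" by auto
    then have "(z, t) \<in> E" using closure_U_set_subset fibre_extrema(1,2)[of z] by auto
    then show "(z, t) \<in> E_hat E - interior E" using zt by (auto simp: E_hat_eq interior_E_eq)
  qed
  finally show ?thesis .
qed

text \<open>Two limits are taken. Over a point of U the open fibre segment is closed up vertically;
  then, for a fixed proportion u of the fibre, continuity of the bounding functions carries the
  inclusion from U to its closure. Fixing u instead of the height keeps the approximating points
  inside E.\<close>

lemma E_hat_eq_closure: "E_hat E = closure (interior E)"
proof (rule antisym)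
  show "closure (interior E) \<subseteq> E_hat E"
    using interior_subset[of "E_hat E"] compact_imp_closed[OF compact_E_hat]
    by (intro closure_minimal) (simp_all add: interior_E_hat)
  have U: "(z, (1 - u) * f_minus E z + u * f_plus E z) \<in> closure (interior E)"
    if z: "z \<in> U_set E" and u: "0 \<le> u" "u \<le> 1" for z u
  proof -
    let ?h = "\<lambda>u::real. (z, (1 - u) * f_minus E z + u * f_plus E z)"
    have "?h ` {0<..<1} \<subseteq> closure (interior E)"
    proof clarify
      fix u :: real assume u: "u \<in> {0<..<1}"
      have lt: "f_minus E z < f_plus E z" using z by (simp add: U_set_def)
      then have "u * (f_plus E z - f_minus E z) > 0" "(1 - u) * (f_plus E z - f_minus E z) > 0" using u by simp_all
      then have "?h u \<in> interior E" using z by (simp add: interior_E_eq algebra_simps)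
      then show "?h u \<in> closure (interior E)" using closure_subset by blast
    qed
    then have "?h ` closure {0<..<1} \<subseteq> closure (interior E)"
      by (intro image_closure_subset continuous_intros) auto
    then show ?thesis using u by auto
  qed
  show "E_hat E \<subseteq> closure (interior E)"
  proof (rule subrelI)
    fix z t assume "(z, t) \<in> E_hat E"
    then have z: "z \<in> closure (U_set E)" and zt: "z \<in> fst ` E" "f_minus E z \<le> t" "t \<le> f_plus E z"
      by (auto simp: E_hat_eq E_iff)
    obtain u where u: "0 \<le> u" "u \<le> 1" "t = (1 - u) * f_minus E z + u * f_plus E z"
    proof (cases "f_minus E z = f_plus E z")
      case True
      then show ?thesis using zt that[of 0] by simp
    next
      case False
      then have lt: "f_minus E z < f_plus E z" using zt by simp
      define l where "l = (t - f_minus E z) / (f_plus E z - f_minus E z)"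
      have "l * (f_plus E z - f_minus E z) = t - f_minus E z" using lt by (simp add: l_def)
      then show ?thesis using that[of l] zt lt by (simp add: algebra_simps) (simp add: l_def)
    qed
    let ?g = "\<lambda>z. (z, (1 - u) * f_minus E z + u * f_plus E z)"
    have "continuous_on (closure (U_set E)) ?g"
      by (intro continuous_intros continuous_on_subset[OF continuous_on_fibre_extrema(1) closure_U_set_subset]
          continuous_on_subset[OF continuous_on_fibre_extrema(2) closure_U_set_subset])
    then have "?g ` closure (U_set E) \<subseteq> closure (interior E)"
      by (rule image_closure_subset) (use U u in auto)
    then show "(z, t) \<in> closure (interior E)" using z u(3) by auto
  qed
qed

end

theorem theorem3p12:
  fixes E :: "'n::finite heis set"
  assumes "E \<in> isodiam_class UNIV \<union> isodiam_class rot_invariant"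
  shows
    "t_convex E \<and>
     (leb (E_hat E) = leb E \<and> cc_diam (E_hat E) = cc_diam E) \<and>
     ((E \<in> isodiam_class UNIV \<longrightarrow> E_hat E \<in> isodiam_class UNIV) \<and>
      (E \<in> isodiam_class rot_invariant \<longrightarrow> E_hat E \<in> isodiam_class rot_invariant)) \<and>
     (open (U_set E) \<and>
      locally_lipschitz_on (U_set E) (f_minus E) \<and> locally_lipschitz_on (U_set E) (f_plus E) \<and>
      continuous_on (fst ` E) (f_minus E) \<and> continuous_on (fst ` E) (f_plus E)) \<and>
     (interior E = interior (E_hat E) \<and>
      interior (E_hat E) = {(z, t). z \<in> U_set E \<and> f_minus E z < t \<and> t < f_plus E z} \<and>
      frontier (E_hat E) =
        {(z, f_plus E z) | z. z \<in> closure (U_set E)} \<union> {(z, f_minus E z) | z. z \<in> closure (U_set E)} \<and>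
      E_hat E = closure (interior E))"
proof -
  have 1: "isodiametric {0} E" if "E \<in> isodiam_class UNIV"
    using that by unfold_locales (auto simp: rot_class_zero)
  have 2: "isodiametric UNIV E" if "E \<in> isodiam_class rot_invariant"
    using that by unfold_locales (auto simp: rot_class_UNIV)
  have hat: "E \<in> isodiam_class UNIV \<longrightarrow> E_hat E \<in> isodiam_class UNIV"
    "E \<in> isodiam_class rot_invariant \<longrightarrow> E_hat E \<in> isodiam_class rot_invariant"
    using isodiametric.E_hat_isodiametric[OF 1] isodiametric.E_hat_isodiametric[OF 2]
    by (simp_all add: rot_class_zero rot_class_UNIV)
  obtain \<Theta> where "isodiametric \<Theta> E" using assms 1 2 by blast
  then interpret isodiametric \<Theta> E .
  show ?thesis
    by (intro conjI hat t_convex_E leb_E_hat cc_diam_E_hat open_U_set locally_lipschitz_fibre_extrema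
        continuous_on_fibre_extrema interior_E_hat[symmetric] interior_E_hat[THEN trans[OF _ interior_E_eq]]
        frontier_E_hat E_hat_eq_closure)
qed

end
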